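(* Let $\mathcal K$ be any of the categories $\mathcal P$, $\mathcal{PB}$, $\mathcal B$, $\mathscr P\mathcal P$, $\mathcal M$ or $\mathcal{TL}$, let $m,n\in\mathbb N$, and let $\sigma\in\mathcal K_{nm}$. Then $$P_1^\sigma=\{\alpha\in\mathcal K_{mn}:\operatorname{rank}(\alpha\sigma)=\operatorname{rank}(\alpha)\},\qquad P_2^\sigma=\{\alpha\in\mathcal K_{mn}:\operatorname{rank}(\sigma\alpha)=\operatorname{rank}(\alpha)\},$$ $$\operatorname{Reg}(\mathcal K_{mn}^\sigma)=P^\sigma=P_3^\sigma=\{\alpha\in\mathcal K_{mn}:\operatorname{rank}(\alpha\sigma)=\operatorname{rank}(\sigma\alpha)=\operatorname{rank}(\alpha)\}=\{\alpha\in\mathcal K_{mn}:\operatorname{rank}(\sigma\alpha\sigma)=\operatorname{rank}(\alpha)\}.$$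
   Context: $\mathbb N=\{0,1,2,\ldots\}$, $[n]=\{1,\ldots,n\}$ (with $[0]=\emptyset$), and $A'=\{a':a\in A\}$, $A''=\{a'':a\in A\}$ for $A\subseteq\mathbb N$. $\mathcal P_{mn}$ is the set of all set partitions of $[m]\cup[n]'$, and $\mathcal P=\bigcup_{m,n\in\mathbb N}\mathcal P_{mn}$. For $\alpha\in\mathcal P_{mn}$ and $\beta\in\mathcal P_{nk}$, the product $\alpha\beta\in\mathcal P_{mk}$ is formed as follows: identify partitions with graphs whose connected components are the blocks; let $\alpha_\downarrow$ be the graph on $[m]\cup[n]''$ obtained from $\alpha$ by renaming each $x'$ to $x''$, let $\beta^\uparrow$ be the graph on $[n]''\cup[k]'$ obtained from $\beta$ by renaming each $x\in[n]$ to $x''$, and let $\Pi(\alpha,\beta)$ be their union on $[m]\cup[n]''\cup[k]'$; two elements of $[m]\cup[k]'$ are in the same block of $\alpha\beta$ iff they are in the same component of $\Pi(\alpha,\beta)$. This makes $\mathcal P$ a category with object set $\mathbb N$. The rank of $\alpha\in\mathcal P_{mn}$ is the number of blocks meeting both $[m]$ and $[n]'$. Subcategories: $\mathcal B$ (Brauer) consists of the partitions all of whose blocks have size $2$; $\mathcal{PB}$ (partial Brauer) of those all of whose blocks have size $1$ or $2$; $\mathscr P\mathcal P$ of the planar partitions, i.e. those represented by some graph drawn in the plane with vertices $x$ at $(x,1)$ and $x'$ at $(x,0)$, edges inside the rectangle $1\le x\le\max(m,n)$, $0\le y\le1$, and no edge crossings in the interior of the rectangle; $\mathcal{TL}=\mathcal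 B\cap\mathscr P\mathcal P$ (Temperley-Lieb); $\mathcal M=\mathcal{PB}\cap\mathscr P\mathcal P$ (Motzkin). $\mathcal K_{mn}=\mathcal K\cap\mathcal P_{mn}$. For $\sigma\in\mathcal K_{nm}$, $\mathcal K_{mn}^\sigma$ is the set $\mathcal K_{mn}$ with operation $\alpha\star_\sigma\beta=\alpha\sigma\beta$; $\operatorname{Reg}(T)$ is the set of (von Neumann) regular elements of a semigroup $T$. Green's relations on the category $\mathcal K$: $\alpha\,\mathscr R\,\beta$ iff $\alpha=\beta\gamma$ and $\beta=\alpha\delta$ for some $\gamma,\delta\in\mathcal K$; $\alpha\,\mathscr L\,\beta$ iff $\alpha=\gamma\beta$ and $\beta=\delta\alpha$ for some $\gamma,\delta\in\mathcal K$; $\alpha\,\mathscr J\,\beta$ iff $\alpha=\gamma\beta\delta$ and $\beta=\gamma'\alpha\delta'$ for some $\gamma,\delta,\gamma',\delta'\in\mathcal K$. Define $P_1^\sigma=\{\alpha\in\mathcal K_{mn}:\alpha\sigma\,\mathscr R\,\alpha\}$, $P_2^\sigma=\{\alpha\in\mathcal K_{mn}:\sigma\alpha\,\mathscr L\,\alpha\}$, $P_3^\sigma=\{\alpha\in\mathcal K_{mn}:\sigma\alpha\sigma\,\mathscr J\,\alpha\}$, $P^\sigma=P_1^\sigma\cap P_2^\sigma$. *)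

theory Defs
  imports "HOL-Analysis.Analysis"
begin

datatype vertex = Upper nat | Lower nat | Middle nat
  \<comment> \<open>\<open>Upper x\<close>, \<open>Lower x\<close>, \<open>Middle x\<close> stand for \<open>x\<close>, \<open>x'\<close>, \<open>x''\<close>\<close>

definition verts :: "nat \<Rightarrow> nat \<Rightarrow> vertex set" where
  "verts m n = Upper ` {1..m} \<union> Lower ` {1..n}"

text \<open>A partition is given by its set of blocks; \<open>m\<close> and \<open>n\<close> can be recovered from the
  union of the blocks, so the hom-sets \<open>Part m n\<close> are pairwise disjoint.\<close>

definition Part :: "nat \<Rightarrow> nat \<Rightarrow> vertex set set set" where
  "Part m n = {\<alpha>. partition_on (verts m n) \<alpha>}"

definition part_rank :: "vertex set set \<Rightarrow> nat" where
  "part_rank \<alpha> = card {B \<in> \<alpha>. B \<inter> range Upper \<noteq> {} \<and> B \<inter> range Lower \<noteq> {}}"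


text \<open>Graphs are simple and are given by their edge sets, edges being two-element sets of
  vertices.  \<open>classes_on X E\<close> is the partition of \<open>X\<close> in which two elements lie in the same
  block iff they are in the same component of the graph; paths may leave \<open>X\<close>.\<close>

definition joined :: "vertex set set \<Rightarrow> (vertex \<times> vertex) set" where
  "joined E = {(x, y). {x, y} \<in> E}\<^sup>*"

definition classes_on :: "vertex set \<Rightarrow> vertex set set \<Rightarrow> vertex set set" where
  "classes_on X E = X // (joined E \<inter> X \<times> X)"

definition represents :: "nat \<Rightarrow> nat \<Rightarrow> vertex set set \<Rightarrow> vertex set set \<Rightarrow> bool" where
  "represents m n E \<alpha> \<longleftrightarrow>
     (\<forall>e\<in>E. e \<subseteq> verts m n \<and> card e = 2) \<and> classes_on (verts m n) E = \<alpha>"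


text \<open>Among the graphs representing a partition, the product uses the one in which every
  block is complete; the product does not depend on this choice.\<close>

definition block_graph :: "vertex set set \<Rightarrow> vertex set set" where
  "block_graph \<alpha> = {e. card e = 2 \<and> (\<exists>B\<in>\<alpha>. e \<subseteq> B)}"

fun lower_to_middle :: "vertex \<Rightarrow> vertex" where
  "lower_to_middle (Lower x) = Middle x"
| "lower_to_middle v = v"

fun upper_to_middle :: "vertex \<Rightarrow> vertex" where
  "upper_to_middle (Upper x) = Middle x"
| "upper_to_middle v = v"

definition product_graph :: "vertex set set \<Rightarrow> vertex set set \<Rightarrow> vertex set set" where
  "product_graph \<alpha> \<beta> =
     (\<lambda>e. lower_to_middle ` e) ` block_graph \<alpha> \<union> (\<lambda>e. upper_to_middle ` e) ` block_graph \<beta>"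

text \<open>The product is meaningful only for composable arguments: \<open>\<alpha> \<in> Part m n\<close> and
  \<open>\<beta> \<in> Part n k\<close>, in which case the vertex set below is \<open>verts m k\<close>.\<close>

definition part_prod :: "vertex set set \<Rightarrow> vertex set set \<Rightarrow> vertex set set" (infixl "\<odot>" 70) where
  "\<alpha> \<odot> \<beta> = classes_on ((\<Union>\<alpha> \<inter> range Upper) \<union> (\<Union>\<beta> \<inter> range Lower)) (product_graph \<alpha> \<beta>)"

definition composable :: "vertex set set \<Rightarrow> vertex set set \<Rightarrow> bool" where
  "composable \<alpha> \<beta> \<longleftrightarrow> (\<exists>m n k. \<alpha> \<in> Part m n \<and> \<beta> \<in> Part n k)"


fun position :: "vertex \<Rightarrow> real ^ 2" where
  "position (Upper x) = vector [real x, 1]"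
| "position (Lower x) = vector [real x, 0]"

definition rectangle :: "nat \<Rightarrow> nat \<Rightarrow> (real ^ 2) set" where
  "rectangle m n = cbox (vector [1, 0]) (vector [real (max m n), 1])"

text \<open>A crossing-free drawing of a graph in the closed rectangle: each edge is an arc that
  meets the vertices only in its two ends, and distinct edges meet only in common end vertices.
  Edges may run along the boundary of the rectangle (as they must if \<open>max m n = 1\<close>), so the
  last two conditions have to be imposed on the boundary as well: otherwise an edge could
  pass another vertex, or cross another edge, there, and every partition would be planar.\<close>

definition planar_drawing ::
  "nat \<Rightarrow> nat \<Rightarrow> vertex set set \<Rightarrow> (vertex set \<Rightarrow> real \<Rightarrow> real ^ 2) \<Rightarrow> bool" where
  "planar_drawing m n E g \<longleftrightarrow>
     (\<forall>e\<in>E. arc (g e) \<and> {pathstart (g e), pathfinish (g e)} = position ` e \<and>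
        path_image (g e) \<subseteq> rectangle m n \<and>
        path_image (g e) \<inter> position ` verts m n = position ` e) \<and>
     (\<forall>e\<in>E. \<forall>f\<in>E. e \<noteq> f \<longrightarrow>
        path_image (g e) \<inter> path_image (g f) \<subseteq> position ` (e \<inter> f))"

definition planar :: "nat \<Rightarrow> nat \<Rightarrow> vertex set set \<Rightarrow> bool" where
  "planar m n \<alpha> \<longleftrightarrow> (\<exists>E g. represents m n E \<alpha> \<and> planar_drawing m n E g)"


definition P_cat :: "vertex set set set" where
  "P_cat = (\<Union>m n. Part m n)"

definition PB_cat :: "vertex set set set" where
  "PB_cat = {\<alpha> \<in> P_cat. \<forall>B\<in>\<alpha>. card B = 1 \<or> card B = 2}"

definition B_cat :: "vertex set set set" where
  "B_cat = {\<alpha> \<in> P_cat. \<forall>B\<in>\<alpha>. card B = 2}"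

definition PP_cat :: "vertex set set set" where
  "PP_cat = (\<Union>m n. {\<alpha> \<in> Part m n. planar m n \<alpha>})"

definition M_cat :: "vertex set set set" where
  "M_cat = PB_cat \<inter> PP_cat"

definition TL_cat :: "vertex set set set" where
  "TL_cat = B_cat \<inter> PP_cat"

definition hom_set :: "vertex set set set \<Rightarrow> nat \<Rightarrow> nat \<Rightarrow> vertex set set set" where
  "hom_set K m n = K \<inter> Part m n"


definition green_R :: "vertex set set set \<Rightarrow> vertex set set \<Rightarrow> vertex set set \<Rightarrow> bool" where
  "green_R K \<alpha> \<beta> \<longleftrightarrow> \<alpha> \<in> K \<and> \<beta> \<in> K \<and>
     (\<exists>\<gamma>\<in>K. composable \<beta> \<gamma> \<and> \<alpha> = \<beta> \<odot> \<gamma>) \<and>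
     (\<exists>\<delta>\<in>K. composable \<alpha> \<delta> \<and> \<beta> = \<alpha> \<odot> \<delta>)"

definition green_L :: "vertex set set set \<Rightarrow> vertex set set \<Rightarrow> vertex set set \<Rightarrow> bool" where
  "green_L K \<alpha> \<beta> \<longleftrightarrow> \<alpha> \<in> K \<and> \<beta> \<in> K \<and>
     (\<exists>\<gamma>\<in>K. composable \<gamma> \<beta> \<and> \<alpha> = \<gamma> \<odot> \<beta>) \<and>
     (\<exists>\<delta>\<in>K. composable \<delta> \<alpha> \<and> \<beta> = \<delta> \<odot> \<alpha>)"

definition green_J :: "vertex set set set \<Rightarrow> vertex set set \<Rightarrow> vertex set set \<Rightarrow> bool" where
  "green_J K \<alpha> \<beta> \<longleftrightarrow> \<alpha> \<in> K \<and> \<beta> \<in> K \<and>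
     (\<exists>\<gamma>\<in>K. \<exists>\<delta>\<in>K. composable \<gamma> \<beta> \<and> composable \<beta> \<delta> \<and> \<alpha> = \<gamma> \<odot> \<beta> \<odot> \<delta>) \<and>
     (\<exists>\<gamma>\<in>K. \<exists>\<delta>\<in>K. composable \<gamma> \<alpha> \<and> composable \<alpha> \<delta> \<and> \<beta> = \<gamma> \<odot> \<alpha> \<odot> \<delta>)"

definition P1 :: "vertex set set set \<Rightarrow> nat \<Rightarrow> nat \<Rightarrow> vertex set set \<Rightarrow> vertex set set set" where
  "P1 K m n \<sigma> = {\<alpha> \<in> hom_set K m n. green_R K (\<alpha> \<odot> \<sigma>) \<alpha>}"

definition P2 :: "vertex set set set \<Rightarrow> nat \<Rightarrow> nat \<Rightarrow> vertex set set \<Rightarrow> vertex set set set" where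
  "P2 K m n \<sigma> = {\<alpha> \<in> hom_set K m n. green_L K (\<sigma> \<odot> \<alpha>) \<alpha>}"

definition P3 :: "vertex set set set \<Rightarrow> nat \<Rightarrow> nat \<Rightarrow> vertex set set \<Rightarrow> vertex set set set" where
  "P3 K m n \<sigma> = {\<alpha> \<in> hom_set K m n. green_J K (\<sigma> \<odot> \<alpha> \<odot> \<sigma>) \<alpha>}"

definition P12 :: "vertex set set set \<Rightarrow> nat \<Rightarrow> nat \<Rightarrow> vertex set set \<Rightarrow> vertex set set set" where
  "P12 K m n \<sigma> = P1 K m n \<sigma> \<inter> P2 K m n \<sigma>"


definition sandwich :: "vertex set set \<Rightarrow> vertex set set \<Rightarrow> vertex set set \<Rightarrow> vertex set set" where
  "sandwich \<sigma> \<alpha> \<beta> = \<alpha> \<odot> \<sigma> \<odot> \<beta>"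

definition Reg :: "'a set \<Rightarrow> ('a \<Rightarrow> 'a \<Rightarrow> 'a) \<Rightarrow> 'a set" where
  "Reg T f = {a \<in> T. \<exists>x\<in>T. a = f (f a x) a}"

end

theory Submission
  imports Defs
begin

text \<open>
  Write \<open>\<alpha>\<^sup>*\<close> for \<open>\<alpha>\<close> turned upside down (\<open>star \<alpha>\<close> below).  This involution satisfies
  \<open>\<alpha>\<^sup>*\<^sup>* = \<alpha>\<close>, \<open>(\<alpha>\<beta>)\<^sup>* = \<beta>\<^sup>*\<alpha>\<^sup>*\<close> and \<open>\<alpha>\<alpha>\<^sup>*\<alpha> = \<alpha>\<close>, and each of the six categories is closed under
  products and under the involution.  The heart of the argument is \<open>retract_right\<close>:
  if \<open>rank (\<alpha>\<sigma>) = rank \<alpha>\<close>, then \<open>\<alpha> = \<alpha>\<sigma>(\<sigma>\<^sup>*\<alpha>\<^sup>*\<alpha>)\<close>.  Indeed multiplication by \<open>\<sigma>\<close> on the right can only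
  merge transversal blocks of \<open>\<alpha>\<close> (those meeting both rows) or cut their upper parts off from the
  lower row; if the rank does not drop it does neither, so \<open>\<alpha>\<close> and \<open>\<tau> = \<alpha>\<sigma>\<close> have the
  same upper kernel and the same upper domain (\<open>part_rank_prod_left\<close>).  As \<open>\<tau>\<tau>\<^sup>*\<close> depends on these data only (\<open>prod_star_cong\<close>), it follows
  that \<open>\<alpha> = \<alpha>\<alpha>\<^sup>*\<alpha> = \<tau>\<tau>\<^sup>*\<alpha> = \<alpha>\<sigma>\<sigma>\<^sup>*\<alpha>\<^sup>*\<alpha>\<close>.  Together with the involution, with associativity and with the
  fact that a product has rank at most that of each factor, this turns every condition on Green's
  relations, and regularity, into a condition on ranks, uniformly for all six categories.

  Products are handled by placing partitions between numbered levels of \<open>\<nat> \<times> \<nat>\<close>; the product is then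
  a connectivity relation restricted to the outer levels, and one lemma on transitive closures
  (\<open>rtrancl_contract\<close>) gives associativity.

  Closure under products is easy for all partitions.  If all blocks have at most two elements, the
  components of the product graph are paths or cycles, and the outer vertices have degree at most one,
  so a component contains at most two outer vertices (\<open>two_ends_per_component\<close>); if all blocks have
  exactly two elements, the number of outer vertices in a component is even.
  For planar partitions, call a partition noncrossing if no two of its blocks interlace along the
  boundary of the rectangle.  If drawings of \<open>\<alpha>\<close> and \<open>\<beta>\<close> are stacked, with a strip of vertical
  segments between them, then two interlacing blocks of \<open>\<alpha>\<beta>\<close> would give two disjoint paths in
  the rectangle with interlacing ends, which is impossible by Fashoda's theorem
  (\<open>interlaced_paths_meet\<close>); so \<open>\<alpha>\<beta>\<close> is noncrossing (\<open>prod_noncrossing\<close>).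
  Conversely a noncrossing partition is planar: join consecutive elements of each block by flat
  parabolic arches along the top and bottom edges, and by curves from the bottom to the top edge that
  are vertical near both edges (\<open>noncrossing_imp_planar\<close>).
\<close>

section \<open>Partitions as equivalence relations\<close>

text \<open>The equivalence relation whose classes are the blocks of \<open>\<alpha>\<close>.\<close>
definition same :: "vertex set set \<Rightarrow> (vertex \<times> vertex) set" where
  "same \<alpha> = {(u, v). \<exists>B\<in>\<alpha>. u \<in> B \<and> v \<in> B}"

lemma verts_simps [simp]:
  "Upper x \<in> verts m n \<longleftrightarrow> x \<in> {1..m}"
  "Lower x \<in> verts m n \<longleftrightarrow> x \<in> {1..n}"
  "Middle x \<notin> verts m n"
  by (auto simp: verts_def)

lemma finite_verts [simp]: "finite (verts m n)"
  by (simp add: verts_def)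

lemma verts_inject: "verts m n = verts m' n' \<longleftrightarrow> m = m' \<and> n = n'"
proof
  assume eq: "verts m n = verts m' n'"
  have "{1..m} = {x. Upper x \<in> verts m n}" "{1..m'} = {x. Upper x \<in> verts m' n'}"
    "{1..n} = {x. Lower x \<in> verts m n}" "{1..n'} = {x. Lower x \<in> verts m' n'}" by auto
  with eq have "card {1..m} = card {1..m'}" "card {1..n} = card {1..n'}" by auto
  then show "m = m' \<and> n = n'" by simp
qed auto

lemma Union_Part: "\<alpha> \<in> Part m n \<Longrightarrow> \<Union>\<alpha> = verts m n"
  by (auto simp: Part_def partition_on_def)

lemma Part_unique: "\<alpha> \<in> Part m n \<Longrightarrow> \<alpha> \<in> Part m' n' \<Longrightarrow> m = m' \<and> n = n'"
  using Union_Part verts_inject by metis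

lemma equiv_same: "\<alpha> \<in> Part m n \<Longrightarrow> equiv (verts m n) (same \<alpha>)"
  using equiv_partition_on[of "verts m n" \<alpha>] by (simp add: Part_def same_def)

lemma same_quotient: "\<alpha> \<in> Part m n \<Longrightarrow> verts m n // same \<alpha> = \<alpha>"
  using partition_on_eq_quotient[of "verts m n" \<alpha>] by (simp add: Part_def same_def)

lemma quotient_in_Part: "equiv (verts m n) r \<Longrightarrow> verts m n // r \<in> Part m n"
  by (simp add: Part_def partition_on_quotient)

lemma same_of_quotient:
  assumes "equiv A r"
  shows "same (A // r) = r"
proof (intro equalityI subrelI)
  fix u v assume "(u, v) \<in> same (A // r)"
  then obtain B where "B \<in> A // r" "u \<in> B" "v \<in> B" by (auto simp: same_def)
  with assms show "(u, v) \<in> r" by (meson quotient_eq_iff)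
next
  fix u v assume uv: "(u, v) \<in> r"
  with assms have "u \<in> A" "(u, u) \<in> r" by (auto simp: equiv_class_eq_iff)
  with uv have "r `` {u} \<in> A // r" "u \<in> r `` {u}" "v \<in> r `` {u}" by (auto intro: quotientI)
  then show "(u, v) \<in> same (A // r)" unfolding same_def by blast
qed

lemma same_cong: "\<alpha> \<in> Part m n \<Longrightarrow> \<beta> \<in> Part m n \<Longrightarrow> same \<alpha> = same \<beta> \<Longrightarrow> \<alpha> = \<beta>"
  using same_quotient by metis

lemma same_sym: "(u, v) \<in> same \<alpha> \<Longrightarrow> (v, u) \<in> same \<alpha>"
  by (auto simp: same_def)

lemma same_trans:
  "\<alpha> \<in> Part m n \<Longrightarrow> (u, v) \<in> same \<alpha> \<Longrightarrow> (v, w) \<in> same \<alpha> \<Longrightarrow> (u, w) \<in> same \<alpha>"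
  using transD[of "same \<alpha>" u v w] equiv_same[of \<alpha> m n] unfolding equiv_def by blast

lemma same_refl: "\<alpha> \<in> Part m n \<Longrightarrow> u \<in> verts m n \<Longrightarrow> (u, u) \<in> same \<alpha>"
  using refl_onD[of "verts m n" "same \<alpha>"] equiv_same[of \<alpha> m n] unfolding equiv_def by blast

lemma same_verts: "\<alpha> \<in> Part m n \<Longrightarrow> (u, v) \<in> same \<alpha> \<Longrightarrow> u \<in> verts m n \<and> v \<in> verts m n"
  using Union_Part[of \<alpha> m n] by (auto simp: same_def)

lemma rtrancl_map_inj:
  assumes "inj f"
  shows "(f x, f y) \<in> (map_prod f f ` R)\<^sup>* \<longleftrightarrow> (x, y) \<in> R\<^sup>*"
proof
  assume "(f x, f y) \<in> (map_prod f f ` R)\<^sup>*"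
  moreover have "(inv f p, inv f q) \<in> R\<^sup>*" if "(p, q) \<in> (map_prod f f ` R)\<^sup>*" for p q
    using that
  proof induction
    case (step y z)
    then show ?case using assms by (auto intro: rtrancl.rtrancl_into_rtrancl)
  qed simp
  ultimately have "(inv f (f x), inv f (f y)) \<in> R\<^sup>*" by blast
  with assms show "(x, y) \<in> R\<^sup>*" by simp
next
  assume "(x, y) \<in> R\<^sup>*"
  then show "(f x, f y) \<in> (map_prod f f ` R)\<^sup>*"
  proof induction
    case (step y z)
    then show ?case by (auto intro: rtrancl.rtrancl_into_rtrancl)
  qed simp
qed

text \<open>Connectivity, within \<open>Y\<close>, in a union \<open>R \<union> S\<close>: the part \<open>R\<close> may be replaced by the connectivity
  relation that it induces on \<open>X\<close>, provided that \<open>X\<close> contains every point through which \<open>R\<close> can be left.\<close>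
lemma rtrancl_contract:
  assumes "Field R \<inter> (Field S \<union> Y) \<subseteq> X"
    and "y \<in> Y" "y' \<in> Y"
  shows "(y, y') \<in> (R \<union> S)\<^sup>* \<longleftrightarrow> (y, y') \<in> (R\<^sup>* \<inter> X \<times> X \<union> S)\<^sup>*" (is "_ \<longleftrightarrow> _ \<in> ?T\<^sup>*")
proof
  have "?T \<subseteq> (R \<union> S)\<^sup>*"
    by (auto intro: in_rtrancl_UnI)
  then show "(y, y') \<in> ?T\<^sup>* \<Longrightarrow> (y, y') \<in> (R \<union> S)\<^sup>*"
    using rtrancl_subset_rtrancl by blast
next
  have inX: "z \<in> X" if "(w, z) \<in> R\<^sup>*" "w \<in> X" "z \<in> Field S \<union> Y" for w z
    using that(1)
  proof (cases rule: rtranclE)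
    case base
    with that show ?thesis by simp
  next
    case (step x)
    then have "z \<in> Field R" by (auto simp: Field_def)
    with that assms(1) show ?thesis by blast
  qed
  assume "(y, y') \<in> (R \<union> S)\<^sup>*"
  \<comment> \<open>Along a path, either the current point is reached in the contracted graph, or the path is
    in the middle of an excursion into \<open>R\<close> that started at a point \<open>w\<close> of \<open>X\<close>.\<close>
  then have "(y, y') \<in> ?T\<^sup>* \<or> (\<exists>w\<in>X. (y, w) \<in> ?T\<^sup>* \<and> (w, y') \<in> R\<^sup>*)"
  proof induction
    case (step z z')
    show ?case
    proof (cases "(z, z') \<in> S")
      case True
      then have "z \<in> Field S" by (auto simp: Field_def)
      with step.IH have "(y, z) \<in> ?T\<^sup>*"
        using inX by (meson IntI SigmaI UnCI rtrancl.rtrancl_into_rtrancl)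
      with True show ?thesis by (meson UnCI rtrancl.rtrancl_into_rtrancl)
    next
      case False
      with step.hyps have zz: "(z, z') \<in> R" by blast
      have "\<exists>w\<in>X. (y, w) \<in> ?T\<^sup>* \<and> (w, z) \<in> R\<^sup>*"
      proof (cases "(y, z) \<in> ?T\<^sup>*")
        case True
        then have "z \<in> X"
        proof (cases rule: rtranclE)
          case base
          then show ?thesis using zz assms by (auto simp: Field_def)
        next
          case (step w)
          then show ?thesis using zz assms by (auto simp: Field_def)
        qed
        with True show ?thesis by blast
      qed (use step.IH in blast)
      with zz show ?thesis by (meson rtrancl.rtrancl_into_rtrancl)
    qed
  qed simp
  then show "(y, y') \<in> ?T\<^sup>*"
    using inX assms(3) by (meson IntI SigmaI UnCI rtrancl.rtrancl_into_rtrancl)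
qed

section \<open>Partitions placed between levels\<close>

text \<open>The vertices are embedded in \<open>\<nat> \<times> \<nat>\<close>: the upper, middle and lower rows go to the levels
  \<open>i\<close>, \<open>j\<close> and \<open>k\<close>.  A partition has no middle vertices, so for partitions the second level is immaterial,
  and an arbitrary \<open>0\<close> is used for it.\<close>
definition slot :: "nat \<Rightarrow> nat \<Rightarrow> nat \<Rightarrow> vertex \<Rightarrow> nat \<times> nat" where
  "slot i j k v = (case v of Upper x \<Rightarrow> (i, x) | Middle x \<Rightarrow> (j, x) | Lower x \<Rightarrow> (k, x))"

text \<open>The relation \<open>same \<alpha>\<close>, transported to the levels \<open>i\<close> (upper row) and \<open>k\<close> (lower row).\<close>
definition placed :: "nat \<Rightarrow> nat \<Rightarrow> vertex set set \<Rightarrow> ((nat \<times> nat) \<times> (nat \<times> nat)) set" where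
  "placed i k \<alpha> = map_prod (slot i 0 k) (slot i 0 k) ` same \<alpha>"

text \<open>The image of \<open>verts m n\<close> when its rows are placed at the levels \<open>i\<close> and \<open>k\<close>.\<close>
definition ends :: "nat \<Rightarrow> nat \<Rightarrow> nat \<Rightarrow> nat \<Rightarrow> (nat \<times> nat) set" where
  "ends i m k n = {i} \<times> {1..m} \<union> {k} \<times> {1..n}"

lemma slot_simps [simp]:
  "slot i j k (Upper x) = (i, x)" "slot i j k (Middle x) = (j, x)" "slot i j k (Lower x) = (k, x)"
  by (simp_all add: slot_def)

lemma slot_verts: "slot i j k ` verts m n = ends i m k n"
  by (auto simp: verts_def ends_def image_Un image_image)

lemma inj_slot: "i \<noteq> j \<Longrightarrow> i \<noteq> k \<Longrightarrow> j \<noteq> k \<Longrightarrow> inj (slot i j k)"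
  by (auto simp: inj_def slot_def split: vertex.splits)

lemma verts_cases:
  assumes "u \<in> verts m n"
  obtains x where "u = Upper x" "x \<in> {1..m}" | x where "u = Lower x" "x \<in> {1..n}"
  using assms by (auto simp: verts_def)

lemma slot_middle_cong: "u \<in> verts m n \<Longrightarrow> slot i j k u = slot i j' k u"
  by (erule verts_cases) auto

lemma placed_iff:
  assumes "\<alpha> \<in> Part m n" "i \<noteq> k" "u \<in> verts m n" "v \<in> verts m n"
  shows "(slot i j k u, slot i j k v) \<in> placed i k \<alpha> \<longleftrightarrow> (u, v) \<in> same \<alpha>"
proof
  have inj: "u' = u" if "slot i j k u = slot i 0 k u'" "u \<in> verts m n" "u' \<in> verts m n" for u u'
    using that assms(2) by (auto elim!: verts_cases)
  assume "(slot i j k u, slot i j k v) \<in> placed i k \<alpha>"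
  then obtain u' v' where uv: "(u', v') \<in> same \<alpha>" "slot i j k u = slot i 0 k u'"
    "slot i j k v = slot i 0 k v'"
    by (auto simp: placed_def)
  with same_verts[OF assms(1) uv(1)] inj[of u u'] inj[of v v'] assms
  show "(u, v) \<in> same \<alpha>" by simp
next
  assume "(u, v) \<in> same \<alpha>"
  then show "(slot i j k u, slot i j k v) \<in> placed i k \<alpha>"
    using assms slot_middle_cong[of u m n i j k 0] slot_middle_cong[of v m n i j k 0]
    by (auto simp: placed_def)
qed

lemma placedE:
  assumes "(p, q) \<in> placed i k \<alpha>" "\<alpha> \<in> Part m n"
  obtains u v where "p = slot i 0 k u" "q = slot i 0 k v" "(u, v) \<in> same \<alpha>"
    "u \<in> verts m n" "v \<in> verts m n"
  using assms same_verts[OF assms(2)] by (auto simp: placed_def)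

lemma ends_mem [simp]: "(a, x) \<in> ends i m k n \<longleftrightarrow> a = i \<and> x \<in> {1..m} \<or> a = k \<and> x \<in> {1..n}"
  by (auto simp: ends_def)

lemma placed_ends:
  assumes "\<alpha> \<in> Part m n"
  shows "placed i k \<alpha> \<subseteq> ends i m k n \<times> ends i m k n" "Field (placed i k \<alpha>) \<subseteq> ends i m k n"
proof -
  show "placed i k \<alpha> \<subseteq> ends i m k n \<times> ends i m k n"
    using same_verts[OF assms] by (auto simp: placed_def simp flip: slot_verts[of i 0 k])
  then show "Field (placed i k \<alpha>) \<subseteq> ends i m k n" by (auto simp: Field_def)
qed

lemma placed_iffs:
  assumes "\<alpha> \<in> Part m n" "i \<noteq> k"
  shows "((i, x), (i, y)) \<in> placed i k \<alpha> \<longleftrightarrow> (Upper x, Upper y) \<in> same \<alpha>"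
    and "((i, x), (k, y)) \<in> placed i k \<alpha> \<longleftrightarrow> (Upper x, Lower y) \<in> same \<alpha>"
    and "((k, x), (i, y)) \<in> placed i k \<alpha> \<longleftrightarrow> (Lower x, Upper y) \<in> same \<alpha>"
    and "((k, x), (k, y)) \<in> placed i k \<alpha> \<longleftrightarrow> (Lower x, Lower y) \<in> same \<alpha>"
proof -
  have *: "(slot i 0 k u, slot i 0 k v) \<in> placed i k \<alpha> \<longleftrightarrow> (u, v) \<in> same \<alpha>"
    if "u \<notin> range Middle" "v \<notin> range Middle" for u v
  proof -
    have "w \<in> verts m n" if "slot i 0 k w \<in> ends i m k n" "w \<notin> range Middle" for w
      using that assms(2) by (cases w) auto
    with that show ?thesis
      using placed_iff[OF assms, of u v 0] same_verts[OF assms(1), of u v] placed_ends(1)[OF assms(1), of i k]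
      by blast
  qed
  show "((i, x), (i, y)) \<in> placed i k \<alpha> \<longleftrightarrow> (Upper x, Upper y) \<in> same \<alpha>"
    "((i, x), (k, y)) \<in> placed i k \<alpha> \<longleftrightarrow> (Upper x, Lower y) \<in> same \<alpha>"
    "((k, x), (i, y)) \<in> placed i k \<alpha> \<longleftrightarrow> (Lower x, Upper y) \<in> same \<alpha>"
    "((k, x), (k, y)) \<in> placed i k \<alpha> \<longleftrightarrow> (Lower x, Lower y) \<in> same \<alpha>"
    using *[of "Upper x" "Upper y"] *[of "Upper x" "Lower y"] *[of "Lower x" "Upper y"]
      *[of "Lower x" "Lower y"] by auto
qed

lemma placed_cong:
  assumes "\<alpha> \<in> Part m n" "\<beta> \<in> Part m n" "i \<noteq> k" "placed i k \<alpha> = placed i k \<beta>"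
  shows "\<alpha> = \<beta>"
proof (rule same_cong[OF assms(1,2)])
  have "(u, v) \<in> same \<alpha> \<longleftrightarrow> (u, v) \<in> same \<beta>" if "u \<in> verts m n" "v \<in> verts m n" for u v
    using placed_iff[OF assms(1,3) that, of 0] placed_iff[OF assms(2,3) that, of 0] assms(4) by simp
  then show "same \<alpha> = same \<beta>"
    using same_verts[OF assms(1)] same_verts[OF assms(2)] by (meson subrelI subset_antisym)
qed

section \<open>The product\<close>

text \<open>Since the blocks are complete graphs, edges of the product graph and pairs of the two
  equivalence relations differ only by loops.\<close>
lemma joined_product_graph:
  "joined (product_graph \<alpha> \<beta>) =
    (map_prod lower_to_middle lower_to_middle ` same \<alpha> \<union>
     map_prod upper_to_middle upper_to_middle ` same \<beta>)\<^sup>*" (is "_ = ?R\<^sup>*")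
proof -
  let ?Q = "{(x, y). {x, y} \<in> product_graph \<alpha> \<beta>}"
  have image_in: "(x, y) \<in> map_prod f f ` same \<gamma>" if "{x, y} \<in> (`) f ` block_graph \<gamma>" for x y f \<gamma>
  proof -
    from that obtain e B where e: "{x, y} = f ` e" "e \<subseteq> B" "B \<in> \<gamma>" by (auto simp: block_graph_def)
    then have "x \<in> f ` e" "y \<in> f ` e" by (metis insertI1 insertI2)+
    then obtain a b where "a \<in> e" "b \<in> e" "x = f a" "y = f b" by blast
    moreover with e have "(a, b) \<in> same \<gamma>" by (auto simp: same_def)
    ultimately show ?thesis by (metis imageI map_prod_simp)
  qed
  have Q_R: "?Q \<subseteq> ?R"
  proof (rule subrelI)
    fix x y assume "(x, y) \<in> ?Q"
    then have "{x, y} \<in> (`) lower_to_middle ` block_graph \<alpha> \<or>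
        {x, y} \<in> (`) upper_to_middle ` block_graph \<beta>"
      by (simp add: product_graph_def)
    then show "(x, y) \<in> ?R"
      using image_in[of x y lower_to_middle \<alpha>] image_in[of x y upper_to_middle \<beta>] by (metis UnCI)
  qed
  have in_Q: "map_prod f f ` same \<gamma> \<subseteq> {(x, y). {x, y} \<in> (`) f ` block_graph \<gamma>}\<^sup>=" for f \<gamma>
  proof safe
    fix a b assume "(a, b) \<in> same \<gamma>" "f a \<noteq> f b"
    then have "{a, b} \<in> block_graph \<gamma>" by (cases "a = b") (auto simp: same_def block_graph_def)
    then have "f ` {a, b} \<in> (`) f ` block_graph \<gamma>" by (rule imageI)
    then show "{f a, f b} \<in> (`) f ` block_graph \<gamma>" by simp
  qed
  have Un_mem: "P \<union> P' \<subseteq> {(x, y). {x, y} \<in> G \<union> G'}\<^sup>="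
    if "P \<subseteq> {(x, y). {x, y} \<in> G}\<^sup>=" "P' \<subseteq> {(x, y). {x, y} \<in> G'}\<^sup>="
    for P P' :: "(vertex \<times> vertex) set" and G G' :: "vertex set set"
    using that by blast
  have "?R \<subseteq> ?Q\<^sup>="
    unfolding product_graph_def by (rule Un_mem; rule in_Q)
  then show ?thesis
    using Q_R unfolding joined_def by (metis rtrancl_mono rtrancl_reflcl subset_antisym)
qed

lemma sym_joined: "sym (joined E)"
  unfolding joined_def by (rule sym_rtrancl) (auto simp: sym_def insert_commute)

lemma equiv_joined: "equiv X (joined E \<inter> X \<times> X)"
  using sym_joined[of E]
  by (auto simp: equiv_def refl_on_def joined_def sym_def trans_def)

lemma part_prod_eq:
  assumes "\<alpha> \<in> Part m n" "\<beta> \<in> Part n k"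
  shows "\<alpha> \<odot> \<beta> = classes_on (verts m k) (product_graph \<alpha> \<beta>)"
proof -
  have "\<Union>\<alpha> \<inter> range Upper \<union> \<Union>\<beta> \<inter> range Lower = verts m k"
    using Union_Part[OF assms(1)] Union_Part[OF assms(2)] by (auto simp: verts_def)
  then show ?thesis by (simp add: part_prod_def)
qed

lemma part_prod_Part: "\<alpha> \<in> Part m n \<Longrightarrow> \<beta> \<in> Part n k \<Longrightarrow> \<alpha> \<odot> \<beta> \<in> Part m k"
  by (simp add: part_prod_eq classes_on_def quotient_in_Part equiv_joined)

lemma same_part_prod:
  assumes "\<alpha> \<in> Part m n" "\<beta> \<in> Part n k"
  shows "same (\<alpha> \<odot> \<beta>) = joined (product_graph \<alpha> \<beta>) \<inter> verts m k \<times> verts m k"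
  by (simp add: part_prod_eq[OF assms] classes_on_def same_of_quotient equiv_joined)

text \<open>The product of \<open>\<alpha>\<close> and \<open>\<beta>\<close> is connectivity in the stacked picture, restricted to the outer levels.\<close>
lemma placed_prod:
  assumes \<alpha>: "\<alpha> \<in> Part m n" and \<beta>: "\<beta> \<in> Part n l" and ne: "i \<noteq> j" "i \<noteq> k" "j \<noteq> k"
  shows "placed i k (\<alpha> \<odot> \<beta>) = (placed i j \<alpha> \<union> placed j k \<beta>)\<^sup>* \<inter> ends i m k l \<times> ends i m k l"
proof -
  let ?s = "slot i j k" and ?X = "ends i m k l"
  have ab: "map_prod ?s ?s ` map_prod lower_to_middle lower_to_middle ` same \<alpha> = placed i j \<alpha>"
    "map_prod ?s ?s ` map_prod upper_to_middle upper_to_middle ` same \<beta> = placed j k \<beta>"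
  proof -
    have 1: "slot i j k (lower_to_middle u) = slot i 0 j u" if "u \<in> verts m n" for u
      using that by (rule verts_cases) auto
    have 2: "slot i j k (upper_to_middle u) = slot j 0 k u" if "u \<in> verts n l" for u
      using that by (rule verts_cases) auto
    show "map_prod ?s ?s ` map_prod lower_to_middle lower_to_middle ` same \<alpha> = placed i j \<alpha>"
      unfolding placed_def image_image using same_verts[OF \<alpha>] by (intro image_cong) (auto simp: 1)
    show "map_prod ?s ?s ` map_prod upper_to_middle upper_to_middle ` same \<beta> = placed j k \<beta>"
      unfolding placed_def image_image using same_verts[OF \<beta>] by (intro image_cong) (auto simp: 2)
  qed
  have main: "(u, v) \<in> same (\<alpha> \<odot> \<beta>) \<longleftrightarrow> (?s u, ?s v) \<in> (placed i j \<alpha> \<union> placed j k \<beta>)\<^sup>*"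
    if "u \<in> verts m l" "v \<in> verts m l" for u v
    using that rtrancl_map_inj[OF inj_slot[OF ne], of u v]
    by (simp add: same_part_prod[OF \<alpha> \<beta>] joined_product_graph flip: image_Un ab)
  show ?thesis
  proof (intro equalityI subrelI)
    fix p q assume "(p, q) \<in> placed i k (\<alpha> \<odot> \<beta>)"
    then obtain u v where uv: "p = slot i 0 k u" "q = slot i 0 k v" "(u, v) \<in> same (\<alpha> \<odot> \<beta>)"
      "u \<in> verts m l" "v \<in> verts m l"
      by (rule placedE[OF _ part_prod_Part[OF \<alpha> \<beta>]])
    then show "(p, q) \<in> (placed i j \<alpha> \<union> placed j k \<beta>)\<^sup>* \<inter> ?X \<times> ?X"
      using main[of u v] slot_verts[of i j k m l]
        slot_middle_cong[of u m l i 0 k j] slot_middle_cong[of v m l i 0 k j] by auto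
  next
    fix p q assume pq: "(p, q) \<in> (placed i j \<alpha> \<union> placed j k \<beta>)\<^sup>* \<inter> ?X \<times> ?X"
    then obtain u v where uv: "p = ?s u" "q = ?s v" "u \<in> verts m l" "v \<in> verts m l"
      by (auto simp flip: slot_verts[of i j k])
    with pq main[of u v] placed_iff[OF part_prod_Part[OF \<alpha> \<beta>] ne(2) uv(3,4), of j]
    show "(p, q) \<in> placed i k (\<alpha> \<odot> \<beta>)" by simp
  qed
qed

text \<open>Both ways of bracketing a triple product are connectivity in the same picture with four levels.\<close>
lemma placed_prod_left:
  assumes \<alpha>: "\<alpha> \<in> Part m n" and \<beta>: "\<beta> \<in> Part n k" and \<gamma>: "\<gamma> \<in> Part k l" 
    and ne: "distinct [i, a, b, j]"
  shows "placed i j (\<alpha> \<odot> \<beta> \<odot> \<gamma>) =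
    (placed i a \<alpha> \<union> placed a b \<beta> \<union> placed b j \<gamma>)\<^sup>* \<inter> ends i m j l \<times> ends i m j l"
proof -
  let ?R = "placed i a \<alpha> \<union> placed a b \<beta>" and ?X = "ends i m b k" and ?Y = "ends i m j l"
  have "Field ?R \<inter> (Field (placed b j \<gamma>) \<union> ?Y) \<subseteq> (ends i m a n \<union> ends a n b k) \<inter> (ends b k j l \<union> ?Y)"
    using placed_ends(2)[OF \<alpha>, of i a] placed_ends(2)[OF \<beta>, of a b] placed_ends(2)[OF \<gamma>, of b j]
    by (auto simp: Field_Un)
  also have "\<dots> \<subseteq> ?X" using ne by auto
  finally have F: "Field ?R \<inter> (Field (placed b j \<gamma>) \<union> ?Y) \<subseteq> ?X" .
  have "placed i j (\<alpha> \<odot> \<beta> \<odot> \<gamma>) = (?R\<^sup>* \<inter> ?X \<times> ?X \<union> placed b j \<gamma>)\<^sup>* \<inter> ?Y \<times> ?Y"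
    using ne by (simp add: placed_prod[OF part_prod_Part[OF \<alpha> \<beta>] \<gamma>, of i b j]
        placed_prod[OF \<alpha> \<beta>, of i a b])
  also have "\<dots> = (?R \<union> placed b j \<gamma>)\<^sup>* \<inter> ?Y \<times> ?Y"
    using rtrancl_contract[OF F] by auto
  finally show ?thesis .
qed

lemma placed_prod_right:
  assumes \<alpha>: "\<alpha> \<in> Part m n" and \<beta>: "\<beta> \<in> Part n k" and \<gamma>: "\<gamma> \<in> Part k l" 
    and ne: "distinct [i, a, b, j]"
  shows "placed i j (\<alpha> \<odot> (\<beta> \<odot> \<gamma>)) =
    (placed i a \<alpha> \<union> placed a b \<beta> \<union> placed b j \<gamma>)\<^sup>* \<inter> ends i m j l \<times> ends i m j l"
proof -
  let ?R = "placed a b \<beta> \<union> placed b j \<gamma>" and ?X = "ends a n j l" and ?Y = "ends i m j l"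
  have "Field ?R \<inter> (Field (placed i a \<alpha>) \<union> ?Y) \<subseteq> (ends a n b k \<union> ends b k j l) \<inter> (ends i m a n \<union> ?Y)"
    using placed_ends(2)[OF \<alpha>, of i a] placed_ends(2)[OF \<beta>, of a b] placed_ends(2)[OF \<gamma>, of b j]
    by (auto simp: Field_Un)
  also have "\<dots> \<subseteq> ?X" using ne by auto
  finally have F: "Field ?R \<inter> (Field (placed i a \<alpha>) \<union> ?Y) \<subseteq> ?X" .
  have "placed i j (\<alpha> \<odot> (\<beta> \<odot> \<gamma>)) = (?R\<^sup>* \<inter> ?X \<times> ?X \<union> placed i a \<alpha>)\<^sup>* \<inter> ?Y \<times> ?Y"
    using ne by (simp add: placed_prod[OF \<alpha> part_prod_Part[OF \<beta> \<gamma>], of i a j]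
        placed_prod[OF \<beta> \<gamma>, of a b j] Un_commute)
  also have "\<dots> = (?R \<union> placed i a \<alpha>)\<^sup>* \<inter> ?Y \<times> ?Y"
    using rtrancl_contract[OF F] by auto
  finally show ?thesis by (simp add: Un_ac)
qed

lemma part_prod_assoc:
  assumes "\<alpha> \<in> Part m n" "\<beta> \<in> Part n k" "\<gamma> \<in> Part k l" 
  shows "\<alpha> \<odot> \<beta> \<odot> \<gamma> = \<alpha> \<odot> (\<beta> \<odot> \<gamma>)"
proof (rule placed_cong)
  show "\<alpha> \<odot> \<beta> \<odot> \<gamma> \<in> Part m l" "\<alpha> \<odot> (\<beta> \<odot> \<gamma>) \<in> Part m l"
    using assms by (blast intro: part_prod_Part)+
  show "placed 0 3 (\<alpha> \<odot> \<beta> \<odot> \<gamma>) = placed 0 3 (\<alpha> \<odot> (\<beta> \<odot> \<gamma>))"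
    by (simp add: placed_prod_left[OF assms, of 0 1 2 3] placed_prod_right[OF assms, of 0 1 2 3])
qed simp

section \<open>The involution\<close>

fun flip :: "vertex \<Rightarrow> vertex" where
  "flip (Upper x) = Lower x"
| "flip (Lower x) = Upper x"
| "flip (Middle x) = Middle x"

text \<open>The involution: a partition turned upside down.\<close>
definition star :: "vertex set set \<Rightarrow> vertex set set" where
  "star \<alpha> = (\<lambda>B. flip ` B) ` \<alpha>"

lemma flip_flip [simp]: "flip (flip v) = v"
  by (cases v) auto

lemma inj_flip: "inj flip"
  by (metis flip_flip injI)

lemma flip_verts: "flip ` verts m n = verts n m"
  by (auto simp: verts_def image_Un image_image)

lemma flip_mem_verts [simp]: "flip u \<in> verts m n \<longleftrightarrow> u \<in> verts n m"
  by (cases u) auto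

lemma slot_flip: "slot i j k (flip u) = slot k j i u"
  by (cases u) auto

lemma star_star: "star (star \<alpha>) = \<alpha>"
  by (simp add: star_def image_image)

lemma same_star: "(u, v) \<in> same (star \<alpha>) \<longleftrightarrow> (flip u, flip v) \<in> same \<alpha>"
proof -
  have "u \<in> flip ` B \<longleftrightarrow> flip u \<in> B" for u B
    by (metis flip_flip imageE imageI)
  then show ?thesis by (auto simp: same_def star_def)
qed

lemma star_Part:
  assumes "\<alpha> \<in> Part m n"
  shows "star \<alpha> \<in> Part n m"
proof -
  have "inj_on flip (verts m n)" using inj_flip by (rule inj_on_subset) simp
  then have "partition_on (flip ` verts m n) ((`) flip ` \<alpha>)"
    using assms partition_on_inj_image[of "verts m n" \<alpha> flip] partition_onD3[of "verts m n" \<alpha>]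
    using image_is_empty[of flip] by (simp add: Part_def Diff_insert_absorb image_iff)
  then show ?thesis by (simp add: Part_def star_def flip_verts)
qed

lemma placed_star: "placed i k (star \<alpha>) = placed k i \<alpha>"
proof -
  have "same (star \<alpha>) = map_prod flip flip ` same \<alpha>"
  proof (intro equalityI subrelI)
    fix u v assume "(u, v) \<in> same (star \<alpha>)"
    then have "map_prod flip flip (flip u, flip v) \<in> map_prod flip flip ` same \<alpha>"
      unfolding same_star by (rule imageI)
    then show "(u, v) \<in> map_prod flip flip ` same \<alpha>" by simp
  qed (auto simp: same_star)
  then show ?thesis
    unfolding placed_def by (simp add: image_image map_prod_def case_prod_unfold slot_flip)
qed

lemma ends_commute: "ends i m k n = ends k n i m"
  by (auto simp: ends_def)

lemma star_prod:
  assumes "\<alpha> \<in> Part m n" "\<beta> \<in> Part n k"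
  shows "star (\<alpha> \<odot> \<beta>) = star \<beta> \<odot> star \<alpha>"
proof (rule placed_cong)
  show "star (\<alpha> \<odot> \<beta>) \<in> Part k m" "star \<beta> \<odot> star \<alpha> \<in> Part k m"
    using assms by (blast intro: part_prod_Part star_Part)+
  show "placed 0 2 (star (\<alpha> \<odot> \<beta>)) = placed 0 2 (star \<beta> \<odot> star \<alpha>)"
    by (simp add: placed_prod[OF assms, of 2 1 0] placed_star Un_commute
        placed_prod[OF star_Part[OF assms(2)] star_Part[OF assms(1)], of 0 1 2] ends_commute)
qed simp

text \<open>To bound a transitive closure it suffices to map the generating relation into a transitive one.\<close>
lemma rtrancl_fold:
  assumes "(p, q) \<in> R\<^sup>*" "(f p, f p) \<in> T"
    and "trans T" "\<And>p q. (p, q) \<in> R \<Longrightarrow> (f p, f q) \<in> T"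
  shows "(f p, f q) \<in> T"
  using assms(1)
proof induction
  case (step q r)
  then show ?case using assms(3,4) by (meson transD)
qed (use assms in simp)

lemma trans_same: "\<alpha> \<in> Part m n \<Longrightarrow> trans (same \<alpha>)"
  using equiv_same[of \<alpha> m n] by (simp add: equiv_def)

lemma prod_star_prod:
  assumes \<alpha>: "\<alpha> \<in> Part m n"
  shows "\<alpha> \<odot> star \<alpha> \<odot> \<alpha> = \<alpha>"
proof (rule placed_cong)
  note \<alpha>' = star_Part[OF \<alpha>]
  show "\<alpha> \<odot> star \<alpha> \<odot> \<alpha> \<in> Part m n" "\<alpha> \<in> Part m n"
    using \<alpha> \<alpha>' by (blast intro: part_prod_Part)+
  let ?R = "placed 0 1 \<alpha> \<union> placed 2 1 \<alpha> \<union> placed 2 3 \<alpha>" and ?Y = "ends 0 m 3 n"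
  have eq: "placed 0 3 (\<alpha> \<odot> star \<alpha> \<odot> \<alpha>) = ?R\<^sup>* \<inter> ?Y \<times> ?Y"
    by (simp add: placed_prod_left[OF \<alpha> \<alpha>' \<alpha>, of 0 1 2 3] placed_star)
  \<comment> \<open>The four levels are folded onto the two rows of \<open>\<alpha>\<close>; every layer of the picture is then a copy of \<open>\<alpha>\<close>.\<close>
  define f where "f p = (if even (fst p) then Upper (snd p) else Lower (snd p))" for p :: "nat \<times> nat"
  have f_slot: "f (slot i 0 k u) = u" if "u \<in> verts m n" "even i" "odd k" for i k u
    using that by (elim verts_cases) (auto simp: f_def)
  have f_step: "(f p, f q) \<in> same \<alpha>" if "(p, q) \<in> ?R" for p q
    using that by (elim UnE; elim placedE[OF _ \<alpha>]) (simp_all add: f_slot)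
  have f_Y: "p = slot 0 0 3 (f p) \<and> f p \<in> verts m n" if "p \<in> ?Y" for p
    using that by (cases p) (auto simp: f_def)
  show "placed 0 3 (\<alpha> \<odot> star \<alpha> \<odot> \<alpha>) = placed 0 3 \<alpha>"
  proof (intro equalityI subrelI)
    fix p q assume "(p, q) \<in> placed 0 3 (\<alpha> \<odot> star \<alpha> \<odot> \<alpha>)"
    then have pq: "(p, q) \<in> ?R\<^sup>*" "p \<in> ?Y" "q \<in> ?Y" by (auto simp: eq)
    then have "(f p, f q) \<in> same \<alpha>"
      using f_Y[OF pq(2)] same_refl[OF \<alpha>]
      by (intro rtrancl_fold[where f = f, OF pq(1) _ trans_same[OF \<alpha>] f_step]) auto
    then show "(p, q) \<in> placed 0 3 \<alpha>"
      using placed_iff[OF \<alpha>, of 0 3 "f p" "f q" 0] f_Y[OF pq(2)] f_Y[OF pq(3)] by simp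
  next
    fix p q assume pq: "(p, q) \<in> placed 0 3 \<alpha>"
    obtain u v where uv: "p = slot 0 0 3 u" "q = slot 0 0 3 v" "(u, v) \<in> same \<alpha>"
      "u \<in> verts m n" "v \<in> verts m n" using placedE[OF pq \<alpha>] .
    have across: "((0, x), (3, y)) \<in> ?R\<^sup>*" "((3, y), (0, x)) \<in> ?R\<^sup>*"
      if xy: "(Upper x, Lower y) \<in> same \<alpha>" for x y
    proof -
      have "((0, x), (1, y)) \<in> ?R" "((1, y), (2, x)) \<in> ?R" "((2, x), (3, y)) \<in> ?R"
        "((3, y), (2, x)) \<in> ?R" "((2, x), (1, y)) \<in> ?R" "((1, y), (0, x)) \<in> ?R"
        using xy same_sym[OF xy]
        by (simp_all add: placed_iffs[OF \<alpha>, of 0 "Suc 0"] placed_iffs[OF \<alpha>, of 2 "Suc 0"]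
            placed_iffs[OF \<alpha>, of 2 3])
      then show "((0, x), (3, y)) \<in> ?R\<^sup>*" "((3, y), (0, x)) \<in> ?R\<^sup>*"
        by (meson converse_rtrancl_into_rtrancl rtrancl.rtrancl_refl)+
    qed
    have "(p, q) \<in> ?R\<^sup>*"
      using uv(4,5)
    proof (elim verts_cases)
      fix x y assume "u = Upper x" "v = Upper y"
      with uv have "(p, q) \<in> placed 0 1 \<alpha>" by (simp add: placed_iffs[OF \<alpha>])
      then show ?thesis by blast
    next
      fix x y assume "u = Lower x" "v = Lower y"
      with uv have "(p, q) \<in> placed 2 3 \<alpha>" by (simp add: placed_iffs[OF \<alpha>])
      then show ?thesis by blast
    qed (use uv across same_sym in auto)
    moreover have "p \<in> ?Y" "q \<in> ?Y" using uv slot_verts[of 0 0 3 m n] by auto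
    ultimately show "(p, q) \<in> placed 0 3 (\<alpha> \<odot> star \<alpha> \<odot> \<alpha>)" by (simp add: eq)
  qed
qed simp

section \<open>Rank\<close>

text \<open>The upper kernel: the relation induced by \<open>\<alpha>\<close> on the labels of the upper row.\<close>
definition kernel :: "vertex set set \<Rightarrow> (nat \<times> nat) set" where
  "kernel \<alpha> = {(x, y). (Upper x, Upper y) \<in> same \<alpha>}"

text \<open>The labels of those upper vertices that lie in a block meeting both rows.\<close>
definition domain :: "vertex set set \<Rightarrow> nat set" where
  "domain \<alpha> = {x. \<exists>z. (Upper x, Lower z) \<in> same \<alpha>}"

text \<open>The product \<open>\<alpha>\<alpha>\<^sup>*\<close> joins the copies of \<open>x\<close> and \<open>y\<close> in one row iff they are in the kernel, and the
  copies in different rows iff moreover \<open>x\<close> is in the domain; so it is determined by kernel and domain.\<close>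
lemma prod_star_char:
  assumes \<alpha>: "\<alpha> \<in> Part m n"
  shows "placed 0 2 (\<alpha> \<odot> star \<alpha>) =
    {((i, x), (j, y)) |i j x y. i \<in> {0, 2} \<and> j \<in> {0, 2} \<and> (x, y) \<in> kernel \<alpha> \<and> (i \<noteq> j \<longrightarrow> x \<in> domain \<alpha>)}"
    (is "_ = ?Q")
proof (intro equalityI subrelI)
  let ?R = "placed 0 1 \<alpha> \<union> placed 2 1 \<alpha>" and ?Y = "ends 0 m 2 m"
  have eq: "placed 0 2 (\<alpha> \<odot> star \<alpha>) = ?R\<^sup>* \<inter> ?Y \<times> ?Y"
    by (simp add: placed_prod[OF \<alpha> star_Part[OF \<alpha>], of 0 1 2] placed_star Un_commute)
  note iffs = placed_iffs[OF \<alpha>, of 0 1, simplified] placed_iffs[OF \<alpha>, of 2 1, simplified]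
  {
    \<comment> \<open>A path starting in an outer level \<open>i\<close> stays in one block of \<open>\<alpha>\<close>, up to folding, and reaches the other
      outer level \<open>2 - i\<close> only through the middle one.\<close>
    fix i x p assume i: "i = 0 \<or> i = (2 :: nat)" "x \<in> {1..m}" and "((i, x), p) \<in> ?R\<^sup>*"
    from this(3) have "(\<exists>y. p = (i, y) \<and> (Upper x, Upper y) \<in> same \<alpha>) \<or>
        (\<exists>y. p = (1, y) \<and> (Upper x, Lower y) \<in> same \<alpha>) \<or>
        (\<exists>y. p = (2 - i, y) \<and> (Upper x, Upper y) \<in> same \<alpha> \<and> x \<in> domain \<alpha>)"
    proof induction
      case base
      then show ?case using i same_refl[OF \<alpha>, of "Upper x"] by auto
    next
      case (step p q)
      from step.hyps(2) obtain k u v where k: "p = slot k 0 1 u" "q = slot k 0 1 v" "k = 0 \<or> k = 2"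
        and uv: "(u, v) \<in> same \<alpha>" and mem: "u \<in> verts m n" "v \<in> verts m n"
        by (elim UnE; elim placedE[OF _ \<alpha>]) auto
      from step.IH k i mem have xu: "(Upper x, u) \<in> same \<alpha>"
        by (auto elim!: verts_cases)
      with uv have xv: "(Upper x, v) \<in> same \<alpha>" using same_trans[OF \<alpha>] by blast
      from mem(2) show ?case
      proof (cases rule: verts_cases)
        case (1 y)
        then have q: "q = (k, y)" "(Upper x, Upper y) \<in> same \<alpha>" using k xv by auto
        show ?thesis
        proof (cases "k = i")
          case False
          have "x \<in> domain \<alpha>" using step.IH False k i mem(1) xu
            by (auto elim!: verts_cases simp: domain_def)
          with False q k i show ?thesis by auto
        qed (use q in auto)
      qed (use k xv in auto)
    qed
  } note reach = this
  {
    fix p q assume "(p, q) \<in> placed 0 2 (\<alpha> \<odot> star \<alpha>)"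
    then obtain i x j y where "p = (i, x)" "q = (j, y)" "i = 0 \<or> i = 2" "j = 0 \<or> j = 2"
      "x \<in> {1..m}" "((i, x), q) \<in> ?R\<^sup>*"
      by (cases p; cases q) (auto simp: eq)
    with reach[of i x q] show "(p, q) \<in> ?Q" by (auto simp: kernel_def)
  next
    fix p q assume "(p, q) \<in> ?Q"
    then obtain i j x y where p: "p = (i, x)" "q = (j, y)" "i = 0 \<or> i = 2" "j = 0 \<or> j = 2"
      and xy: "(Upper x, Upper y) \<in> same \<alpha>" and ij: "i \<noteq> j \<longrightarrow> x \<in> domain \<alpha>"
      by (auto simp: kernel_def)
    have "(p, q) \<in> ?R\<^sup>*"
    proof (cases "i = j")
      case True
      then have "(p, q) \<in> ?R" using p xy by (auto simp: iffs)
      then show ?thesis by blast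
    next
      case False
      with ij obtain z where xz: "(Upper x, Lower z) \<in> same \<alpha>" by (auto simp: domain_def)
      then have "(Lower z, Upper y) \<in> same \<alpha>" using xy same_sym same_trans[OF \<alpha>] by blast
      then have "(p, (1, z)) \<in> ?R" "((1, z), q) \<in> ?R" using p xz by (auto simp: iffs)
      then show ?thesis by (meson converse_rtrancl_into_rtrancl rtrancl.rtrancl_refl)
    qed
    moreover have "p \<in> ?Y" "q \<in> ?Y" using p same_verts[OF \<alpha> xy] by auto
    ultimately show "(p, q) \<in> placed 0 2 (\<alpha> \<odot> star \<alpha>)" by (simp add: eq)
  }
qed

lemma prod_star_cong:
  assumes "\<alpha> \<in> Part m n" "\<beta> \<in> Part m k" "kernel \<alpha> = kernel \<beta>" "domain \<alpha> = domain \<beta>"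
  shows "\<alpha> \<odot> star \<alpha> = \<beta> \<odot> star \<beta>"
proof (rule placed_cong)
  show "\<alpha> \<odot> star \<alpha> \<in> Part m m" "\<beta> \<odot> star \<beta> \<in> Part m m"
    using assms by (blast intro: part_prod_Part star_Part)+
  show "placed 0 2 (\<alpha> \<odot> star \<alpha>) = placed 0 2 (\<beta> \<odot> star \<beta>)"
    by (simp only: prod_star_char[OF assms(1)] prod_star_char[OF assms(2)] assms(3,4))
qed simp

text \<open>A transversal block is determined by its upper part, which is a kernel class inside the domain.\<close>
lemma part_rank_eq:
  assumes \<alpha>: "\<alpha> \<in> Part m n"
  shows "part_rank \<alpha> = card ((\<lambda>x. kernel \<alpha> `` {x}) ` domain \<alpha>)"
proof -
  let ?T = "{B \<in> \<alpha>. B \<inter> range Upper \<noteq> {} \<and> B \<inter> range Lower \<noteq> {}}"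
  let ?h = "\<lambda>B. Upper -` B"
  have disj: "B = B'" if "B \<in> \<alpha>" "B' \<in> \<alpha>" "u \<in> B" "u \<in> B'" for u B B'
    using that \<alpha> unfolding Part_def partition_on_def disjoint_def by blast
  have cls: "kernel \<alpha> `` {x} = ?h B" if "B \<in> \<alpha>" "Upper x \<in> B" for x B
    using that disj by (auto simp: kernel_def same_def)
  have "?h ` ?T = (\<lambda>x. kernel \<alpha> `` {x}) ` domain \<alpha>"
  proof (intro equalityI subsetI)
    fix C assume "C \<in> ?h ` ?T"
    then obtain B x z where "B \<in> \<alpha>" "Upper x \<in> B" "Lower z \<in> B" "C = ?h B" by blast
    then show "C \<in> (\<lambda>x. kernel \<alpha> `` {x}) ` domain \<alpha>"
      using cls[of B x] by (auto simp: domain_def same_def)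
  next
    fix C assume "C \<in> (\<lambda>x. kernel \<alpha> `` {x}) ` domain \<alpha>"
    then obtain B x z where "B \<in> \<alpha>" "Upper x \<in> B" "Lower z \<in> B" "C = kernel \<alpha> `` {x}"
      by (auto simp: domain_def same_def)
    then show "C \<in> ?h ` ?T" using cls[of B x] by blast
  qed
  moreover have "card (?h ` ?T) = card ?T"
  proof (rule card_image, rule inj_onI)
    fix B B' assume B: "B \<in> ?T" "B' \<in> ?T" "?h B = ?h B'"
    then obtain x where "Upper x \<in> B" by blast
    with B have "Upper x \<in> B'" by blast
    with \<open>Upper x \<in> B\<close> B show "B = B'" using disj by blast
  qed
  ultimately show ?thesis unfolding part_rank_def by simp
qed

lemma kernel_refl: "\<alpha> \<in> Part m n \<Longrightarrow> x \<in> domain \<alpha> \<Longrightarrow> (x, x) \<in> kernel \<alpha>"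
  using same_verts same_refl by (fastforce simp: domain_def kernel_def)

lemma finite_domain: "\<alpha> \<in> Part m n \<Longrightarrow> finite (domain \<alpha>)"
  using same_verts[of \<alpha> m n] by (intro finite_subset[of "domain \<alpha>" "{1..m}"]) (fastforce simp: domain_def)+

lemma part_rank_star: "part_rank (star \<alpha>) = part_rank \<alpha>"
proof -
  let ?T = "\<lambda>\<alpha>. {B \<in> \<alpha>. B \<inter> range Upper \<noteq> {} \<and> B \<inter> range Lower \<noteq> {}}"
  have sub: "(`) flip ` ?T \<alpha> \<subseteq> ?T (star \<alpha>)" for \<alpha>
    by (force simp: star_def)
  have "(`) flip ` ((`) flip ` ?T (star \<alpha>)) \<subseteq> (`) flip ` ?T (star (star \<alpha>))"
    using sub[of "star \<alpha>"] by (rule image_mono)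
  then have "?T (star \<alpha>) \<subseteq> (`) flip ` ?T \<alpha>" by (simp add: image_image star_star)
  with sub have "?T (star \<alpha>) = (`) flip ` ?T \<alpha>" by blast
  moreover have "card ((`) flip ` ?T \<alpha>) = card (?T \<alpha>)"
    using inj_flip by (intro card_image) (simp add: inj_image_eq_iff inj_on_def)
  ultimately show ?thesis unfolding part_rank_def by simp
qed

text \<open>Multiplication on the right enlarges the kernel and shrinks the domain, and it can merge kernel
  classes only inside the domain.\<close>
lemma kernel_prod:
  assumes \<alpha>: "\<alpha> \<in> Part m n" and \<beta>: "\<beta> \<in> Part n k"
  shows "kernel \<alpha> \<subseteq> kernel (\<alpha> \<odot> \<beta>)" "domain (\<alpha> \<odot> \<beta>) \<subseteq> domain \<alpha>"
    "(x, y) \<in> kernel (\<alpha> \<odot> \<beta>) \<Longrightarrow> x \<in> domain \<alpha> \<or> (x, y) \<in> kernel \<alpha>"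
proof -
  let ?R = "placed 0 1 \<alpha> \<union> placed 1 2 \<beta>" and ?Y = "ends 0 m 2 k"
  have eq: "placed 0 2 (\<alpha> \<odot> \<beta>) = ?R\<^sup>* \<inter> ?Y \<times> ?Y"
    by (simp add: placed_prod[OF assms, of 0 1 2])
  note iffs = placed_iffs[OF part_prod_Part[OF assms], of 0 2, simplified]
  show "kernel \<alpha> \<subseteq> kernel (\<alpha> \<odot> \<beta>)"
  proof (rule subrelI)
    fix x y assume "(x, y) \<in> kernel \<alpha>"
    then have xy: "(Upper x, Upper y) \<in> same \<alpha>" by (simp add: kernel_def)
    then have "((0, x), (0, y)) \<in> ?R\<^sup>*" by (auto simp: placed_iffs[OF \<alpha>])
    with same_verts[OF \<alpha> xy] have "((0, x), (0, y)) \<in> placed 0 2 (\<alpha> \<odot> \<beta>)" by (auto simp: eq)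
    then show "(x, y) \<in> kernel (\<alpha> \<odot> \<beta>)" by (simp add: iffs kernel_def)
  qed
  \<comment> \<open>From a vertex outside the domain no path leaves the upper level.\<close>
  have stuck: "\<exists>y. p = (0, y) \<and> (Upper x, Upper y) \<in> same \<alpha>"
    if "((0, x), p) \<in> ?R\<^sup>*" "x \<in> {1..m}" "x \<notin> domain \<alpha>" for x p
    using that(1)
  proof induction
    case base
    then show ?case using that same_refl[OF \<alpha>, of "Upper x"] by auto
  next
    case (step p q)
    then obtain y where y: "p = (0, y)" "(Upper x, Upper y) \<in> same \<alpha>" by blast
    have "p \<notin> Field (placed 1 2 \<beta>)" using placed_ends(2)[OF \<beta>, of 1 2] y by auto
    with step.hyps have "(p, q) \<in> placed 0 1 \<alpha>" by (auto simp: Field_def)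
    then obtain u v where uv: "p = slot 0 0 1 u" "q = slot 0 0 1 v" "(u, v) \<in> same \<alpha>"
      "u \<in> verts m n" "v \<in> verts m n" by (rule placedE[OF _ \<alpha>])
    with y have "u = Upper y" by (auto elim!: verts_cases)
    with uv y have xv: "(Upper x, v) \<in> same \<alpha>" using same_trans[OF \<alpha>] by blast
    from uv(5) show ?case
      by (cases rule: verts_cases) (use xv uv that(3) in \<open>auto simp: domain_def\<close>)
  qed
  show "domain (\<alpha> \<odot> \<beta>) \<subseteq> domain \<alpha>"
  proof
    fix x assume "x \<in> domain (\<alpha> \<odot> \<beta>)"
    then obtain z where "((0, x), (2, z)) \<in> placed 0 2 (\<alpha> \<odot> \<beta>)" by (auto simp: domain_def iffs)
    with stuck[of x "(2, z)"] show "x \<in> domain \<alpha>" by (auto simp: eq)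
  qed
  assume "(x, y) \<in> kernel (\<alpha> \<odot> \<beta>)"
  then have "((0, x), (0, y)) \<in> placed 0 2 (\<alpha> \<odot> \<beta>)" by (simp add: kernel_def iffs)
  with stuck[of x "(0, y)"] show "x \<in> domain \<alpha> \<or> (x, y) \<in> kernel \<alpha>"
    by (auto simp: eq kernel_def)
qed

lemma kernel_sym: "(x, y) \<in> kernel \<alpha> \<Longrightarrow> (y, x) \<in> kernel \<alpha>"
  using same_sym by (simp add: kernel_def)

lemma kernel_trans: "\<alpha> \<in> Part m n \<Longrightarrow> (x, y) \<in> kernel \<alpha> \<Longrightarrow> (y, z) \<in> kernel \<alpha> \<Longrightarrow> (x, z) \<in> kernel \<alpha>"
  using same_trans unfolding kernel_def by blast

lemma kernel_class_eq:
  assumes "\<alpha> \<in> Part m n" "(x, y) \<in> kernel \<alpha>"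
  shows "kernel \<alpha> `` {x} = kernel \<alpha> `` {y}"
  using kernel_trans[OF assms(1)] kernel_sym assms(2) by blast

lemma domain_saturated:
  assumes "\<alpha> \<in> Part m n" "(x, y) \<in> kernel \<alpha>" "x \<in> domain \<alpha>"
  shows "y \<in> domain \<alpha>"
  using assms same_sym same_trans[OF assms(1)] unfolding kernel_def domain_def by blast

text \<open>The transversal classes of \<open>\<alpha>\<beta>\<close> are unions of transversal classes of \<open>\<alpha>\<close>; if there are equally
  many of them, nothing has been merged or cut off.\<close>
lemma part_rank_prod_left:
  assumes \<alpha>: "\<alpha> \<in> Part m n" and \<beta>: "\<beta> \<in> Part n k"
  shows "part_rank (\<alpha> \<odot> \<beta>) \<le> part_rank \<alpha>"
    and "part_rank (\<alpha> \<odot> \<beta>) = part_rank \<alpha> \<Longrightarrow>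
      kernel (\<alpha> \<odot> \<beta>) = kernel \<alpha> \<and> domain (\<alpha> \<odot> \<beta>) = domain \<alpha>"
proof -
  define \<tau> where "\<tau> = \<alpha> \<odot> \<beta>"
  have \<tau>: "\<tau> \<in> Part m k" unfolding \<tau>_def by (rule part_prod_Part[OF assms])
  note kp = kernel_prod[OF assms, folded \<tau>_def]
  let ?A = "(\<lambda>x. kernel \<alpha> `` {x}) ` domain \<alpha>"
  let ?A' = "(\<lambda>x. kernel \<alpha> `` {x}) ` domain \<tau>"
  let ?T = "(\<lambda>x. kernel \<tau> `` {x}) ` domain \<tau>"
  have sub: "?A' \<subseteq> ?A" using kp(2) by blast
  have fin: "finite ?A" using finite_domain[OF \<alpha>] by simp
  \<comment> \<open>\<open>h\<close> sends a transversal class of \<open>\<alpha>\<close> to the class of \<open>\<tau>\<close> containing it.\<close>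
  define h where "h C = kernel \<tau> `` C" for C
  have h: "h (kernel \<alpha> `` {x}) = kernel \<tau> `` {x}" if "x \<in> domain \<tau>" for x
  proof -
    have "(x, x) \<in> kernel \<alpha>" using that kp(2) kernel_refl[OF \<alpha>] by blast
    then show ?thesis unfolding h_def using kernel_trans[OF \<tau>] kp(1) by blast
  qed
  then have hT: "h ` ?A' = ?T" by (simp add: image_image)
  then have le1: "card ?T \<le> card ?A'" using fin sub card_image_le finite_subset by metis
  have le2: "card ?A' \<le> card ?A" using fin sub card_mono by blast
  have rk: "part_rank \<tau> = card ?T" "part_rank \<alpha> = card ?A"
    using part_rank_eq[OF \<tau>] part_rank_eq[OF \<alpha>] by auto
  show "part_rank (\<alpha> \<odot> \<beta>) \<le> part_rank \<alpha>" using le1 le2 rk by (simp add: \<tau>_def)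
  assume "part_rank (\<alpha> \<odot> \<beta>) = part_rank \<alpha>"
  with rk have ca: "card ?T = card ?A" by (simp add: \<tau>_def)
  with le1 le2 fin sub have A: "?A' = ?A" by (metis card_subset_eq order_antisym)
  with ca hT fin have inj: "inj_on h ?A'" using eq_card_imp_inj_on by metis
  have dom: "domain \<tau> = domain \<alpha>"
  proof (rule antisym[OF kp(2)], rule)
    fix x assume x: "x \<in> domain \<alpha>"
    then obtain y where y: "y \<in> domain \<tau>" "kernel \<alpha> `` {x} = kernel \<alpha> `` {y}" using A by blast
    with kernel_refl[OF \<alpha> x] kp(1) have "(y, x) \<in> kernel \<tau>" by blast
    with y show "x \<in> domain \<tau>" using domain_saturated[OF \<tau>] by blast
  qed
  have "kernel \<tau> \<subseteq> kernel \<alpha>"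
  proof (rule subrelI)
    fix x y assume xy: "(x, y) \<in> kernel \<tau>"
    show "(x, y) \<in> kernel \<alpha>"
    proof (cases "x \<in> domain \<alpha>")
      case True
      then have D: "x \<in> domain \<tau>" "y \<in> domain \<tau>" using dom domain_saturated[OF \<tau> xy] by auto
      with xy have "h (kernel \<alpha> `` {x}) = h (kernel \<alpha> `` {y})"
        using h kernel_class_eq[OF \<tau>] by simp
      with inj D have "kernel \<alpha> `` {x} = kernel \<alpha> `` {y}" unfolding inj_on_def by blast
      with D dom kernel_refl[OF \<alpha>, of y] show ?thesis by blast
    qed (use kp(3)[OF xy] in blast)
  qed
  with kp(1) dom show "kernel (\<alpha> \<odot> \<beta>) = kernel \<alpha> \<and> domain (\<alpha> \<odot> \<beta>) = domain \<alpha>"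
    by (auto simp: \<tau>_def)
qed

lemma part_rank_prod_right:
  assumes "\<alpha> \<in> Part m n" "\<beta> \<in> Part n k"
  shows "part_rank (\<alpha> \<odot> \<beta>) \<le> part_rank \<beta>"
  using part_rank_prod_left(1)[OF star_Part[OF assms(2)] star_Part[OF assms(1)]]
  by (metis part_rank_star star_prod[OF assms])

lemma retract_right:
  assumes \<alpha>: "\<alpha> \<in> Part m n" and \<sigma>: "\<sigma> \<in> Part n k" and rk: "part_rank (\<alpha> \<odot> \<sigma>) = part_rank \<alpha>"
  shows "\<alpha> = \<alpha> \<odot> \<sigma> \<odot> (star \<sigma> \<odot> star \<alpha> \<odot> \<alpha>)"
proof -
  have "\<alpha> = \<alpha> \<odot> star \<alpha> \<odot> \<alpha>" using prod_star_prod[OF \<alpha>] by simp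
  also have "\<alpha> \<odot> star \<alpha> = \<alpha> \<odot> \<sigma> \<odot> star (\<alpha> \<odot> \<sigma>)"
    using part_rank_prod_left(2)[OF \<alpha> \<sigma> rk] by (intro prod_star_cong[OF \<alpha> part_prod_Part[OF \<alpha> \<sigma>]]) auto
  also have "star (\<alpha> \<odot> \<sigma>) = star \<sigma> \<odot> star \<alpha>" by (rule star_prod[OF \<alpha> \<sigma>])
  also have "\<alpha> \<odot> \<sigma> \<odot> (star \<sigma> \<odot> star \<alpha>) \<odot> \<alpha> = \<alpha> \<odot> \<sigma> \<odot> (star \<sigma> \<odot> star \<alpha> \<odot> \<alpha>)"
    by (rule part_prod_assoc[OF part_prod_Part[OF \<alpha> \<sigma>] part_prod_Part[OF star_Part[OF \<sigma>] star_Part[OF \<alpha>]] \<alpha>])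
  finally show ?thesis .
qed

lemma retract_left:
  assumes \<alpha>: "\<alpha> \<in> Part m n" and \<sigma>: "\<sigma> \<in> Part k m" and rk: "part_rank (\<sigma> \<odot> \<alpha>) = part_rank \<alpha>"
  shows "\<alpha> = \<alpha> \<odot> star \<alpha> \<odot> star \<sigma> \<odot> (\<sigma> \<odot> \<alpha>)"
proof -
  note P = part_prod_Part[OF \<sigma> \<alpha>] part_prod_Part[OF star_Part[OF \<alpha>] star_Part[OF \<sigma>]]
  note P' = part_prod_Part[OF P(1) star_Part[OF \<alpha>]]
  have "part_rank (star \<alpha> \<odot> star \<sigma>) = part_rank (star \<alpha>)"
    using rk by (metis part_rank_star star_prod[OF \<sigma> \<alpha>])
  from retract_right[OF star_Part[OF \<alpha>] star_Part[OF \<sigma>] this]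
  have "star \<alpha> = star \<alpha> \<odot> star \<sigma> \<odot> (\<sigma> \<odot> \<alpha> \<odot> star \<alpha>)" by (simp add: star_star)
  then have "\<alpha> = star (star \<alpha> \<odot> star \<sigma> \<odot> (\<sigma> \<odot> \<alpha> \<odot> star \<alpha>))" by (metis star_star)
  also have "\<dots> = star (\<sigma> \<odot> \<alpha> \<odot> star \<alpha>) \<odot> star (star \<alpha> \<odot> star \<sigma>)"
    by (rule star_prod[OF P(2) P'])
  also have "star (star \<alpha> \<odot> star \<sigma>) = \<sigma> \<odot> \<alpha>"
    by (metis star_prod[OF \<sigma> \<alpha>] star_star)
  also have "star (\<sigma> \<odot> \<alpha> \<odot> star \<alpha>) = star (star \<alpha>) \<odot> star (\<sigma> \<odot> \<alpha>)"
    by (rule star_prod[OF P(1) star_Part[OF \<alpha>]])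
  also have "\<dots> = \<alpha> \<odot> (star \<alpha> \<odot> star \<sigma>)" by (simp add: star_star star_prod[OF \<sigma> \<alpha>])
  also have "\<dots> = \<alpha> \<odot> star \<alpha> \<odot> star \<sigma>"
    by (rule part_prod_assoc[symmetric, OF \<alpha> star_Part[OF \<alpha>] star_Part[OF \<sigma>]])
  finally show ?thesis .
qed

section \<open>Partitions with small blocks\<close>

text \<open>In a finite graph with degrees at most two, a component contains at most two vertices from a set \<open>X\<close>
  of vertices of degree at most one.\<close>
lemma two_ends_per_component:
  assumes fin: "finite E" and sym: "sym E"
    and two: "\<And>p q q' q''. (p, q) \<in> E \<Longrightarrow> (p, q') \<in> E \<Longrightarrow> (p, q'') \<in> E \<Longrightarrow> \<not> distinct [q, q', q'']"
    and one: "\<And>p q q'. p \<in> X \<Longrightarrow> (p, q) \<in> E \<Longrightarrow> (p, q') \<in> E \<Longrightarrow> q = q'"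
    and X: "u \<in> X" "v \<in> X" "w \<in> X" and conn: "(u, v) \<in> E\<^sup>*" "(u, w) \<in> E\<^sup>*"
  shows "\<not> distinct [u, v, w]"
proof -
  \<comment> \<open>A longest simple path from \<open>u\<close> exhausts the component of \<open>u\<close>.  An inner vertex of the path has two
    neighbours, so only the two ends of the path can belong to \<open>X\<close>.\<close>
  define P where "P xs \<longleftrightarrow> xs \<noteq> [] \<and> hd xs = u \<and> distinct xs \<and> successively (\<lambda>x y. (x, y) \<in> E) xs
    \<and> set xs \<subseteq> insert u (Field E)" for xs
  have finF: "finite (insert u (Field E))" using fin by (simp add: finite_Field)
  have "P [u]" by (simp add: P_def)
  moreover have "length xs \<le> card (insert u (Field E))" if "P xs" for xs
    using that card_mono[OF finF, of "set xs"] distinct_card[of xs] by (simp add: P_def)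
  ultimately obtain xs where P: "P xs" and max: "\<And>ys. P ys \<Longrightarrow> length ys \<le> length xs"
    using ex_has_greatest_nat[of P "[u]" length "Suc (card (insert u (Field E)))"] by (metis le_imp_less_Suc)
  have inner: "(x, a) \<in> E \<and> (x, b) \<in> E \<and> a \<noteq> b"
    if xs: "xs = as @ [a] @ [x] @ [b] @ bs" for as a x b bs
    using P sym unfolding P_def xs by (auto simp: successively_append_iff dest: symD)
  have closed: "y \<in> set xs" if x: "x \<in> set xs" and xy: "(x, y) \<in> E" for x y
  proof -
    obtain as bs where xs: "xs = as @ x # bs" using x by (meson split_list)
    consider "bs = []" | b bs' where "as = []" "bs = b # bs'"
      | a as' b bs' where "as = as' @ [a]" "bs = b # bs'"
      by (metis list.exhaust rev_exhaust)
    then show ?thesis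
    proof cases
      case 1
      show ?thesis
      proof (rule ccontr)
        assume "y \<notin> set xs"
        moreover have "last xs = x" "xs \<noteq> []" using xs 1 by auto
        ultimately have "P (xs @ [y])"
          using P xy by (auto simp: P_def successively_append_iff Field_def)
        then show False using max[of "xs @ [y]"] by simp
      qed
    next
      case 2
      then have "x = u" "(x, b) \<in> E" using P xs by (auto simp: P_def)
      then show ?thesis using one[OF X(1), of y b] xy xs 2 by simp
    next
      case 3
      then show ?thesis using inner[of as' a x b bs'] two[of x a b y] xy xs by auto
    qed
  qed
  have reach: "y \<in> set xs" if "(u, y) \<in> E\<^sup>*" for y
    using that
  proof induction
    case base
    then show ?case using P by (auto simp: P_def)
  qed (rule closed)
  have last: "y = last xs" if y: "y \<in> X" "(u, y) \<in> E\<^sup>*" "y \<noteq> u" for y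
  proof -
    obtain as bs where xs: "xs = as @ y # bs" using reach[OF y(2)] by (meson split_list)
    have "as \<noteq> []" using P y(3) xs by (auto simp: P_def)
    then obtain a as' where as: "as = as' @ [a]" by (metis rev_exhaust)
    show ?thesis
    proof (cases bs)
      case (Cons b bs')
      then show ?thesis using inner[of as' a y b bs'] one[OF y(1)] xs as by auto
    qed (use xs in simp)
  qed
  show ?thesis using last[OF X(2) conn(1)] last[OF X(3) conn(2)] by auto
qed

lemma block_same: "\<alpha> \<in> Part m n \<Longrightarrow> B \<in> \<alpha> \<Longrightarrow> u \<in> B \<Longrightarrow> B = same \<alpha> `` {u}"
  using same_quotient[of \<alpha> m n] equiv_same[of \<alpha> m n]
  by (metis equiv_class_eq_iff quotientE Image_singleton_iff)

lemma finite_block: "\<alpha> \<in> Part m n \<Longrightarrow> B \<in> \<alpha> \<Longrightarrow> finite B"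
  using Union_Part finite_verts by (metis Sup_upper finite_subset)

lemma card_le_2_iff:
  assumes "finite B"
  shows "card B \<le> 2 \<longleftrightarrow> (\<forall>u\<in>B. \<forall>v\<in>B. \<forall>w\<in>B. \<not> distinct [u, v, w])"
proof (cases "B = {}")
  case False
  then obtain u where u: "u \<in> B" by blast
  have "card B \<le> 2 \<longleftrightarrow> card (B - {u}) \<le> Suc 0"
    using u assms by (simp add: card_Diff_singleton card_gt_0_iff le_diff_conv numeral_2_eq_2)
  also have "\<dots> \<longleftrightarrow> (\<forall>v\<in>B - {u}. \<forall>w\<in>B - {u}. v = w)"
    using assms by (intro card_le_Suc0_iff_eq) simp
  also have "\<dots> \<longleftrightarrow> (\<forall>u\<in>B. \<forall>v\<in>B. \<forall>w\<in>B. \<not> distinct [u, v, w])"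
    using u by auto
  finally show ?thesis .
qed simp

lemma placed_neighbour_unique:
  assumes \<alpha>: "\<alpha> \<in> Part m n" and small: "\<forall>B\<in>\<alpha>. card B \<le> 2" and "i \<noteq> k"
    and pq: "(p, q) \<in> placed i k \<alpha>" "(p, q') \<in> placed i k \<alpha>" "p \<noteq> q" "p \<noteq> q'"
  shows "q = q'"
proof -
  obtain u v where uv: "p = slot i 0 k u" "q = slot i 0 k v" "(u, v) \<in> same \<alpha>" "u \<in> verts m n" 
    using placedE[OF pq(1) \<alpha>] by metis
  obtain u' w where uw: "p = slot i 0 k u'" "q' = slot i 0 k w" "(u', w) \<in> same \<alpha>" "u' \<in> verts m n"
    using placedE[OF pq(2) \<alpha>] by metis
  have "u' = u" using uv(1,4) uw(1,4) \<open>i \<noteq> k\<close> by (auto elim!: verts_cases)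
  with uv uw obtain B where B: "B \<in> \<alpha>" "u \<in> B" "v \<in> B" "w \<in> B"
    using block_same[OF \<alpha>] unfolding same_def by blast
  then have "\<not> distinct [u, v, w]" using small finite_block[OF \<alpha>] card_le_2_iff by metis
  then show ?thesis using pq(3,4) uv(1,2) uw(1,2) \<open>u' = u\<close> by auto
qed

lemma finite_same: "\<alpha> \<in> Part m n \<Longrightarrow> finite (same \<alpha>)"
  using same_verts[of \<alpha> m n] by (intro finite_subset[of "same \<alpha>" "verts m n \<times> verts m n"]) auto

lemma sym_placed: "(p, q) \<in> placed i k \<alpha> \<Longrightarrow> (q, p) \<in> placed i k \<alpha>"
proof -
  assume "(p, q) \<in> placed i k \<alpha>"
  then obtain u v where "p = slot i 0 k u" "q = slot i 0 k v" "(u, v) \<in> same \<alpha>"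
    by (auto simp: placed_def)
  then have "(q, p) = map_prod (slot i 0 k) (slot i 0 k) (v, u)" "(v, u) \<in> same \<alpha>"
    using same_sym by auto
  then show "(q, p) \<in> placed i k \<alpha>" unfolding placed_def by (rule image_eqI)
qed

lemma prod_blocks_small:
  assumes \<alpha>: "\<alpha> \<in> Part m n" and \<beta>: "\<beta> \<in> Part n k"
    and small: "\<forall>B\<in>\<alpha>. card B \<le> 2" "\<forall>B\<in>\<beta>. card B \<le> 2"
  shows "\<forall>B\<in>\<alpha> \<odot> \<beta>. card B \<le> 2"
proof
  fix B assume B: "B \<in> \<alpha> \<odot> \<beta>"
  note \<alpha>\<beta> = part_prod_Part[OF \<alpha> \<beta>]
  let ?A = "placed 0 1 \<alpha>" and ?B = "placed 1 2 \<beta>"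
  let ?E = "(?A \<union> ?B) - Id" and ?X = "ends 0 m 2 k"
  have FA: "Field ?A \<subseteq> ends 0 m 1 n" and FB: "Field ?B \<subseteq> ends 1 n 2 k"
    by (rule placed_ends(2)[OF \<alpha>], rule placed_ends(2)[OF \<beta>])
  have A: "q = q'" if "(p, q) \<in> ?A - Id" "(p, q') \<in> ?A - Id" for p q q'
    by (rule placed_neighbour_unique[OF \<alpha> small(1), of 0 1]) (use that in auto)
  have B': "q = q'" if "(p, q) \<in> ?B - Id" "(p, q') \<in> ?B - Id" for p q q'
    by (rule placed_neighbour_unique[OF \<beta> small(2), of 1 2]) (use that in auto)
  have one: "q = q'" if "p \<in> ?X" "(p, q) \<in> ?E" "(p, q') \<in> ?E" for p q q'
  proof (cases "fst p = 0")
    case True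
    then have "p \<notin> Field ?B" using FB by (cases p) auto
    then have "(p, q) \<in> ?A - Id" "(p, q') \<in> ?A - Id" using that by (auto simp: Field_def)
    then show ?thesis by (rule A)
  next
    case False
    with that(1) have "p \<notin> Field ?A" using FA by (cases p) auto
    then have "(p, q) \<in> ?B - Id" "(p, q') \<in> ?B - Id" using that by (auto simp: Field_def)
    then show ?thesis by (rule B')
  qed
  have two: "\<not> distinct [q, q', q'']" if "(p, q) \<in> ?E" "(p, q') \<in> ?E" "(p, q'') \<in> ?E" for p q q' q''
  proof -
    have "(p, r) \<in> ?A - Id \<or> (p, r) \<in> ?B - Id" if "(p, r) \<in> ?E" for r
      using that by blast
    from this[OF that(1)] this[OF that(2)] this[OF that(3)] have "q = q' \<or> q = q'' \<or> q' = q''"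
      using A[of p q q'] A[of p q q''] A[of p q' q''] B'[of p q q'] B'[of p q q''] B'[of p q' q'']
      by argo
    then show ?thesis by auto
  qed
  have fin: "finite ?E"
    by (simp add: placed_def finite_same[OF \<alpha>] finite_same[OF \<beta>])
  have sym: "sym ?E"
    using sym_placed by (auto simp: sym_def)
  have "\<not> distinct [u, v, w]" if "u \<in> B" "v \<in> B" "w \<in> B" for u v w
  proof -
    have V: "u \<in> verts m k" "v \<in> verts m k" "w \<in> verts m k"
      using that B Union_Part[OF \<alpha>\<beta>] by blast+
    have "(slot 0 0 2 u, slot 0 0 2 y) \<in> ?E\<^sup>*" if "y \<in> B" for y
    proof -
      have "(u, y) \<in> same (\<alpha> \<odot> \<beta>)" using that \<open>u \<in> B\<close> B by (auto simp: same_def)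
      then have "(slot 0 0 2 u, slot 0 0 2 y) \<in> placed 0 2 (\<alpha> \<odot> \<beta>)"
        by (auto simp: placed_def)
      then have "(slot 0 0 2 u, slot 0 0 2 y) \<in> (?A \<union> ?B)\<^sup>*"
        by (simp add: placed_prod[OF \<alpha> \<beta>, of 0 1 2])
      then show ?thesis by (simp add: rtrancl_r_diff_Id)
    qed
    then have conn: "(slot 0 0 2 u, slot 0 0 2 v) \<in> ?E\<^sup>*" "(slot 0 0 2 u, slot 0 0 2 w) \<in> ?E\<^sup>*"
      using that by auto
    have mem: "slot 0 0 2 u \<in> ?X" "slot 0 0 2 v \<in> ?X" "slot 0 0 2 w \<in> ?X"
      using V unfolding slot_verts[of 0 0 2 m k, symmetric] by auto
    have "\<not> distinct [slot 0 0 2 u, slot 0 0 2 v, slot 0 0 2 w]"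
      by (rule two_ends_per_component[where E = ?E and X = ?X, OF fin sym _ _ mem conn])
        (erule (2) two, erule (2) one)
    then show ?thesis using V by (auto elim!: verts_cases)
  qed
  then show "card B \<le> 2" using card_le_2_iff[OF finite_block[OF \<alpha>\<beta> B]] by blast
qed

text \<open>A union of blocks of size two has an even number of elements.\<close>
lemma even_card_saturated:
  assumes \<alpha>: "\<alpha> \<in> Part m n" and two: "\<forall>B\<in>\<alpha>. card B = 2"
    and X: "X \<subseteq> verts m n" "\<And>u v. u \<in> X \<Longrightarrow> (u, v) \<in> same \<alpha> \<Longrightarrow> v \<in> X"
  shows "even (card X)"
proof -
  let ?D = "{B \<in> \<alpha>. B \<subseteq> X}"
  have "X = \<Union>?D"
  proof
    show "X \<subseteq> \<Union>?D"
    proof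
      fix u assume u: "u \<in> X"
      then obtain B where "B \<in> \<alpha>" "u \<in> B" using X(1) Union_Part[OF \<alpha>] by blast
      moreover from this have "B \<subseteq> X" using X(2)[OF u] by (auto simp: same_def)
      ultimately show "u \<in> \<Union>?D" by blast
    qed
  qed blast
  moreover have "card (\<Union>?D) = sum card ?D"
    using \<alpha> finite_block[OF \<alpha>]
    by (intro card_Union_disjoint) (auto simp: Part_def partition_on_def disjoint_def pairwise_def disjnt_def)
  moreover have "sum card ?D = 2 * card ?D" using two by simp
  ultimately show ?thesis by simp
qed

text \<open>Let \<open>C0\<close>, \<open>C1\<close>, \<open>C2\<close> be the parts of a component in the three levels.  The sets \<open>C0 \<union> C1\<close> and
  \<open>C1 \<union> C2\<close> are unions of blocks of \<open>\<alpha>\<close> and of \<open>\<beta>\<close>, so that \<open>C0 \<union> C2\<close>, a block of the product, has an even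
  number of elements.\<close>
lemma prod_blocks_two:
  assumes \<alpha>: "\<alpha> \<in> Part m n" and \<beta>: "\<beta> \<in> Part n k"
    and two: "\<forall>B\<in>\<alpha>. card B = 2" "\<forall>B\<in>\<beta>. card B = 2"
  shows "\<forall>B\<in>\<alpha> \<odot> \<beta>. card B = 2"
proof
  fix B assume B: "B \<in> \<alpha> \<odot> \<beta>"
  note \<alpha>\<beta> = part_prod_Part[OF \<alpha> \<beta>]
  let ?R = "placed 0 1 \<alpha> \<union> placed 1 2 \<beta>"
  from B \<alpha>\<beta> have "B \<noteq> {}" by (auto simp: Part_def partition_on_def)
  then obtain u where u: "u \<in> B" by blast
  have V: "u \<in> verts m k" using u B Union_Part[OF \<alpha>\<beta>] by blast
  define C where "C = ?R\<^sup>* `` {slot 0 0 2 u}"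
  define C0 C1 C2 where "C0 = {x \<in> {1..m}. (0, x) \<in> C}"
    and "C1 = {x \<in> {1..n}. (1, x) \<in> C}" and "C2 = {x \<in> {1..k}. (2, x) \<in> C}"
  have closed: "q \<in> C" if "p \<in> C" "(p, q) \<in> ?R" for p q
    using that by (auto simp: C_def intro: rtrancl.rtrancl_into_rtrancl)
  have card_UL: "card (Upper ` S \<union> Lower ` S') = card S + card S'" if "finite S" "finite S'" for S S'
    using that by (subst card_Un_disjoint) (auto simp: card_image inj_on_def)
  have fin: "finite C0" "finite C1" "finite C2" by (auto simp: C0_def C1_def C2_def)
  have "v \<in> B \<longleftrightarrow> v \<in> Upper ` C0 \<union> Lower ` C2" for v
  proof -
    have "v \<in> B \<longleftrightarrow> (u, v) \<in> same (\<alpha> \<odot> \<beta>)" using block_same[OF \<alpha>\<beta> B u] by blast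
    also have "\<dots> \<longleftrightarrow> v \<in> verts m k \<and> slot 0 0 2 v \<in> C"
      using placed_iff[OF \<alpha>\<beta>, of 0 2 u v 0] same_verts[OF \<alpha>\<beta>, of u v] V
        slot_verts[of 0 0 2 m k]
      by (auto simp: placed_prod[OF \<alpha> \<beta>, of 0 1 2] C_def)
    also have "\<dots> \<longleftrightarrow> v \<in> Upper ` C0 \<union> Lower ` C2"
      by (cases v) (auto simp: C0_def C2_def)
    finally show ?thesis .
  qed
  then have cB: "card B = card C0 + card C2" using card_UL[OF fin(1,3)] by (metis subset_antisym subsetI)
  have "even (card (Upper ` C0 \<union> Lower ` C1))"
  proof (rule even_card_saturated[OF \<alpha> two(1)])
    fix v w assume vw: "v \<in> Upper ` C0 \<union> Lower ` C1" "(v, w) \<in> same \<alpha>"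
    then have "slot 0 0 1 v \<in> C" "(slot 0 0 1 v, slot 0 0 1 w) \<in> ?R"
      by (auto simp: C0_def C1_def placed_def)
    then have "slot 0 0 1 w \<in> C" using closed by blast
    then show "w \<in> Upper ` C0 \<union> Lower ` C1"
      using same_verts[OF \<alpha> vw(2)] by (cases w) (auto simp: C0_def C1_def)
  qed (auto simp: C0_def C1_def)
  moreover have "even (card (Upper ` C1 \<union> Lower ` C2))"
  proof (rule even_card_saturated[OF \<beta> two(2)])
    fix v w assume vw: "v \<in> Upper ` C1 \<union> Lower ` C2" "(v, w) \<in> same \<beta>"
    then have "slot 1 0 2 v \<in> C" "(slot 1 0 2 v, slot 1 0 2 w) \<in> ?R"
      by (auto simp: C1_def C2_def placed_def)
    then have "slot 1 0 2 w \<in> C" using closed by blast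
    then show "w \<in> Upper ` C1 \<union> Lower ` C2"
      using same_verts[OF \<beta> vw(2)] by (cases w) (auto simp: C1_def C2_def)
  qed (auto simp: C1_def C2_def)
  ultimately have "even (card B)" unfolding cB card_UL[OF fin(1,2)] card_UL[OF fin(2,3)] by presburger
  moreover have "card B \<le> 2" using prod_blocks_small[OF \<alpha> \<beta>] two B by simp
  moreover have "card B \<noteq> 0" using \<open>B \<noteq> {}\<close> finite_block[OF \<alpha>\<beta> B] by simp
  ultimately show "card B = 2" by presburger
qed

section \<open>Planar partitions\<close>

text \<open>The vertices in their order along the boundary of the rectangle: from the last upper vertex
  backwards to the first one, and on from the first lower vertex to the last one.  The value at middle
  vertices is never used.\<close>
definition bcoord :: "vertex \<Rightarrow> real" where
  "bcoord v = (case v of Upper x \<Rightarrow> - real x | Lower x \<Rightarrow> real x | Middle x \<Rightarrow> 0)"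

text \<open>No two distinct blocks interlace along the boundary.\<close>
definition noncrossing :: "vertex set set \<Rightarrow> bool" where
  "noncrossing \<alpha> \<longleftrightarrow> (\<forall>A\<in>\<alpha>. \<forall>B\<in>\<alpha>. \<forall>a\<in>A. \<forall>b\<in>B. \<forall>c\<in>A. \<forall>d\<in>B.
     bcoord a < bcoord b \<and> bcoord b < bcoord c \<and> bcoord c < bcoord d \<longrightarrow> A = B)"

lemma bcoord_simps [simp]:
  "bcoord (Upper x) = - real x" "bcoord (Lower x) = real x"
  by (simp_all add: bcoord_def)

lemma vec2_eq_iff: "(p :: real ^ 2) = q \<longleftrightarrow> p $ 1 = q $ 1 \<and> p $ 2 = q $ 2"
  by (simp add: vec_eq_iff forall_2)

lemma mem_cbox_2:
  "(p :: real ^ 2) \<in> cbox (vector [a, b]) (vector [c, d]) \<longleftrightarrow> a \<le> p $ 1 \<and> p $ 1 \<le> c \<and> b \<le> p $ 2 \<and> p $ 2 \<le> d"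
  by (auto simp: mem_box_cart forall_2)

lemma mem_rectangle:
  "p \<in> rectangle m n \<longleftrightarrow> 1 \<le> p $ 1 \<and> p $ 1 \<le> real (max m n) \<and> 0 \<le> p $ 2 \<and> p $ 2 \<le> 1"
  unfolding rectangle_def mem_cbox_2 ..

lemma continuous_on_vector_2:
  assumes "continuous_on S f" "continuous_on S g"
  shows "continuous_on S (\<lambda>x. vector [f x, g x] :: real ^ 2)"
proof -
  have eq: "(\<lambda>x. vector [f x, g x] :: real ^ 2) = (\<lambda>x. \<chi> i. if i = 1 then f x else g x)"
    by (simp add: fun_eq_iff vec2_eq_iff)
  have "continuous_on S (\<lambda>x. \<chi> i. if i = (1 :: 2) then f x else g x)"
  proof (rule continuous_on_vec_lambda)
    fix i :: 2
    show "continuous_on S (\<lambda>x. if i = 1 then f x else g x)"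
      using assms by (cases "i = 1") simp_all
  qed
  then show ?thesis unfolding eq .
qed

lemma position_inj:
  "u \<in> verts m n \<Longrightarrow> v \<in> verts m n \<Longrightarrow> position u = position v \<Longrightarrow> u = v"
  by (elim verts_cases) (auto simp: vec2_eq_iff)

subsection \<open>Crossing paths meet\<close>

text \<open>The rectangle is bent into a half annulus, with \<open>p $ 1\<close> as radius and \<open>pi * p $ 2\<close> as angle.  The top
  and the bottom edge come to lie on one line, on which a vertex \<open>v\<close> has the coordinate \<open>bcoord v\<close>.\<close>
definition bend :: "real ^ 2 \<Rightarrow> real ^ 2" where
  "bend p = vector [p $ 1 * cos (pi * p $ 2), p $ 1 * sin (pi * p $ 2)]"

lemma continuous_on_bend: "continuous_on S bend"
proof -
  have "continuous_on S (\<lambda>p :: real ^ 2. vector [p $ 1 * cos (pi * p $ 2), p $ 1 * sin (pi * p $ 2)] :: real ^ 2)"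
    by (intro continuous_on_vector_2 continuous_intros)
  then show ?thesis by (simp add: bend_def[abs_def])
qed

lemma bend_inj:
  assumes "p $ 1 > 0" "q $ 1 > 0" "0 \<le> p $ 2" "p $ 2 \<le> 1" "0 \<le> q $ 2" "q $ 2 \<le> 1" "bend p = bend q"
  shows "p = q"
proof -
  have eq: "p $ 1 * cos (pi * p $ 2) = q $ 1 * cos (pi * q $ 2)"
    "p $ 1 * sin (pi * p $ 2) = q $ 1 * sin (pi * q $ 2)"
    using assms(7) by (simp_all add: bend_def vec2_eq_iff)
  have sq: "(r * cos t)\<^sup>2 + (r * sin t)\<^sup>2 = r\<^sup>2" for r t :: real
    by (simp add: power_mult_distrib flip: distrib_left)
  have "(p $ 1)\<^sup>2 = (q $ 1)\<^sup>2"
    using eq sq[of "p $ 1" "pi * p $ 2"] sq[of "q $ 1" "pi * q $ 2"] by simp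
  then have 1: "p $ 1 = q $ 1" using assms(1,2) by (simp add: power2_eq_iff)
  with eq(1) assms(1) have "cos (pi * p $ 2) = cos (pi * q $ 2)" by simp
  moreover have "0 \<le> pi * t \<and> pi * t \<le> pi" if "0 \<le> t" "t \<le> 1" for t
    using that by (simp add: mult_left_le)
  ultimately have "pi * p $ 2 = pi * q $ 2"
    using cos_inj_pi[of "pi * p $ 2" "pi * q $ 2"] assms(3-6) by blast
  with 1 show ?thesis by (simp add: vec2_eq_iff)
qed

lemma bend_position: "v \<in> verts m n \<Longrightarrow> bend (position v) = vector [bcoord v, 0]"
  by (elim verts_cases) (auto simp: bend_def)

text \<open>Fashoda's theorem, in the form for four interlacing points on one side of a box, applied after bending.\<close>
lemma interlaced_paths_meet:
  fixes N :: real
  assumes paths: "path f" "path g"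
    and box: "path_image f \<subseteq> cbox (vector [1, 0]) (vector [N, 1])"
      "path_image g \<subseteq> cbox (vector [1, 0]) (vector [N, 1])"
    and ends: "pathstart f = position a" "pathstart g = position b"
      "pathfinish f = position c" "pathfinish g = position d"
    and verts: "{a, b, c, d} \<subseteq> verts m n"
    and order: "bcoord a < bcoord b" "bcoord b < bcoord c" "bcoord c < bcoord d"
  shows "path_image f \<inter> path_image g \<noteq> {}"
proof -
  let ?a = "vector [- N, 0] :: real ^ 2" and ?b = "vector [N, N] :: real ^ 2"
  have bend_box: "bend p \<in> cbox ?a ?b" if "p \<in> cbox (vector [1, 0]) (vector [N, 1])" for p
  proof -
    have p: "1 \<le> p $ 1" "p $ 1 \<le> N" "0 \<le> p $ 2" "p $ 2 \<le> 1" using that by (auto simp: mem_cbox_2)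
    have "\<bar>p $ 1 * cos (pi * p $ 2)\<bar> \<le> p $ 1 * 1"
      unfolding abs_mult using p by (intro mult_mono) auto
    moreover have "p $ 1 * sin (pi * p $ 2) \<le> N"
      by (rule order_trans[OF mult_left_mono[of "sin (pi * p $ 2)" 1 "p $ 1"]]) (use p in auto)
    moreover have "0 \<le> sin (pi * p $ 2)"
      using p by (intro sin_ge_zero) (simp_all add: mult_left_le)
    ultimately show ?thesis using p by (auto simp: mem_cbox_2 bend_def)
  qed
  have V: "a \<in> verts m n" "b \<in> verts m n" "c \<in> verts m n" "d \<in> verts m n" using verts by auto
  obtain z where "z \<in> path_image (bend \<circ> f)" "z \<in> path_image (bend \<circ> g)"
  proof (rule fashoda_interlace[of "bend \<circ> f" "bend \<circ> g" ?a ?b])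
    show "path (bend \<circ> f)" "path (bend \<circ> g)"
      using paths continuous_on_bend by (auto intro: path_continuous_image)
    show "path_image (bend \<circ> f) \<subseteq> cbox ?a ?b" "path_image (bend \<circ> g) \<subseteq> cbox ?a ?b"
      using box bend_box unfolding path_image_compose by blast+
  qed (use ends order V in \<open>simp_all add: pathstart_compose pathfinish_compose bend_position\<close>)
  then obtain p q where pq: "p \<in> path_image f" "q \<in> path_image g" "bend p = bend q"
    unfolding path_image_compose by auto
  with box have "p \<in> cbox (vector [1, 0]) (vector [N, 1])" "q \<in> cbox (vector [1, 0]) (vector [N, 1])"
    by blast+
  then have "1 \<le> p $ 1" "1 \<le> q $ 1" "0 \<le> p $ 2" "p $ 2 \<le> 1" "0 \<le> q $ 2" "q $ 2 \<le> 1"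
    unfolding mem_cbox_2 by blast+
  then have "p = q" using bend_inj[of p q] pq(3) by linarith
  with pq show ?thesis by blast
qed

subsection \<open>Thickened graphs\<close>

text \<open>In a thickened graph each vertex \<open>v\<close> is represented by a set \<open>V v\<close> of points, and \<open>P\<close> is a collection of
  pairs \<open>(w, Z)\<close>, where the set \<open>Z\<close> of points represents an edge with vertex set \<open>w\<close>.\<close>
definition adjacency :: "('v set \<times> 'a set) set \<Rightarrow> ('v \<times> 'v) set" where
  "adjacency P = {(u, v). \<exists>(w, Z)\<in>P. u \<in> w \<and> v \<in> w}"

lemma adjacencyI: "(w, Z) \<in> P \<Longrightarrow> u \<in> w \<Longrightarrow> v \<in> w \<Longrightarrow> (u, v) \<in> adjacency P"
  by (auto simp: adjacency_def)

text \<open>The union of all sets representing vertices or edges in the component of \<open>u\<close>.\<close>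
definition region :: "('v \<Rightarrow> 'a set) \<Rightarrow> ('v set \<times> 'a set) set \<Rightarrow> 'v \<Rightarrow> 'a set" where
  "region V P u = \<Union>(V ` ((adjacency P)\<^sup>* `` {u})) \<union> \<Union>{Z. \<exists>w. (w, Z) \<in> P \<and> w \<inter> (adjacency P)\<^sup>* `` {u} \<noteq> {}}"

lemma region_connected:
  fixes V :: "'v \<Rightarrow> 'a :: topological_space set"
  assumes V: "\<And>v. path_connected (V v)" and Z: "\<And>w Z. (w, Z) \<in> P \<Longrightarrow> path_connected Z"
    and meet: "\<And>w Z v. (w, Z) \<in> P \<Longrightarrow> v \<in> w \<Longrightarrow> V v \<inter> Z \<noteq> {}"
    and uv: "(u, v) \<in> (adjacency P)\<^sup>*" and p: "p \<in> V u" and q: "q \<in> V v"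
  shows "path_component (region V P u) p q"
  using uv q
proof (induction arbitrary: q)
  case base
  have "V u \<subseteq> region V P u" by (auto simp: region_def)
  moreover have "path_component (V u) p q" using V[of u] p base by (auto simp: path_connected_component)
  ultimately show ?case using path_component_of_subset by blast
next
  case (step v v')
  then obtain w Z where wZ: "(w, Z) \<in> P" "v \<in> w" "v' \<in> w" by (auto simp: adjacency_def)
  obtain r where r: "r \<in> V v" "r \<in> Z" using meet[OF wZ(1,2)] by blast
  obtain r' where r': "r' \<in> V v'" "r' \<in> Z" using meet[OF wZ(1,3)] by blast
  have uv': "(u, v') \<in> (adjacency P)\<^sup>*" using step.hyps by (rule rtrancl.rtrancl_into_rtrancl)
  have sub: "Z \<subseteq> region V P u" "V v' \<subseteq> region V P u"
    using wZ step.hyps(1) uv' unfolding region_def by blast+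
  note path_component_trans [trans]
  have "path_component (region V P u) p r" using step.IH r by blast
  also have "path_component Z r r'" using Z[OF wZ(1)] r r' by (auto simp: path_connected_component)
  then have "path_component (region V P u) r r'" using sub path_component_of_subset by blast
  also have "path_component (V v') r' q" using V[of v'] r' step.prems by (auto simp: path_connected_component)
  then have "path_component (region V P u) r' q" using sub path_component_of_subset by blast
  finally show ?case .
qed

lemma region_disjoint:
  assumes W: "\<And>w Z. (w, Z) \<in> P \<Longrightarrow> w \<subseteq> W" "u \<in> W" "u' \<in> W"
    and VV: "\<And>v v'. v \<in> W \<Longrightarrow> v' \<in> W \<Longrightarrow> V v \<inter> V v' \<noteq> {} \<Longrightarrow> v = v'"
    and VZ: "\<And>v w Z. v \<in> W \<Longrightarrow> (w, Z) \<in> P \<Longrightarrow> V v \<inter> Z \<noteq> {} \<Longrightarrow> v \<in> w"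
    and ZZ: "\<And>w Z w' Z'. (w, Z) \<in> P \<Longrightarrow> (w', Z') \<in> P \<Longrightarrow> Z \<inter> Z' \<noteq> {} \<Longrightarrow> w \<inter> w' \<noteq> {}"
    and uu': "(u, u') \<notin> (adjacency P)\<^sup>*"
  shows "region V P u \<inter> region V P u' = {}"
proof (rule ccontr)
  let ?J = "(adjacency P)\<^sup>*"
  have sym: "(y, x) \<in> ?J" if "(x, y) \<in> ?J" for x y
    using that sym_rtrancl[of "adjacency P"] by (auto simp: sym_def adjacency_def)
  have JW: "v \<in> W" if "(x, v) \<in> ?J" "x \<in> W" for x v
    using that by (induction rule: rtrancl_induct) (use W(1) in \<open>auto simp: adjacency_def\<close>)
  have ext: "(x, y') \<in> ?J" if "(x, y) \<in> ?J" "(w, Z) \<in> P" "y \<in> w" "y' \<in> w" for x y y' w Z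
    using that by (auto simp: adjacency_def intro: rtrancl.rtrancl_into_rtrancl)
  assume "region V P u \<inter> region V P u' \<noteq> {}"
  then obtain z where z: "z \<in> region V P u" "z \<in> region V P u'" by blast
  have "\<exists>S. (\<forall>x\<in>S. (y, x) \<in> ?J) \<and> ((\<exists>v\<in>W. S = {v} \<and> z \<in> V v) \<or> (\<exists>Z. (S, Z) \<in> P \<and> z \<in> Z))"
    if "z \<in> region V P y" "y \<in> W" for y
    using that(1) unfolding region_def
  proof
    assume "z \<in> \<Union>(V ` (?J `` {y}))"
    then obtain v where "(y, v) \<in> ?J" "z \<in> V v" by blast
    with JW that show ?thesis by (intro exI[of _ "{v}"]) auto
  next
    assume "z \<in> \<Union>{Z. \<exists>w. (w, Z) \<in> P \<and> w \<inter> ?J `` {y} \<noteq> {}}"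
    then obtain w Z x where "(w, Z) \<in> P" "z \<in> Z" "x \<in> w" "(y, x) \<in> ?J" by blast
    with ext show ?thesis by (intro exI[of _ w]) blast
  qed
  from this[OF z(1) W(2)] this[OF z(2) W(3)]
  obtain S S' where S: "\<forall>x\<in>S. (u, x) \<in> ?J" "(\<exists>v\<in>W. S = {v} \<and> z \<in> V v) \<or> (\<exists>Z. (S, Z) \<in> P \<and> z \<in> Z)"
    and S': "\<forall>x\<in>S'. (u', x) \<in> ?J" "(\<exists>v\<in>W. S' = {v} \<and> z \<in> V v) \<or> (\<exists>Z. (S', Z) \<in> P \<and> z \<in> Z)"
    by blast
  have "S \<inter> S' \<noteq> {}"
    using S(2) S'(2)
  proof (elim disjE bexE exE conjE)
    fix v v' assume "v \<in> W" "v' \<in> W" "S = {v}" "S' = {v'}" "z \<in> V v" "z \<in> V v'"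
    then show ?thesis using VV[of v v'] by blast
  next
    fix v Z assume "v \<in> W" "S = {v}" "z \<in> V v" "(S', Z) \<in> P" "z \<in> Z"
    then show ?thesis using VZ[of v S' Z] by blast
  next
    fix v Z assume "v \<in> W" "S' = {v}" "z \<in> V v" "(S, Z) \<in> P" "z \<in> Z"
    then show ?thesis using VZ[of v S Z] by blast
  next
    fix Z Z' assume "(S, Z) \<in> P" "z \<in> Z" "(S', Z') \<in> P" "z \<in> Z'"
    then show ?thesis using ZZ[of S Z S' Z'] by blast
  qed
  then obtain x where "(u, x) \<in> ?J" "(x, u') \<in> ?J" using S(1) S'(1) sym by blast
  then have "(u, u') \<in> ?J" by (rule rtrancl_trans)
  with uu' show False by contradiction
qed

subsection \<open>Stacking drawings\<close>

text \<open>For the product of \<open>\<alpha>\<close> and \<open>\<beta>\<close> the drawing of \<open>\<alpha>\<close> is squeezed into the upper third of the rectangle, and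
  the drawing of \<open>\<beta>\<close> into the lower third.  The middle third is needed because edges of both drawings may
  run along the line in which the two rectangles would otherwise meet.\<close>
definition upper_third :: "real ^ 2 \<Rightarrow> real ^ 2" where
  "upper_third p = vector [p $ 1, (p $ 2 + 2) / 3]"

definition lower_third :: "real ^ 2 \<Rightarrow> real ^ 2" where
  "lower_third p = vector [p $ 1, p $ 2 / 3]"

text \<open>An outer vertex is represented by its position, a middle vertex \<open>(1, x)\<close> by a vertical segment across the
  middle third.  Only the levels \<open>0\<close>, \<open>1\<close> and \<open>2\<close> are used.\<close>
definition vertex_set :: "nat \<times> nat \<Rightarrow> (real ^ 2) set" where
  "vertex_set v = (if fst v = 0 then {vector [real (snd v), 1]}
     else if fst v = 1 then cbox (vector [real (snd v), 1/3]) (vector [real (snd v), 2/3])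
     else {vector [real (snd v), 0]})"

lemma represents_same:
  assumes "represents m n E \<alpha>" 
  shows "same \<alpha> = joined E \<inter> verts m n \<times> verts m n"
  using assms unfolding represents_def classes_on_def by (metis equiv_joined same_of_quotient)

lemma represents_adjacent:
  assumes "represents m n E \<alpha>" "e \<in> E" "u \<in> e" "v \<in> e"
  shows "(u, v) \<in> same \<alpha>"
proof -
  have e: "e \<subseteq> verts m n" "card e = 2" using assms by (auto simp: represents_def)
  have "(u, v) \<in> joined E"
  proof (cases "u = v")
    case False
    with e assms have "e = {u, v}" by (metis card_2_iff doubleton_eq_iff insertE singletonD)
    with assms show ?thesis by (auto simp: joined_def)
  qed (simp add: joined_def)
  with e assms represents_same[OF assms(1)] show ?thesis by auto
qed

lemma planar_drawingD:
  assumes "planar_drawing m n E g" "e \<in> E"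
  shows "arc (g e)" "path_image (g e) \<subseteq> rectangle m n"
    "path_image (g e) \<inter> position ` verts m n = position ` e"
    "f \<in> E \<Longrightarrow> path_image (g e) \<inter> path_image (g f) \<noteq> {} \<Longrightarrow> position ` e \<subseteq> position ` verts m n \<Longrightarrow> e \<noteq> {} \<Longrightarrow> e \<inter> f \<noteq> {}"
  using assms unfolding planar_drawing_def by blast+

text \<open>Different components of the stacked picture occupy disjoint regions, and each region is path connected;
  so interlacing blocks of the product would give disjoint paths with interlacing ends.\<close>
lemma prod_noncrossing:
  assumes \<alpha>: "\<alpha> \<in> Part m n" and \<beta>: "\<beta> \<in> Part n k"
    and E: "represents m n E \<alpha>" "planar_drawing m n E g"
    and F: "represents n k F \<beta>" "planar_drawing n k F h"
  shows "noncrossing (\<alpha> \<odot> \<beta>)"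
proof -
  note \<alpha>\<beta> = part_prod_Part[OF \<alpha> \<beta>]
  let ?s = "slot 0 0 1" and ?t = "slot 1 0 2"
  define P where "P = (\<lambda>e. (?s ` e, upper_third ` path_image (g e))) ` E \<union>
    (\<lambda>e. (?t ` e, lower_third ` path_image (h e))) ` F"
  define W where "W = ends 0 m 1 n \<union> ends 1 n 2 k"
  let ?V = vertex_set
  let ?J = "(adjacency P)\<^sup>*"
  have e_verts: "e \<subseteq> verts m n" "e \<noteq> {}" if "e \<in> E" for e
    using E(1) that by (auto simp: represents_def)
  have f_verts: "f \<subseteq> verts n k" "f \<noteq> {}" if "f \<in> F" for f
    using F(1) that by (auto simp: represents_def)
  have PE: "(\<exists>e\<in>E. w = ?s ` e \<and> Z = upper_third ` path_image (g e)) \<or>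
      (\<exists>f\<in>F. w = ?t ` f \<and> Z = lower_third ` path_image (h f))" if "(w, Z) \<in> P" for w Z
    using that by (auto simp: P_def)
  \<comment> \<open>The components of the thickened graph are those of the product graph.\<close>
  have J: "(slot 0 0 2 u, slot 0 0 2 v) \<in> ?J \<longleftrightarrow> (u, v) \<in> same (\<alpha> \<odot> \<beta>)"
    if uv: "u \<in> verts m k" "v \<in> verts m k" for u v
  proof -
    let ?R = "placed 0 1 \<alpha> \<union> placed 1 2 \<beta>"
    have "adjacency P \<subseteq> ?R"
    proof (rule subrelI)
      fix p q assume "(p, q) \<in> adjacency P"
      then obtain w Z where "(w, Z) \<in> P" "p \<in> w" "q \<in> w" by (auto simp: adjacency_def)
      with PE[of w Z] consider e u v where "e \<in> E" "u \<in> e" "v \<in> e" "p = ?s u" "q = ?s v"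
        | f u v where "f \<in> F" "u \<in> f" "v \<in> f" "p = ?t u" "q = ?t v" by blast
      then show "(p, q) \<in> ?R"
      proof cases
        case 1
        then have "map_prod ?s ?s (u, v) \<in> map_prod ?s ?s ` same \<alpha>"
          using represents_adjacent[OF E(1)] by (intro imageI) blast
        with 1 show ?thesis by (simp add: placed_def)
      next
        case 2
        then have "map_prod ?t ?t (u, v) \<in> map_prod ?t ?t ` same \<beta>"
          using represents_adjacent[OF F(1)] by (intro imageI) blast
        with 2 show ?thesis by (simp add: placed_def)
      qed
    qed
    then have "?J \<subseteq> ?R\<^sup>*" by (rule rtrancl_mono)
    moreover have "?R \<subseteq> ?J"
    proof (rule subrelI)
      have s: "(?s u, ?s v) \<in> ?J" if "(u, v) \<in> joined E" for u v
        using that unfolding joined_def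
      proof induction
        case (step v w)
        then have "(?s ` {v, w}, upper_third ` path_image (g {v, w})) \<in> P"
          unfolding P_def by blast
        then have "(?s v, ?s w) \<in> adjacency P" by (rule adjacencyI) simp_all
        with step.IH show ?case by (rule rtrancl.rtrancl_into_rtrancl)
      qed simp
      have t: "(?t u, ?t v) \<in> ?J" if "(u, v) \<in> joined F" for u v
        using that unfolding joined_def
      proof induction
        case (step v w)
        then have "(?t ` {v, w}, lower_third ` path_image (h {v, w})) \<in> P"
          unfolding P_def by blast
        then have "(?t v, ?t w) \<in> adjacency P" by (rule adjacencyI) simp_all
        with step.IH show ?case by (rule rtrancl.rtrancl_into_rtrancl)
      qed simp
      fix p q assume "(p, q) \<in> ?R"
      then show "(p, q) \<in> ?J"
        using s t represents_same[OF E(1)] represents_same[OF F(1)] by (auto simp: placed_def)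
    qed
    then have "?R\<^sup>* \<subseteq> ?J" by (rule rtrancl_subset_rtrancl)
    ultimately have "?J = ?R\<^sup>*" by blast
    moreover have "slot 0 0 2 u \<in> ends 0 m 2 k" "slot 0 0 2 v \<in> ends 0 m 2 k"
      using uv unfolding slot_verts[of 0 0 2 m k, symmetric] by auto
    ultimately show ?thesis
      using placed_iff[OF \<alpha>\<beta> _ uv, of 0 2 0] by (simp add: placed_prod[OF \<alpha> \<beta>, of 0 1 2])
  qed
  have Vconn: "path_connected (?V v)" for v
    by (auto simp: vertex_set_def intro: convex_imp_path_connected)
  have cont: "continuous_on S upper_third" "continuous_on S lower_third" for S
    unfolding upper_third_def[abs_def] lower_third_def[abs_def]
    by (rule continuous_on_vector_2; rule continuous_intros; simp add: continuous_intros)+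
  have Zconn: "path_connected Z" if "(w, Z) \<in> P" for w Z
  proof -
    have "path_connected (path_image (g e))" if "e \<in> E" for e
      using planar_drawingD(1)[OF E(2) that] by (simp add: arc_imp_path path_connected_path_image)
    moreover have "path_connected (path_image (h f))" if "f \<in> F" for f
      using planar_drawingD(1)[OF F(2) that] by (simp add: arc_imp_path path_connected_path_image)
    ultimately show ?thesis
      using PE[OF that] cont path_connected_continuous_image by metis
  qed
  have up_pos: "upper_third (position u) \<in> ?V (?s u)" if "u \<in> verts m n" for u
    using that by (elim verts_cases) (auto simp: upper_third_def vertex_set_def mem_cbox_2)
  have low_pos: "lower_third (position u) \<in> ?V (?t u)" if "u \<in> verts n k" for u
    using that by (elim verts_cases) (auto simp: lower_third_def vertex_set_def mem_cbox_2)
  have g_pos: "position u \<in> path_image (g e) \<longleftrightarrow> u \<in> e" if "e \<in> E" "u \<in> verts m n" for e u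
    using planar_drawingD(3)[OF E(2) that(1)] that(2) e_verts[OF that(1)] position_inj by blast
  have h_pos: "position u \<in> path_image (h e) \<longleftrightarrow> u \<in> e" if "e \<in> F" "u \<in> verts n k" for e u
    using planar_drawingD(3)[OF F(2) that(1)] that(2) f_verts[OF that(1)] position_inj by blast
  have g_box: "1 \<le> p $ 1" "p $ 1 \<le> real (max m n)" "0 \<le> p $ 2" "p $ 2 \<le> 1" if "e \<in> E" "p \<in> path_image (g e)" for e p
    using subsetD[OF planar_drawingD(2)[OF E(2) that(1)] that(2)] by (simp_all add: mem_rectangle)
  have h_box: "1 \<le> p $ 1" "p $ 1 \<le> real (max n k)" "0 \<le> p $ 2" "p $ 2 \<le> 1" if "e \<in> F" "p \<in> path_image (h e)" for e p
    using subsetD[OF planar_drawingD(2)[OF F(2) that(1)] that(2)] by (simp_all add: mem_rectangle)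
  have meet: "?V v \<inter> Z \<noteq> {}" if "(w, Z) \<in> P" "v \<in> w" for w Z v
    using PE[OF that(1)]
  proof (elim disjE bexE conjE)
    fix e assume e: "e \<in> E" "w = ?s ` e" "Z = upper_third ` path_image (g e)"
    with that obtain u where u: "u \<in> e" "v = ?s u" by blast
    with e e_verts g_pos have "position u \<in> path_image (g e)" "u \<in> verts m n" by blast+
    with u e up_pos[of u] show ?thesis by blast
  next
    fix e assume e: "e \<in> F" "w = ?t ` e" "Z = lower_third ` path_image (h e)"
    with that obtain u where u: "u \<in> e" "v = ?t u" by blast
    with e f_verts h_pos have "position u \<in> path_image (h e)" "u \<in> verts n k" by blast+
    with u e low_pos[of u] show ?thesis by blast
  qed
  have PW: "w \<subseteq> W" if "(w, Z) \<in> P" for w Z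
    using PE[OF that] e_verts f_verts slot_verts[of 0 0 1 m n] slot_verts[of 1 0 2 n k]
    unfolding W_def by blast
  have W_cases: "(\<exists>x\<in>{1..m}. v = (0, x)) \<or> (\<exists>x\<in>{1..n}. v = (1, x)) \<or> (\<exists>x\<in>{1..k}. v = (2, x))" if "v \<in> W" for v
    using that by (cases v) (auto simp: W_def)
  have VV: "v = v'" if "v \<in> W" "v' \<in> W" "?V v \<inter> ?V v' \<noteq> {}" for v v'
    using W_cases[OF that(1)] W_cases[OF that(2)] that(3)
    by (elim disjE bexE) (auto simp: vertex_set_def mem_cbox_2 vec2_eq_iff)
  have VZ: "v \<in> w" if "v \<in> W" "(w, Z) \<in> P" "?V v \<inter> Z \<noteq> {}" for v w Z
    using PE[OF that(2)]
  proof (elim disjE bexE conjE)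
    fix e assume e: "e \<in> E" "w = ?s ` e" "Z = upper_third ` path_image (g e)"
    with that(3) obtain p where p: "p \<in> path_image (g e)" "upper_third p \<in> ?V v" by blast
    note b = g_box[OF e(1) p(1)]
    from W_cases[OF that(1)] show ?thesis
    proof (elim disjE bexE)
      fix x assume x: "x \<in> {1..m}" "v = (0, x)"
      with p b have "p = position (Upper x)" by (auto simp: vertex_set_def upper_third_def vec2_eq_iff)
      with p g_pos[OF e(1), of "Upper x"] x have "Upper x \<in> e" by auto
      with x e show ?thesis by force
    next
      fix x assume x: "x \<in> {1..n}" "v = (1, x)"
      with p b have "p = position (Lower x)"
        by (auto simp: vertex_set_def upper_third_def mem_cbox_2 vec2_eq_iff)
      with p g_pos[OF e(1), of "Lower x"] x have "Lower x \<in> e" by auto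
      with x e show ?thesis by force
    qed (use p b in \<open>auto simp: vertex_set_def upper_third_def vec2_eq_iff\<close>)
  next
    fix e assume e: "e \<in> F" "w = ?t ` e" "Z = lower_third ` path_image (h e)"
    with that(3) obtain p where p: "p \<in> path_image (h e)" "lower_third p \<in> ?V v" by blast
    note b = h_box[OF e(1) p(1)]
    from W_cases[OF that(1)] show ?thesis
    proof (elim disjE bexE)
      fix x assume x: "x \<in> {1..n}" "v = (1, x)"
      with p b have "p = position (Upper x)"
        by (auto simp: vertex_set_def lower_third_def mem_cbox_2 vec2_eq_iff)
      with p h_pos[OF e(1), of "Upper x"] x have "Upper x \<in> e" by auto
      with x e show ?thesis by force
    next
      fix x assume x: "x \<in> {1..k}" "v = (2, x)"
      with p b have "p = position (Lower x)"
        by (auto simp: vertex_set_def lower_third_def vec2_eq_iff)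
      with p h_pos[OF e(1), of "Lower x"] x have "Lower x \<in> e" by auto
      with x e show ?thesis by force
    qed (use p b in \<open>auto simp: vertex_set_def lower_third_def vec2_eq_iff\<close>)
  qed
  have inj_third: "p = q" if "upper_third p = upper_third q \<or> lower_third p = lower_third q" for p q
    using that by (auto simp: upper_third_def lower_third_def vec2_eq_iff)
  \<comment> \<open>The upper third has height at least \<open>2/3\<close>, the lower third at most \<open>1/3\<close>.\<close>
  have sep: "upper_third p \<noteq> lower_third q"
    if "e \<in> E" "p \<in> path_image (g e)" "f \<in> F" "q \<in> path_image (h f)" for e p f q
    using g_box(3)[OF that(1,2)] h_box(4)[OF that(3,4)]
    by (auto simp: upper_third_def lower_third_def vec2_eq_iff)
  have ZZ: "w \<inter> w' \<noteq> {}" if "(w, Z) \<in> P" "(w', Z') \<in> P" "Z \<inter> Z' \<noteq> {}" for w Z w' Z'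
    using PE[OF that(1)] PE[OF that(2)]
  proof (elim disjE bexE conjE)
    fix e e' assume e: "e \<in> E" "w = ?s ` e" "Z = upper_third ` path_image (g e)"
      "e' \<in> E" "w' = ?s ` e'" "Z' = upper_third ` path_image (g e')"
    with that(3) inj_third have "path_image (g e) \<inter> path_image (g e') \<noteq> {}" by blast
    with planar_drawingD(4)[OF E(2) e(1,4)] e_verts[OF e(1)] have "e \<inter> e' \<noteq> {}" by blast
    with e show ?thesis by blast
  next
    fix e e' assume e: "e \<in> F" "w = ?t ` e" "Z = lower_third ` path_image (h e)"
      "e' \<in> F" "w' = ?t ` e'" "Z' = lower_third ` path_image (h e')"
    with that(3) inj_third have "path_image (h e) \<inter> path_image (h e') \<noteq> {}" by blast
    with planar_drawingD(4)[OF F(2) e(1,4)] f_verts[OF e(1)] have "e \<inter> e' \<noteq> {}" by blast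
    with e show ?thesis by blast
  next
    fix e f assume e: "e \<in> E" "Z = upper_third ` path_image (g e)"
      "f \<in> F" "Z' = lower_third ` path_image (h f)"
    with that(3) sep show ?thesis by blast
  next
    fix e f assume e: "e \<in> E" "Z' = upper_third ` path_image (g e)"
      "f \<in> F" "Z = lower_third ` path_image (h f)"
    with that(3) sep show ?thesis by blast
  qed
  define N where "N = real (max m (max n k))"
  let ?box = "cbox (vector [1, 0]) (vector [N, 1]) :: (real ^ 2) set"
  have Vbox: "?V v \<subseteq> ?box" if "v \<in> W" for v
    using W_cases[OF that] by (elim disjE bexE) (auto simp: vertex_set_def mem_cbox_2 N_def)
  have Zbox: "Z \<subseteq> ?box" if "(w, Z) \<in> P" for w Z
    using PE[OF that]
  proof (elim disjE bexE conjE)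
    fix e assume e: "e \<in> E" "Z = upper_third ` path_image (g e)"
    show ?thesis
    proof
      fix z assume "z \<in> Z"
      then obtain p where p: "p \<in> path_image (g e)" "z = upper_third p" using e by blast
      show "z \<in> ?box" using g_box[OF e(1) p(1)] by (auto simp: p(2) upper_third_def mem_cbox_2 N_def)
    qed
  next
    fix e assume e: "e \<in> F" "Z = lower_third ` path_image (h e)"
    show ?thesis
    proof
      fix z assume "z \<in> Z"
      then obtain p where p: "p \<in> path_image (h e)" "z = lower_third p" using e by blast
      show "z \<in> ?box" using h_box[OF e(1) p(1)] by (auto simp: p(2) lower_third_def mem_cbox_2 N_def)
    qed
  qed
  have JW: "v \<in> W" if "(x, v) \<in> ?J" "x \<in> W" for x v
    using that by (induction rule: rtrancl_induct) (use PW in \<open>auto simp: adjacency_def\<close>)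
  have Rbox: "region ?V P x \<subseteq> ?box" if "x \<in> W" for x
    unfolding region_def using Vbox Zbox JW[OF _ that] by blast
  have pos: "position u \<in> ?V (slot 0 0 2 u)" "slot 0 0 2 u \<in> W" if "u \<in> verts m k" for u
    using that by (auto elim!: verts_cases simp: vertex_set_def W_def)
  show ?thesis
    unfolding noncrossing_def
  proof (intro ballI impI, elim conjE, rule ccontr)
    fix A B a b c d
    assume AB: "A \<in> \<alpha> \<odot> \<beta>" "B \<in> \<alpha> \<odot> \<beta>" "A \<noteq> B" and mem: "a \<in> A" "b \<in> B" "c \<in> A" "d \<in> B"
      and order: "bcoord a < bcoord b" "bcoord b < bcoord c" "bcoord c < bcoord d"
    let ?r = "slot 0 0 2"
    have v: "{a, b, c, d} \<subseteq> verts m k" using AB mem Union_Part[OF \<alpha>\<beta>] by blast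
    have ac: "(?r a, ?r c) \<in> ?J" and bd: "(?r b, ?r d) \<in> ?J"
    proof -
      have "(a, c) \<in> same (\<alpha> \<odot> \<beta>)" "(b, d) \<in> same (\<alpha> \<odot> \<beta>)"
        using AB mem by (auto simp: same_def)
      then show "(?r a, ?r c) \<in> ?J" "(?r b, ?r d) \<in> ?J"
        using J[of a c] J[of b d] v by simp_all
    qed
    have "(a, b) \<notin> same (\<alpha> \<odot> \<beta>)"
    proof
      assume "(a, b) \<in> same (\<alpha> \<odot> \<beta>)"
      then have "b \<in> A" using block_same[OF \<alpha>\<beta> AB(1) mem(1)] by simp
      then show False using block_same[OF \<alpha>\<beta> AB(1)] block_same[OF \<alpha>\<beta> AB(2) mem(2)] AB(3) by metis
    qed
    then have ab: "(?r a, ?r b) \<notin> ?J" using J[of a b] v by simp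
    have disj: "region ?V P (?r a) \<inter> region ?V P (?r b) = {}"
    proof (rule region_disjoint[where W = W])
      show "?r a \<in> W" "?r b \<in> W" using pos v by simp_all
    qed (fact PW VV VZ ZZ ab)+
    have "path_component (region ?V P (?r a)) (position a) (position c)"
      "path_component (region ?V P (?r b)) (position b) (position d)"
      using v pos ac bd by (simp_all add: region_connected[OF Vconn Zconn meet])
    then obtain \<phi> \<psi> where paths: "path \<phi>" "path \<psi>"
      and img: "path_image \<phi> \<subseteq> region ?V P (?r a)" "path_image \<psi> \<subseteq> region ?V P (?r b)"
      and ends: "pathstart \<phi> = position a" "pathstart \<psi> = position b" 
        "pathfinish \<phi> = position c" "pathfinish \<psi> = position d"
      unfolding path_component_def by blast
    have "path_image \<phi> \<subseteq> ?box" "path_image \<psi> \<subseteq> ?box"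
      using img Rbox pos v by blast+
    from interlaced_paths_meet[OF paths this ends v order] img disj show False by blast
  qed
qed

subsection \<open>Drawing a noncrossing partition\<close>

text \<open>A continuous function from \<open>0\<close> to \<open>1\<close> that is constant except on the middle third of the unit interval.\<close>
definition step_height :: "real \<Rightarrow> real" where
  "step_height t = max 0 (min 1 (3 * t - 1))"

text \<open>The curve drawn for an edge whose ends have boundary coordinates \<open>a < b\<close>, in a rectangle with right
  end \<open>N\<close>: an arch on the bottom edge if both are positive, an arch on the top edge if both are negative,
  and otherwise a curve from the bottom to the top that is vertical near both.  Dividing by \<open>N\<^sup>2\<close>
  keeps the height of the arches at most \<open>1/4\<close>, within the zone where the curves of the third kind are vertical.\<close>
definition curve :: "real \<Rightarrow> real \<Rightarrow> real \<Rightarrow> real \<Rightarrow> real ^ 2" where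
  "curve N a b t = (let s = a + t * (b - a); h = (s - a) * (b - s) / N\<^sup>2 in
     if 0 < a then vector [s, h]
     else if b < 0 then vector [- s, 1 - h]
     else vector [b + (- a - b) * step_height t, t])"

text \<open>The position of the vertex with boundary coordinate \<open>a\<close>.\<close>
definition boundary_point :: "real \<Rightarrow> real ^ 2" where
  "boundary_point a = (if 0 < a then vector [a, 0] else vector [- a, 1])"

lemma step_height_simps:
  "0 \<le> step_height t" "step_height t \<le> 1" "t \<le> 1/4 \<Longrightarrow> step_height t = 0" "3/4 \<le> t \<Longrightarrow> step_height t = 1"
  by (auto simp: step_height_def)

lemma bcoord_verts:
  assumes "v \<in> verts m n"
  shows "1 \<le> \<bar>bcoord v\<bar>" "\<bar>bcoord v\<bar> \<le> real (max m n)" "position v = boundary_point (bcoord v)"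
proof -
  show "1 \<le> \<bar>bcoord v\<bar>" using assms by (rule verts_cases) auto
  show "\<bar>bcoord v\<bar> \<le> real (max m n)" using assms by (rule verts_cases) auto
  show "position v = boundary_point (bcoord v)"
    using assms by (rule verts_cases) (auto simp: boundary_point_def)
qed

lemma bcoord_inj: "u \<in> verts m n \<Longrightarrow> v \<in> verts m n \<Longrightarrow> bcoord u = bcoord v \<Longrightarrow> u = v"
  using bcoord_verts(3)[of u m n] bcoord_verts(3)[of v m n] position_inj[of u m n v] by simp

lemma continuous_on_curve: "continuous_on S (curve N a b)"
proof -
  consider "0 < a" | "\<not> 0 < a" "b < 0" | "\<not> 0 < a" "\<not> b < 0" by blast
  then show ?thesis
  proof cases
    case 1
    then have "curve N a b = (\<lambda>t. vector [a + t * (b - a), (a + t * (b - a) - a) * (b - (a + t * (b - a))) * inverse (N\<^sup>2)])"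
      by (simp add: fun_eq_iff curve_def Let_def divide_inverse)
    then show ?thesis by (auto intro!: continuous_on_vector_2 continuous_intros)
  next
    case 2
    then have "curve N a b = (\<lambda>t. vector [- (a + t * (b - a)), 1 - (a + t * (b - a) - a) * (b - (a + t * (b - a))) * inverse (N\<^sup>2)])"
      by (simp add: fun_eq_iff curve_def Let_def divide_inverse)
    then show ?thesis by (auto intro!: continuous_on_vector_2 continuous_intros)
  next
    case 3
    then have "curve N a b = (\<lambda>t. vector [b + (- a - b) * max 0 (min 1 (3 * t - 1)), t])"
      by (simp add: fun_eq_iff curve_def Let_def step_height_def)
    then show ?thesis by (auto intro!: continuous_on_vector_2 continuous_intros)
  qed
qed

lemma arc_curve:
  assumes "a < b" "a \<noteq> 0" "b \<noteq> 0"
  shows "arc (curve N a b)"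
proof -
  have "t = t'" if "curve N a b t = curve N a b t'" for t t'
    using that assms by (simp add: curve_def Let_def vec2_eq_iff split: if_splits)
  then show ?thesis
    unfolding arc_def path_def using continuous_on_curve by (auto intro: inj_onI)
qed

lemma curve_ends:
  assumes "a < b" "a \<noteq> 0" "b \<noteq> 0"
  shows "{pathstart (curve N a b), pathfinish (curve N a b)} = {boundary_point a, boundary_point b}"
  using assms step_height_simps(3)[of 0] step_height_simps(4)[of 1]
  by (auto simp: pathstart_def pathfinish_def curve_def Let_def boundary_point_def)

lemma arch_height:
  fixes s :: real
  assumes "a \<le> s" "s \<le> b" "b - a \<le> N" "1 \<le> N"
  shows "0 \<le> (s - a) * (b - s) / N\<^sup>2" "(s - a) * (b - s) / N\<^sup>2 \<le> 1/4"
proof -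
  show "0 \<le> (s - a) * (b - s) / N\<^sup>2" using assms by simp
  have "(s - a) * (b - s) = (b - a)\<^sup>2 / 4 - (s - (a + b) / 2)\<^sup>2"
    by (simp add: power2_eq_square field_simps)
  also have "\<dots> \<le> (b - a)\<^sup>2 / 4" by simp
  also have "\<dots> \<le> N\<^sup>2 / 4" using assms by (intro divide_right_mono power_mono) auto
  finally show "(s - a) * (b - s) / N\<^sup>2 \<le> 1/4" using assms by (simp add: divide_simps)
qed

lemma curve_image_cases:
  assumes z: "z \<in> path_image (curve N a b)" and ab: "a < b" "1 \<le> \<bar>a\<bar>" "\<bar>a\<bar> \<le> N" "1 \<le> \<bar>b\<bar>" "\<bar>b\<bar> \<le> N"
  obtains (lower) s h where "z $ 1 = s" "z $ 2 = h" "0 < a" "a \<le> s" "s \<le> b" 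
      "h = (s - a) * (b - s) / N\<^sup>2" "0 \<le> h" "h \<le> 1/4"
  | (upper) s h where "z $ 1 = - s" "z $ 2 = 1 - h" "b < 0" "a \<le> s" "s \<le> b" 
      "h = (s - a) * (b - s) / N\<^sup>2" "0 \<le> h" "h \<le> 1/4"
  | (across) "a < 0" "0 < b" "0 \<le> z $ 2" "z $ 2 \<le> 1" "z $ 1 = b + (- a - b) * step_height (z $ 2)"
proof -
  from z obtain t where t: "0 \<le> t" "t \<le> 1" "z = curve N a b t" by (auto simp: path_image_def)
  define s where "s = a + t * (b - a)"
  define h where "h = (s - a) * (b - s) / N\<^sup>2"
  have s: "a \<le> s" "s \<le> b"
  proof -
    show "a \<le> s" using t ab by (simp add: s_def)
    have "t * (b - a) \<le> 1 * (b - a)" using t ab by (intro mult_right_mono) auto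
    then show "s \<le> b" by (simp add: s_def)
  qed
  have N: "1 \<le> N" using ab by linarith
  consider "0 < a" | "b < 0" | "a < 0" "0 < b" using ab by linarith
  then show ?thesis
  proof cases
    case 1
    then have "0 \<le> h" "h \<le> 1/4" using arch_height[OF s _ N] ab unfolding h_def by linarith+
    with 1 s t(3) show ?thesis
      by (intro lower[of s h]) (simp_all add: curve_def Let_def h_def s_def)
  next
    case 2
    then have "0 \<le> h" "h \<le> 1/4" using arch_height[OF s _ N] ab unfolding h_def by linarith+
    with 2 ab s t(3) show ?thesis
      by (intro upper[of s h]) (simp_all add: curve_def Let_def h_def s_def)
  next
    case 3
    with t show ?thesis by (intro across) (simp_all add: curve_def Let_def)
  qed
qed

lemma across_bounds:
  fixes a b w :: real
  assumes "a < 0" "0 < b" "0 \<le> w" "w \<le> 1" "1 \<le> \<bar>a\<bar>" "\<bar>a\<bar> \<le> N" "1 \<le> \<bar>b\<bar>" "\<bar>b\<bar> \<le> N"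
  shows "1 \<le> b + (- a - b) * w" "b + (- a - b) * w \<le> N"
proof -
  have eq: "b + (- a - b) * w = (1 - w) * b + w * (- a)" by (simp add: algebra_simps)
  have "(1 - w) * 1 + w * 1 \<le> (1 - w) * b + w * (- a)" "(1 - w) * b + w * (- a) \<le> (1 - w) * N + w * N"
    using assms by (intro add_mono mult_left_mono; simp)+
  then show "1 \<le> b + (- a - b) * w" "b + (- a - b) * w \<le> N"
    unfolding eq by (simp_all add: algebra_simps)
qed

lemma curve_image_box:
  assumes z: "z \<in> path_image (curve N a b)" and ab: "a < b" "1 \<le> \<bar>a\<bar>" "\<bar>a\<bar> \<le> N" "1 \<le> \<bar>b\<bar>" "\<bar>b\<bar> \<le> N"
  shows "1 \<le> z $ 1 \<and> z $ 1 \<le> N \<and> 0 \<le> z $ 2 \<and> z $ 2 \<le> 1"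
  using z ab
proof (cases rule: curve_image_cases)
  case across
  then show ?thesis
    using across_bounds[of a b "step_height (z $ 2)" N] step_height_simps(1,2)[of "z $ 2"] ab by simp
qed (use ab in linarith)+

lemma curve_image_boundary:
  assumes z: "boundary_point c \<in> path_image (curve N a b)" and c: "c \<noteq> 0"
    and ab: "a < b" "1 \<le> \<bar>a\<bar>" "\<bar>a\<bar> \<le> N" "1 \<le> \<bar>b\<bar>" "\<bar>b\<bar> \<le> N"
  shows "c = a \<or> c = b"
  using z ab
proof (cases rule: curve_image_cases)
  case (lower s h)
  then have "c = s" "h = 0" by (auto simp: boundary_point_def split: if_splits)
  with lower ab show ?thesis by auto
next
  case (upper s h)
  then have "c = s" "h = 0" by (auto simp: boundary_point_def split: if_splits)
  with upper ab show ?thesis by auto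
next
  case across
  then show ?thesis
    using step_height_simps(3)[of 0] step_height_simps(4)[of 1] c
    by (auto simp: boundary_point_def split: if_splits)
qed

text \<open>The intervals \<open>[a, b]\<close> and \<open>[a', b']\<close> have no common inner point, or one is contained in the interior
  of the other.\<close>
definition separated :: "real \<Rightarrow> real \<Rightarrow> real \<Rightarrow> real \<Rightarrow> bool" where
  "separated a b a' b' \<longleftrightarrow> b \<le> a' \<or> b' \<le> a \<or> a < a' \<and> b' < b \<or> a' < a \<and> b < b'"

lemma separated_commute: "separated a b a' b' \<longleftrightarrow> separated a' b' a b"
  by (auto simp: separated_def)

lemma nested_arches_disjoint:
  fixes s :: real
  assumes "a < a'" "b' < b" "a' \<le> s" "s \<le> b'" "1 \<le> N"
  shows "(s - a') * (b' - s) / N\<^sup>2 < (s - a) * (b - s) / N\<^sup>2"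
proof -
  have "(s - a') * (b' - s) < (s - a) * (b - s)"
    using assms by (intro mult_strict_mono') auto
  then show ?thesis using assms by (intro divide_strict_right_mono) auto
qed

lemma arches_meet:
  fixes s :: real
  assumes "separated a b a' b'" "a < b" "a' < b'" "a \<le> s" "s \<le> b" "a' \<le> s" "s \<le> b'" "1 \<le> N"
    and h: "(s - a) * (b - s) / N\<^sup>2 = (s - a') * (b' - s) / N\<^sup>2"
  shows "(s = a \<or> s = b) \<and> (s = a' \<or> s = b')"
  using assms(1) unfolding separated_def
proof (elim disjE conjE)
  assume "a < a'" "b' < b"
  with nested_arches_disjoint[of a a' b' b s N] assms show ?thesis by simp
next
  assume "a' < a" "b < b'"
  with nested_arches_disjoint[of a' a b b' s N] assms show ?thesis by simp
qed (use assms in linarith)+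

text \<open>Curves for separated intervals meet only in common end points: arches over nested intervals have
  different heights above each point of the smaller interval, the zone of the arches contains only vertical parts of the curves
  from bottom to top, and two curves of the latter kind stay on different sides of each other since both
  interpolate between their ends with the same weights.\<close>
lemma curves_meet:
  assumes z: "z \<in> path_image (curve N a b)" and z': "z \<in> path_image (curve N a' b')"
    and ab: "a < b" "1 \<le> \<bar>a\<bar>" "\<bar>a\<bar> \<le> N" "1 \<le> \<bar>b\<bar>" "\<bar>b\<bar> \<le> N"
    and ab': "a' < b'" "1 \<le> \<bar>a'\<bar>" "\<bar>a'\<bar> \<le> N" "1 \<le> \<bar>b'\<bar>" "\<bar>b'\<bar> \<le> N"
    and sep: "separated a b a' b'"
  shows "\<exists>c. z = boundary_point c \<and> (c = a \<or> c = b) \<and> (c = a' \<or> c = b')"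
proof -
  have N: "1 \<le> N" using ab by linarith
  \<comment> \<open>An arch, for \<open>a\<close> and \<open>b\<close>, and a curve from bottom to top, for \<open>b'\<close> and \<open>a'\<close>.\<close>
  have mixed: "\<exists>c. z = boundary_point c \<and> (c = a \<or> c = b) \<and> (c = a' \<or> c = b')"
    if z: "z \<in> path_image (curve N a b)" and ab: "a < b" "1 \<le> \<bar>a\<bar>" "\<bar>a\<bar> \<le> N" "1 \<le> \<bar>b\<bar>" "\<bar>b\<bar> \<le> N"
      and sep: "separated a b a' b'" and ne: "0 < a \<or> b < 0"
      and z': "a' < 0" "0 < b'" "z $ 1 = b' + (- a' - b') * step_height (z $ 2)"
    for a b a' b'
    using z ab
  proof (cases rule: curve_image_cases)
    case (lower s h)
    then have "s = b'" using z' step_height_simps(3)[of h] by simp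
    with lower z' sep have "s = a" unfolding separated_def by linarith
    with lower \<open>s = b'\<close> show ?thesis
      by (intro exI[of _ s]) (auto simp: boundary_point_def vec2_eq_iff)
  next
    case (upper s h)
    then have "s = a'" using z' step_height_simps(4)[of "1 - h"] by simp
    with upper z' sep have "s = b" unfolding separated_def by linarith
    with upper \<open>s = a'\<close> show ?thesis
      by (intro exI[of _ s]) (auto simp: boundary_point_def vec2_eq_iff)
  qed (use ne in simp)
  from z ab show ?thesis
  proof (cases rule: curve_image_cases)
    case L: (lower s h)
    from z' ab' show ?thesis
    proof (cases rule: curve_image_cases)
      case (lower s' h')
      with L have "(s = a \<or> s = b) \<and> (s = a' \<or> s = b')"
        by (intro arches_meet[OF sep _ _ _ _ _ _ N]) (use ab ab' in auto)
      moreover from this L have "h = 0" by auto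
      ultimately show ?thesis using L by (intro exI[of _ s]) (auto simp: boundary_point_def vec2_eq_iff)
    next
      case upper
      with L show ?thesis by linarith
    next
      case across
      with mixed[OF z ab sep _ across(1,2,5)] L show ?thesis by blast
    qed
  next
    case U: (upper s h)
    from z' ab' show ?thesis
    proof (cases rule: curve_image_cases)
      case lower
      with U show ?thesis by linarith
    next
      case (upper s' h')
      with U have "(s = a \<or> s = b) \<and> (s = a' \<or> s = b')"
        by (intro arches_meet[OF sep _ _ _ _ _ _ N]) (use ab ab' in auto)
      moreover from this U have "h = 0" by auto
      ultimately show ?thesis using U by (intro exI[of _ s]) (auto simp: boundary_point_def vec2_eq_iff)
    next
      case across
      with mixed[OF z ab sep _ across(1,2,5)] U show ?thesis by blast
    qed
  next
    case A: across
    show ?thesis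
    proof (cases "0 < a' \<or> b' < 0")
      case True
      with mixed[OF z' ab' _ _ A(1,2,5)] sep show ?thesis by (auto simp: separated_commute)
    next
      case False
      define w where "w = step_height (z $ 2)"
      have w: "0 \<le> w" "w \<le> 1" using step_height_simps by (auto simp: w_def)
      have sgn: "a' < 0" "0 < b'" using False ab' by linarith+
      from z' ab' have "z $ 1 = b' + (- a' - b') * w"
        by (cases rule: curve_image_cases) (use sgn in \<open>auto simp: w_def\<close>)
      with A have "b + (- a - b) * w = b' + (- a' - b') * w" by (simp add: w_def)
      then have eq: "(1 - w) * b + w * (- a) = (1 - w) * b' + w * (- a')" by (simp add: algebra_simps)
      \<comment> \<open>Convex combinations with the same weights preserve strict order.\<close>
      have less: "(1 - w) * x + w * y < (1 - w) * x' + w * y'" if "x < x'" "y < y'" for x y x' y'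
      proof (cases "w = 0")
        case False
        then have "w * y < w * y'" "(1 - w) * x \<le> (1 - w) * x'" using w that by (auto intro: mult_left_mono)
        then show ?thesis by linarith
      qed (use that in simp)
      show ?thesis
        using sep A sgn less[of b b' "- a" "- a'"] less[of b' b "- a'" "- a"] eq
        unfolding separated_def by auto
    qed
  qed
qed

text \<open>\<open>v\<close> follows \<open>u\<close> in the boundary order of their common block.\<close>
definition consecutive :: "vertex set set \<Rightarrow> vertex \<Rightarrow> vertex \<Rightarrow> bool" where
  "consecutive \<alpha> u v \<longleftrightarrow> (u, v) \<in> same \<alpha> \<and> bcoord u < bcoord v \<and>
     (\<forall>w. (u, w) \<in> same \<alpha> \<longrightarrow> \<not> (bcoord u < bcoord w \<and> bcoord w < bcoord v))"

text \<open>The graph that joins consecutive elements of each block represents the partition.  That two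
  elements \<open>u\<close> and \<open>v\<close> of a block are joined is shown by induction on the number of elements of the block between them.\<close>
lemma consecutive_represents:
  assumes \<alpha>: "\<alpha> \<in> Part m n"
  shows "represents m n {{u, v} |u v. consecutive \<alpha> u v} \<alpha>"
proof -
  let ?E = "{{u, v} |u v. consecutive \<alpha> u v}"
  have "e \<subseteq> verts m n \<and> card e = 2" if "e \<in> ?E" for e
  proof -
    from that obtain u v where e: "e = {u, v}" "consecutive \<alpha> u v" by blast
    then have "u \<noteq> v" "u \<in> verts m n" "v \<in> verts m n"
      using same_verts[OF \<alpha>, of u v] by (auto simp: consecutive_def)
    with e show ?thesis by simp
  qed
  moreover have "joined ?E \<inter> verts m n \<times> verts m n = same \<alpha>"
  proof (intro equalityI subrelI)
    fix u v assume uv: "(u, v) \<in> joined ?E \<inter> verts m n \<times> verts m n"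
    then have "(u, v) \<in> joined ?E" "u \<in> verts m n" by auto
    from this(1) show "(u, v) \<in> same \<alpha>"
      unfolding joined_def
    proof induction
      case base
      show ?case by (rule same_refl[OF \<alpha> \<open>u \<in> verts m n\<close>])
    next
      case (step y z)
      then have "(y, z) \<in> same \<alpha>"
        using same_sym by (auto simp: consecutive_def doubleton_eq_iff)
      with step.IH show ?case by (rule same_trans[OF \<alpha>])
    qed
  next
    have le: "(u, v) \<in> joined ?E" if "(u, v) \<in> same \<alpha>" "bcoord u \<le> bcoord v" for u v
      using that
    proof (induction "card {w. (u, w) \<in> same \<alpha> \<and> bcoord u < bcoord w \<and> bcoord w < bcoord v}"
        arbitrary: u v rule: less_induct)
      case less
      let ?between = "\<lambda>u v. {w. (u, w) \<in> same \<alpha> \<and> bcoord u < bcoord w \<and> bcoord w < bcoord v}"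
      have fin: "finite (?between u v)" for u v
        by (rule finite_subset[of _ "verts m n"]) (use same_verts[OF \<alpha>] in auto)
      show ?case
      proof (cases "?between u v = {}")
        case True
        show ?thesis
        proof (cases "u = v")
          case False
          then have "bcoord u \<noteq> bcoord v" using bcoord_inj same_verts[OF \<alpha> less.prems(1)] by blast
          with True less.prems have "consecutive \<alpha> u v" by (auto simp: consecutive_def)
          then have "{u, v} \<in> ?E" by blast
          then show ?thesis by (auto simp: joined_def)
        qed (simp add: joined_def)
      next
        case False
        then obtain w where w: "(u, w) \<in> same \<alpha>" "bcoord u < bcoord w" "bcoord w < bcoord v" by blast
        have wv: "(w, v) \<in> same \<alpha>" using same_trans[OF \<alpha> same_sym[OF w(1)] less.prems(1)] .
        have "?between u w \<subseteq> ?between u v - {w}" using w by auto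
        moreover have "?between w v \<subseteq> ?between u v - {w}" using w same_trans[OF \<alpha> w(1)] by auto
        moreover have "card (?between u v - {w}) < card (?between u v)"
          using w less.prems by (intro psubset_card_mono[OF fin]) auto
        ultimately have "card (?between u w) < card (?between u v)" "card (?between w v) < card (?between u v)"
          using fin by (meson card_mono finite_Diff le_less_trans)+
        then have "(u, w) \<in> joined ?E" "(w, v) \<in> joined ?E"
          using less.hyps[of u w] less.hyps[of w v] w wv by auto
        then show ?thesis unfolding joined_def by (rule rtrancl_trans)
      qed
    qed
    fix u v assume uv: "(u, v) \<in> same \<alpha>"
    then have "(u, v) \<in> joined ?E"
      using le[of u v] le[of v u] same_sym[OF uv] sym_joined[of ?E] by (meson linear symD)
    with same_verts[OF \<alpha> uv] show "(u, v) \<in> joined ?E \<inter> verts m n \<times> verts m n" by blast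
  qed
  ultimately show ?thesis
    unfolding represents_def classes_on_def by (simp add: same_quotient[OF \<alpha>])
qed

text \<open>Edges within one block are separated since their ends are consecutive in the block, edges in
  different blocks since these do not interlace.\<close>
lemma consecutive_separated:
  assumes \<alpha>: "\<alpha> \<in> Part m n" and nc: "noncrossing \<alpha>"
    and uv: "consecutive \<alpha> u v" "consecutive \<alpha> u' v'" and ne: "{u, v} \<noteq> {u', v'}"
  shows "separated (bcoord u) (bcoord v) (bcoord u') (bcoord v')"
proof -
  have s: "(u, v) \<in> same \<alpha>" "(u', v') \<in> same \<alpha>" "bcoord u < bcoord v" "bcoord u' < bcoord v'"
    using uv by (auto simp: consecutive_def)
  note V = same_verts[OF \<alpha> s(1)] same_verts[OF \<alpha> s(2)]
  show ?thesis
  proof (cases "(u, u') \<in> same \<alpha>")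
    case True
    then have "(u, v') \<in> same \<alpha>" "(u', u) \<in> same \<alpha>" "(u', v) \<in> same \<alpha>"
      using s same_sym same_trans[OF \<alpha>] by blast+
    then have "\<not> (bcoord u < bcoord u' \<and> bcoord u' < bcoord v)" "\<not> (bcoord u < bcoord v' \<and> bcoord v' < bcoord v)"
      "\<not> (bcoord u' < bcoord u \<and> bcoord u < bcoord v')" "\<not> (bcoord u' < bcoord v \<and> bcoord v < bcoord v')"
      using True uv unfolding consecutive_def by blast+
    moreover have "\<not> (bcoord u = bcoord u' \<and> bcoord v = bcoord v')"
      using ne V bcoord_inj by blast
    ultimately show ?thesis using s unfolding separated_def by linarith
  next
    case False
    obtain A where A: "A \<in> \<alpha>" "u \<in> A" "v \<in> A" using s(1) by (auto simp: same_def)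
    obtain B where B: "B \<in> \<alpha>" "u' \<in> B" "v' \<in> B" using s(2) by (auto simp: same_def)
    have AB: "A \<noteq> B" using False A B by (auto simp: same_def)
    have dist: "x \<noteq> y" if "x \<in> A" "y \<in> B" for x y
      using that AB A B block_same[OF \<alpha>] by metis
    have "bcoord u \<noteq> bcoord u'" "bcoord u \<noteq> bcoord v'" "bcoord v \<noteq> bcoord u'" "bcoord v \<noteq> bcoord v'"
      using bcoord_inj V dist A B by metis+
    moreover have "\<not> (bcoord u < bcoord u' \<and> bcoord u' < bcoord v \<and> bcoord v < bcoord v')"
      "\<not> (bcoord u' < bcoord u \<and> bcoord u < bcoord v' \<and> bcoord v' < bcoord v)"
      using nc A B AB unfolding noncrossing_def by metis+
    ultimately show ?thesis unfolding separated_def by linarith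
  qed
qed

lemma noncrossing_imp_planar:
  assumes \<alpha>: "\<alpha> \<in> Part m n" and nc: "noncrossing \<alpha>"
  shows "planar m n \<alpha>"
proof -
  let ?E = "{{u, v} |u v. consecutive \<alpha> u v}"
  define N where "N = real (max m n)"
  have "\<forall>e\<in>?E. \<exists>p. \<exists>u v. e = {u, v} \<and> consecutive \<alpha> u v \<and> p = curve N (bcoord u) (bcoord v)"
    by blast
  from bchoice[OF this] obtain g where
    g: "\<forall>e\<in>?E. \<exists>u v. e = {u, v} \<and> consecutive \<alpha> u v \<and> g e = curve N (bcoord u) (bcoord v)" by blast
  have V: "u \<in> verts m n" "v \<in> verts m n" if "consecutive \<alpha> u v" for u v
    using that same_verts[OF \<alpha>, of u v] by (auto simp: consecutive_def)
  have bounds: "bcoord u < bcoord v" "1 \<le> \<bar>bcoord u\<bar>" "\<bar>bcoord u\<bar> \<le> N" "1 \<le> \<bar>bcoord v\<bar>" "\<bar>bcoord v\<bar> \<le> N"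
    if "consecutive \<alpha> u v" for u v
    using that bcoord_verts(1,2)[OF V(1)[OF that]] bcoord_verts(1,2)[OF V(2)[OF that]]
    by (simp_all add: consecutive_def N_def)
  have single: "arc (g e) \<and> {pathstart (g e), pathfinish (g e)} = position ` e \<and>
      path_image (g e) \<subseteq> rectangle m n \<and> path_image (g e) \<inter> position ` verts m n = position ` e"
    if "e \<in> ?E" for e
  proof -
    from bspec[OF g that] obtain u v where e: "e = {u, v}" and c: "consecutive \<alpha> u v"
      and ge: "g e = curve N (bcoord u) (bcoord v)" by blast
    note b = bounds[OF c]
    have nz: "bcoord u \<noteq> 0" "bcoord v \<noteq> 0" using b by linarith+
    have pe: "position ` e = {boundary_point (bcoord u), boundary_point (bcoord v)}"
      using bcoord_verts(3) V[OF c] by (auto simp: e)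
    have ends: "{pathstart (g e), pathfinish (g e)} = position ` e"
      unfolding pe ge by (rule curve_ends[OF b(1) nz])
    have "position ` e \<subseteq> path_image (g e)"
      unfolding ends[symmetric] by auto
    moreover have "position ` e \<subseteq> position ` verts m n" using V[OF c] by (auto simp: e)
    moreover have "position x \<in> position ` e" if "x \<in> verts m n" "position x \<in> path_image (g e)" for x
    proof -
      have "bcoord x \<noteq> 0" using bcoord_verts(1)[OF that(1)] by linarith
      with that(2) have "bcoord x = bcoord u \<or> bcoord x = bcoord v"
        unfolding ge bcoord_verts(3)[OF that(1)] by (rule curve_image_boundary) (fact b)+
      then show ?thesis unfolding pe bcoord_verts(3)[OF that(1)] by auto
    qed
    ultimately have "path_image (g e) \<inter> position ` verts m n = position ` e" by blast
    moreover have "path_image (g e) \<subseteq> rectangle m n"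
      using curve_image_box[OF _ b] unfolding ge by (auto simp: mem_rectangle N_def)
    moreover have "arc (g e)" unfolding ge by (rule arc_curve[OF b(1) nz])
    ultimately show ?thesis using ends by blast
  qed
  have double: "path_image (g e) \<inter> path_image (g f) \<subseteq> position ` (e \<inter> f)"
    if "e \<in> ?E" "f \<in> ?E" "e \<noteq> f" for e f
  proof
    fix z assume z: "z \<in> path_image (g e) \<inter> path_image (g f)"
    from bspec[OF g that(1)] obtain u v where e: "e = {u, v}" and c: "consecutive \<alpha> u v"
      and ge: "g e = curve N (bcoord u) (bcoord v)" by blast
    from bspec[OF g that(2)] obtain u' v' where f: "f = {u', v'}" and c': "consecutive \<alpha> u' v'"
      and gf: "g f = curve N (bcoord u') (bcoord v')" by blast
    have sep: "separated (bcoord u) (bcoord v) (bcoord u') (bcoord v')"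
      using consecutive_separated[OF \<alpha> nc c c'] that(3) e f by blast
    obtain d where d: "z = boundary_point d" "d = bcoord u \<or> d = bcoord v" "d = bcoord u' \<or> d = bcoord v'"
      using curves_meet[OF _ _ bounds[OF c] bounds[OF c'] sep] z ge gf by auto
    then obtain x y where x: "x \<in> e" "d = bcoord x" and y: "y \<in> f" "d = bcoord y" using e f by blast
    then have xV: "x \<in> verts m n" "y \<in> verts m n" using V[OF c] V[OF c'] e f by auto
    with x y have "x = y" using bcoord_inj by metis
    moreover have "z = position x" using bcoord_verts(3)[OF xV(1)] d(1) x(2) by simp
    ultimately show "z \<in> position ` (e \<inter> f)" using x y by blast
  qed
  have "planar_drawing m n ?E g"
    unfolding planar_drawing_def by (rule conjI; intro ballI impI; (erule single | erule (2) double))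
  with consecutive_represents[OF \<alpha>] show ?thesis unfolding planar_def by blast
qed

subsection \<open>Reflected drawings\<close>

text \<open>Reflection of the rectangle in its horizontal axis.\<close>
definition reflect :: "real ^ 2 \<Rightarrow> real ^ 2" where
  "reflect p = vector [p $ 1, 1 - p $ 2]"

lemma reflect_reflect [simp]: "reflect (reflect p) = p"
  by (simp add: reflect_def vec2_eq_iff)

lemma reflect_position: "v \<in> verts m n \<Longrightarrow> reflect (position v) = position (flip v)"
  by (elim verts_cases) (auto simp: reflect_def vec2_eq_iff)

lemma continuous_on_reflect: "continuous_on S reflect"
proof -
  have "continuous_on S (\<lambda>p :: real ^ 2. vector [p $ 1, 1 - p $ 2] :: real ^ 2)"
    by (intro continuous_on_vector_2 continuous_intros)
  then show ?thesis by (simp add: reflect_def[abs_def])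
qed

lemma reflect_rectangle: "p \<in> rectangle m n \<Longrightarrow> reflect p \<in> rectangle n m"
  by (simp add: mem_rectangle reflect_def max.commute)

lemma planar_star:
  assumes \<alpha>: "\<alpha> \<in> Part m n" and "planar m n \<alpha>"
  shows "planar n m (star \<alpha>)"
proof -
  obtain E g where E: "represents m n E \<alpha>" and g: "planar_drawing m n E g"
    using assms(2) by (auto simp: planar_def)
  let ?E = "(`) flip ` E" and ?g = "\<lambda>e. reflect \<circ> g (flip ` e)"
  have ff: "flip ` flip ` e = e" for e by (simp add: image_image)
  have inj: "inj reflect" by (metis injI reflect_reflect)
  have E_verts: "e \<subseteq> verts m n" "card e = 2" if "e \<in> E" for e
    using E that by (auto simp: represents_def)
  have pos: "position ` flip ` e = reflect ` position ` e" if "e \<subseteq> verts m n" for e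
    unfolding image_image using that reflect_position by (intro image_cong) auto
  have mem: "{u, v} \<in> ?E \<longleftrightarrow> {flip u, flip v} \<in> E" for u v
  proof
    assume "{u, v} \<in> ?E"
    then obtain e where "e \<in> E" "{u, v} = flip ` e" by blast
    then have "flip ` {u, v} \<in> E" using ff by simp
    then show "{flip u, flip v} \<in> E" by simp
  next
    assume "{flip u, flip v} \<in> E"
    then have "flip ` {flip u, flip v} \<in> ?E" by (rule imageI)
    then show "{u, v} \<in> ?E" by simp
  qed
  have map: "map_prod flip flip ` {(x, y). {x, y} \<in> E} = {(x, y). {x, y} \<in> ?E}"
  proof (intro equalityI subrelI)
    fix u v assume "(u, v) \<in> {(x, y). {x, y} \<in> ?E}"
    then have "(flip u, flip v) \<in> {(x, y). {x, y} \<in> E}" using mem by simp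
    then have "map_prod flip flip (flip u, flip v) \<in> map_prod flip flip ` {(x, y). {x, y} \<in> E}" by (rule imageI)
    then show "(u, v) \<in> map_prod flip flip ` {(x, y). {x, y} \<in> E}" by simp
  qed (use mem in auto)
  have joined: "(u, v) \<in> joined ?E \<longleftrightarrow> (flip u, flip v) \<in> joined E" for u v
    using rtrancl_map_inj[OF inj_flip, of "flip u" "flip v" "{(x, y). {x, y} \<in> E}"]
    unfolding joined_def map by simp
  have "represents n m ?E (star \<alpha>)"
    unfolding represents_def
  proof (intro conjI ballI)
    fix e assume "e \<in> ?E"
    then obtain f where f: "f \<in> E" "e = flip ` f" by blast
    have "e \<subseteq> flip ` verts m n" unfolding f(2) by (rule image_mono[OF E_verts(1)[OF f(1)]])
    then show "e \<subseteq> verts n m" by (simp add: flip_verts)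
    show "card e = 2" using E_verts(2)[OF f(1)] f(2) inj_flip by (simp add: card_image inj_on_subset)
  next
    have "joined ?E \<inter> verts n m \<times> verts n m = same (star \<alpha>)"
      using joined same_star[of _ _ \<alpha>] represents_same[OF E] by auto
    then show "classes_on (verts n m) ?E = star \<alpha>"
      by (simp add: classes_on_def same_quotient[OF star_Part[OF \<alpha>]])
  qed
  moreover have "planar_drawing n m ?E ?g"
  proof -
    have single: "arc (?g e) \<and> {pathstart (?g e), pathfinish (?g e)} = position ` e \<and>
        path_image (?g e) \<subseteq> rectangle n m \<and> path_image (?g e) \<inter> position ` verts n m = position ` e"
      if "e \<in> ?E" for e
    proof -
      from that obtain f where f: "f \<in> E" "e = flip ` f" by blast
      have gf: "arc (g f)" "{pathstart (g f), pathfinish (g f)} = position ` f"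
        "path_image (g f) \<subseteq> rectangle m n" "path_image (g f) \<inter> position ` verts m n = position ` f"
        using bspec[OF conjunct1[OF g[unfolded planar_drawing_def]] f(1)] by simp_all
      have ge: "?g e = reflect \<circ> g f" using f(2) ff by simp
      have pe: "position ` e = reflect ` position ` f" using pos[OF E_verts(1)[OF f(1)]] f(2) by simp
      have pv: "position ` verts n m = reflect ` position ` verts m n"
        using pos[of "verts m n"] flip_verts[of m n] by simp
      have "arc (reflect \<circ> g f)"
        using gf(1) path_continuous_image[OF _ continuous_on_reflect, of "g f"] comp_inj_on[of "g f" "{0..1}" reflect]
          inj_on_subset[OF inj subset_UNIV]
        unfolding arc_def by blast
      moreover have "{pathstart (reflect \<circ> g f), pathfinish (reflect \<circ> g f)} = reflect ` position ` f"
        unfolding gf(2)[symmetric] pathstart_compose pathfinish_compose by simp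
      moreover have "path_image (reflect \<circ> g f) \<subseteq> rectangle n m"
        unfolding path_image_compose using gf(3) reflect_rectangle by blast
      moreover have "path_image (reflect \<circ> g f) \<inter> reflect ` position ` verts m n = reflect ` position ` f"
        unfolding path_image_compose gf(4)[symmetric] by (rule image_Int[OF inj, symmetric])
      ultimately show ?thesis unfolding ge pe pv by blast
    qed
    have double: "path_image (?g e) \<inter> path_image (?g e') \<subseteq> position ` (e \<inter> e')"
      if "e \<in> ?E" "e' \<in> ?E" "e \<noteq> e'" for e e'
    proof -
      from that(1) obtain f where f1: "f \<in> E" "e = flip ` f" by blast
      from that(2) obtain f' where f2: "f' \<in> E" "e' = flip ` f'" by blast
      from that(3) f1 f2 have "f \<noteq> f'" by blast
      note f = f1 f2 this
      then have "path_image (g f) \<inter> path_image (g f') \<subseteq> position ` (f \<inter> f')"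
        using g unfolding planar_drawing_def by blast
      then have "reflect ` (path_image (g f) \<inter> path_image (g f')) \<subseteq> reflect ` position ` (f \<inter> f')"
        by (rule image_mono)
      moreover have "reflect ` position ` (f \<inter> f') = position ` flip ` (f \<inter> f')"
        using pos[of "f \<inter> f'"] E_verts(1)[OF f(1)] by blast
      moreover have "flip ` (f \<inter> f') = e \<inter> e'" unfolding f(2,4) by (rule image_Int[OF inj_flip])
      ultimately show ?thesis
        unfolding path_image_compose f(2,4) ff by (simp add: image_Int[OF inj])
    qed
    show ?thesis
      unfolding planar_drawing_def
      by (rule conjI; intro ballI impI; (erule single | erule (2) double))
  qed
  ultimately show ?thesis unfolding planar_def by blast
qed

section \<open>The six categories\<close>

text \<open>A class of partitions closed under composable products and under the involution.\<close>
definition star_subcategory :: "vertex set set set \<Rightarrow> bool" where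
  "star_subcategory K \<longleftrightarrow> K \<subseteq> P_cat \<and>
     (\<forall>m n k. \<forall>\<alpha>\<in>hom_set K m n. \<forall>\<beta>\<in>hom_set K n k. \<alpha> \<odot> \<beta> \<in> K) \<and> (\<forall>\<alpha>\<in>K. star \<alpha> \<in> K)"

lemma P_catE:
  assumes "\<alpha> \<in> P_cat"
  obtains m n where "\<alpha> \<in> Part m n"
  using assms by (auto simp: P_cat_def)

lemma P_catI: "\<alpha> \<in> Part m n \<Longrightarrow> \<alpha> \<in> P_cat"
  by (auto simp: P_cat_def)

lemma star_P_cat: "\<alpha> \<in> P_cat \<Longrightarrow> star \<alpha> \<in> P_cat"
  by (meson P_catE P_catI star_Part)

lemma card_star: "(\<forall>B\<in>star \<alpha>. Q (card B)) \<longleftrightarrow> (\<forall>B\<in>\<alpha>. Q (card B))"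
  using inj_flip by (simp add: star_def card_image inj_on_subset)

lemma star_subcategory_P: "star_subcategory P_cat"
  unfolding star_subcategory_def hom_set_def using part_prod_Part P_catI star_P_cat by blast

lemma PB_cat_iff: "\<alpha> \<in> PB_cat \<longleftrightarrow> \<alpha> \<in> P_cat \<and> (\<forall>B\<in>\<alpha>. card B \<le> 2)"
proof -
  have "card B \<noteq> 0" if "\<alpha> \<in> P_cat" "B \<in> \<alpha>" for B
  proof -
    obtain m n where "\<alpha> \<in> Part m n" using \<open>\<alpha> \<in> P_cat\<close> by (rule P_catE)
    then show ?thesis using that(2) finite_block by (auto simp: Part_def partition_on_def)
  qed
  moreover have "k = 1 \<or> k = 2 \<longleftrightarrow> k \<noteq> 0 \<and> k \<le> 2" for k :: nat by auto
  ultimately show ?thesis unfolding PB_cat_def by auto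
qed

lemma star_subcategory_PB: "star_subcategory PB_cat"
  unfolding star_subcategory_def
proof (intro conjI allI ballI)
  show "PB_cat \<subseteq> P_cat" by (auto simp: PB_cat_def)
next
  fix m n k \<alpha> \<beta> assume ab: "\<alpha> \<in> hom_set PB_cat m n" "\<beta> \<in> hom_set PB_cat n k"
  then have "\<alpha> \<odot> \<beta> \<in> P_cat" using part_prod_Part P_catI unfolding hom_set_def by blast
  moreover have "\<forall>B\<in>\<alpha> \<odot> \<beta>. card B \<le> 2"
    by (rule prod_blocks_small) (use ab in \<open>auto simp: hom_set_def PB_cat_iff\<close>)
  ultimately show "\<alpha> \<odot> \<beta> \<in> PB_cat" by (simp add: PB_cat_iff)
next
  fix \<alpha> assume "\<alpha> \<in> PB_cat"
  then show "star \<alpha> \<in> PB_cat" by (simp add: PB_cat_iff star_P_cat card_star[of _ "\<lambda>k. k \<le> 2"])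
qed

lemma star_subcategory_B: "star_subcategory B_cat"
  unfolding star_subcategory_def
proof (intro conjI allI ballI)
  show "B_cat \<subseteq> P_cat" by (auto simp: B_cat_def)
next
  fix m n k \<alpha> \<beta> assume ab: "\<alpha> \<in> hom_set B_cat m n" "\<beta> \<in> hom_set B_cat n k"
  then have "\<alpha> \<odot> \<beta> \<in> P_cat" using part_prod_Part P_catI unfolding hom_set_def by blast
  moreover have "\<forall>B\<in>\<alpha> \<odot> \<beta>. card B = 2"
    by (rule prod_blocks_two) (use ab in \<open>auto simp: hom_set_def B_cat_def\<close>)
  ultimately show "\<alpha> \<odot> \<beta> \<in> B_cat" by (simp add: B_cat_def)
next
  fix \<alpha> assume "\<alpha> \<in> B_cat"
  then show "star \<alpha> \<in> B_cat" by (simp add: B_cat_def star_P_cat card_star[of _ "\<lambda>k. k = 2"])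
qed

lemma PP_cat_planar: "\<alpha> \<in> PP_cat \<Longrightarrow> \<alpha> \<in> Part m n \<Longrightarrow> planar m n \<alpha>"
  unfolding PP_cat_def using Part_unique by blast

lemma PP_catI: "\<alpha> \<in> Part m n \<Longrightarrow> planar m n \<alpha> \<Longrightarrow> \<alpha> \<in> PP_cat"
  unfolding PP_cat_def by blast

lemma star_subcategory_PP: "star_subcategory PP_cat"
  unfolding star_subcategory_def
proof (intro conjI allI ballI)
  show "PP_cat \<subseteq> P_cat" by (auto simp: PP_cat_def P_cat_def)
next
  fix m n k \<alpha> \<beta> assume "\<alpha> \<in> hom_set PP_cat m n" "\<beta> \<in> hom_set PP_cat n k"
  then have ab: "\<alpha> \<in> Part m n" "\<beta> \<in> Part n k" and "planar m n \<alpha>" "planar n k \<beta>"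
    using PP_cat_planar by (auto simp: hom_set_def)
  then have "noncrossing (\<alpha> \<odot> \<beta>)" unfolding planar_def using prod_noncrossing[OF ab] by blast
  with part_prod_Part[OF ab] show "\<alpha> \<odot> \<beta> \<in> PP_cat"
    by (blast intro: PP_catI noncrossing_imp_planar)
next
  fix \<alpha> assume "\<alpha> \<in> PP_cat"
  then obtain m n where "\<alpha> \<in> Part m n" "planar m n \<alpha>" by (auto simp: PP_cat_def)
  then show "star \<alpha> \<in> PP_cat" by (blast intro: PP_catI planar_star star_Part)
qed

lemma star_subcategory_Int:
  "star_subcategory K \<Longrightarrow> star_subcategory K' \<Longrightarrow> star_subcategory (K \<inter> K')"
  unfolding star_subcategory_def hom_set_def by blast

lemma star_subcategory_cases:
  assumes "K \<in> {P_cat, PB_cat, B_cat, PP_cat, M_cat, TL_cat}"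
  shows "star_subcategory K"
  using assms star_subcategory_P star_subcategory_PB star_subcategory_B star_subcategory_PP
    star_subcategory_Int unfolding M_cat_def TL_cat_def by blast

section \<open>Green's relations and rank\<close>

lemma hom_set_prod:
  "star_subcategory K \<Longrightarrow> \<alpha> \<in> hom_set K m n \<Longrightarrow> \<beta> \<in> hom_set K n k \<Longrightarrow> \<alpha> \<odot> \<beta> \<in> hom_set K m k"
  unfolding star_subcategory_def using part_prod_Part[of \<alpha> m n \<beta> k] by (simp add: hom_set_def) blast

lemma hom_set_star: "star_subcategory K \<Longrightarrow> \<alpha> \<in> hom_set K m n \<Longrightarrow> star \<alpha> \<in> hom_set K n m"
  unfolding star_subcategory_def using star_Part[of \<alpha> m n] by (simp add: hom_set_def)

lemma hom_set_Part: "\<alpha> \<in> hom_set K m n \<Longrightarrow> \<alpha> \<in> Part m n"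
  by (simp add: hom_set_def)

lemma hom_set_composable: "\<alpha> \<in> hom_set K m n \<Longrightarrow> \<beta> \<in> hom_set K n k \<Longrightarrow> composable \<alpha> \<beta>"
  unfolding composable_def hom_set_def by blast

lemma part_rank_composable:
  assumes "composable \<alpha> \<beta>"
  shows "part_rank (\<alpha> \<odot> \<beta>) \<le> part_rank \<alpha>" "part_rank (\<alpha> \<odot> \<beta>) \<le> part_rank \<beta>"
  using assms part_rank_prod_left(1) part_rank_prod_right unfolding composable_def by blast+

lemma part_rank_composable_3:
  assumes "composable \<gamma> \<alpha>" "composable \<alpha> \<delta>"
  shows "part_rank (\<gamma> \<odot> \<alpha> \<odot> \<delta>) \<le> part_rank \<alpha>"
proof -
  obtain i m n where gm: "\<gamma> \<in> Part i m" "\<alpha> \<in> Part m n" using assms(1) by (auto simp: composable_def)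
  obtain m' n' j where dl: "\<alpha> \<in> Part m' n'" "\<delta> \<in> Part n' j" using assms(2) by (auto simp: composable_def)
  have "\<delta> \<in> Part n j" using Part_unique[OF gm(2) dl(1)] dl(2) by simp
  with part_prod_Part[OF gm] have "composable (\<gamma> \<odot> \<alpha>) \<delta>" by (auto simp: composable_def)
  from part_rank_composable(1)[OF this] part_rank_composable(2)[OF assms(1)] show ?thesis by simp
qed

context
  fixes K :: "vertex set set set" and m n :: nat and \<alpha> :: "vertex set set"
  assumes K: "star_subcategory K" and \<alpha>: "\<alpha> \<in> hom_set K m n"
begin

text \<open>The elements that witness Green's relations in \<open>retract_right\<close> and \<open>retract_left\<close> belong to \<open>K\<close>.\<close>
lemma witness_right:
  assumes \<sigma>: "\<sigma> \<in> hom_set K n k"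
  shows "star \<sigma> \<odot> star \<alpha> \<in> hom_set K k m" "star \<sigma> \<odot> star \<alpha> \<odot> \<alpha> \<in> hom_set K k n"
proof -
  show 1: "star \<sigma> \<odot> star \<alpha> \<in> hom_set K k m"
    by (rule hom_set_prod[OF K hom_set_star[OF K \<sigma>] hom_set_star[OF K \<alpha>]])
  show "star \<sigma> \<odot> star \<alpha> \<odot> \<alpha> \<in> hom_set K k n" by (rule hom_set_prod[OF K 1 \<alpha>])
qed

lemma witness_left:
  assumes \<sigma>: "\<sigma> \<in> hom_set K k m"
  shows "\<alpha> \<odot> star \<alpha> \<odot> star \<sigma> \<in> hom_set K m k"
  by (rule hom_set_prod[OF K hom_set_prod[OF K \<alpha> hom_set_star[OF K \<alpha>]] hom_set_star[OF K \<sigma>]])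

lemma green_R_iff:
  assumes \<sigma>: "\<sigma> \<in> hom_set K n k"
  shows "green_R K (\<alpha> \<odot> \<sigma>) \<alpha> \<longleftrightarrow> part_rank (\<alpha> \<odot> \<sigma>) = part_rank \<alpha>"
proof
  note \<alpha>\<sigma> = hom_set_prod[OF K \<alpha> \<sigma>]
  {
    assume "green_R K (\<alpha> \<odot> \<sigma>) \<alpha>"
    then obtain \<delta> where "composable (\<alpha> \<odot> \<sigma>) \<delta>" "\<alpha> = \<alpha> \<odot> \<sigma> \<odot> \<delta>" by (auto simp: green_R_def)
    then have "part_rank \<alpha> \<le> part_rank (\<alpha> \<odot> \<sigma>)" by (metis part_rank_composable(1))
    with part_rank_composable(1)[OF hom_set_composable[OF \<alpha> \<sigma>]]
    show "part_rank (\<alpha> \<odot> \<sigma>) = part_rank \<alpha>" by simp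
  next
    assume rk: "part_rank (\<alpha> \<odot> \<sigma>) = part_rank \<alpha>"
    define \<delta> where "\<delta> = star \<sigma> \<odot> star \<alpha> \<odot> \<alpha>"
    have \<delta>: "\<delta> \<in> hom_set K k n"
      unfolding \<delta>_def by (rule witness_right(2)[OF \<sigma>])
    have "\<alpha> = \<alpha> \<odot> \<sigma> \<odot> \<delta>"
      unfolding \<delta>_def by (rule retract_right[OF hom_set_Part[OF \<alpha>] hom_set_Part[OF \<sigma>] rk])
    then show "green_R K (\<alpha> \<odot> \<sigma>) \<alpha>"
      unfolding green_R_def
      using \<alpha> \<sigma> \<alpha>\<sigma> \<delta> hom_set_composable[OF \<alpha> \<sigma>] hom_set_composable[OF \<alpha>\<sigma> \<delta>]
      by (auto simp: hom_set_def)
  }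
qed

lemma green_L_iff:
  assumes \<sigma>: "\<sigma> \<in> hom_set K k m"
  shows "green_L K (\<sigma> \<odot> \<alpha>) \<alpha> \<longleftrightarrow> part_rank (\<sigma> \<odot> \<alpha>) = part_rank \<alpha>"
proof
  note \<sigma>\<alpha> = hom_set_prod[OF K \<sigma> \<alpha>]
  {
    assume "green_L K (\<sigma> \<odot> \<alpha>) \<alpha>"
    then obtain \<delta> where "composable \<delta> (\<sigma> \<odot> \<alpha>)" "\<alpha> = \<delta> \<odot> (\<sigma> \<odot> \<alpha>)" by (auto simp: green_L_def)
    then have "part_rank \<alpha> \<le> part_rank (\<sigma> \<odot> \<alpha>)" by (metis part_rank_composable(2))
    with part_rank_composable(2)[OF hom_set_composable[OF \<sigma> \<alpha>]]
    show "part_rank (\<sigma> \<odot> \<alpha>) = part_rank \<alpha>" by simp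
  next
    assume rk: "part_rank (\<sigma> \<odot> \<alpha>) = part_rank \<alpha>"
    define \<delta> where "\<delta> = \<alpha> \<odot> star \<alpha> \<odot> star \<sigma>"
    have \<delta>: "\<delta> \<in> hom_set K m k"
      unfolding \<delta>_def by (rule witness_left[OF \<sigma>])
    have "\<alpha> = \<delta> \<odot> (\<sigma> \<odot> \<alpha>)"
      unfolding \<delta>_def by (rule retract_left[OF hom_set_Part[OF \<alpha>] hom_set_Part[OF \<sigma>] rk])
    then show "green_L K (\<sigma> \<odot> \<alpha>) \<alpha>"
      unfolding green_L_def
      using \<alpha> \<sigma> \<sigma>\<alpha> \<delta> hom_set_composable[OF \<sigma> \<alpha>] hom_set_composable[OF \<delta> \<sigma>\<alpha>]
      by (auto simp: hom_set_def)
  }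
qed

text \<open>If \<open>rank (\<alpha>\<sigma>) = rank \<alpha>\<close>, then \<open>\<alpha> = \<alpha>\<sigma>\<delta>\<close> for some \<open>\<delta>\<close>, so \<open>\<sigma>\<alpha> = \<sigma>\<alpha>\<sigma>\<delta>\<close> has rank at most \<open>rank (\<sigma>\<alpha>\<sigma>)\<close>.\<close>
lemma part_rank_sandwich_iff:
  assumes \<sigma>: "\<sigma> \<in> hom_set K n m"
  shows "part_rank (\<sigma> \<odot> \<alpha> \<odot> \<sigma>) = part_rank \<alpha> \<longleftrightarrow>
    part_rank (\<alpha> \<odot> \<sigma>) = part_rank \<alpha> \<and> part_rank (\<sigma> \<odot> \<alpha>) = part_rank \<alpha>"
proof -
  note P = hom_set_Part[OF \<alpha>] hom_set_Part[OF \<sigma>]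
  note \<alpha>\<sigma> = hom_set_prod[OF K \<alpha> \<sigma>] and \<sigma>\<alpha> = hom_set_prod[OF K \<sigma> \<alpha>]
  have assoc: "\<sigma> \<odot> \<alpha> \<odot> \<sigma> = \<sigma> \<odot> (\<alpha> \<odot> \<sigma>)" by (rule part_prod_assoc[OF P(2,1,2)])
  note le = part_rank_composable(1)[OF hom_set_composable[OF \<alpha> \<sigma>]]
    part_rank_composable(2)[OF hom_set_composable[OF \<sigma> \<alpha>]]
    part_rank_composable(1)[OF hom_set_composable[OF \<sigma>\<alpha> \<sigma>]]
    part_rank_composable(2)[OF hom_set_composable[OF \<sigma> \<alpha>\<sigma>], folded assoc]
  have "part_rank (\<sigma> \<odot> \<alpha>) \<le> part_rank (\<sigma> \<odot> \<alpha> \<odot> \<sigma>)" if rk: "part_rank (\<alpha> \<odot> \<sigma>) = part_rank \<alpha>"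
  proof -
    define \<delta> where "\<delta> = star \<sigma> \<odot> star \<alpha> \<odot> \<alpha>"
    have \<delta>: "\<delta> \<in> hom_set K m n"
      unfolding \<delta>_def by (rule witness_right(2)[OF \<sigma>])
    have "\<sigma> \<odot> \<alpha> \<odot> \<sigma> \<odot> \<delta> = \<sigma> \<odot> (\<alpha> \<odot> \<sigma> \<odot> \<delta>)"
      unfolding assoc by (rule part_prod_assoc[OF P(2) hom_set_Part[OF \<alpha>\<sigma>] hom_set_Part[OF \<delta>]])
    also have "\<alpha> \<odot> \<sigma> \<odot> \<delta> = \<alpha>"
      unfolding \<delta>_def by (rule retract_right[OF P rk, symmetric])
    finally show ?thesis
      using part_rank_composable(1)[OF hom_set_composable[OF hom_set_prod[OF K \<sigma>\<alpha> \<sigma>] \<delta>]] by simp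
  qed
  with le show ?thesis by linarith
qed

lemma green_J_iff:
  assumes \<sigma>: "\<sigma> \<in> hom_set K n m"
  shows "green_J K (\<sigma> \<odot> \<alpha> \<odot> \<sigma>) \<alpha> \<longleftrightarrow> part_rank (\<sigma> \<odot> \<alpha> \<odot> \<sigma>) = part_rank \<alpha>"
proof
  note P = hom_set_Part[OF \<alpha>] hom_set_Part[OF \<sigma>]
  note \<alpha>\<sigma> = hom_set_prod[OF K \<alpha> \<sigma>] and \<sigma>\<alpha> = hom_set_prod[OF K \<sigma> \<alpha>]
  note \<sigma>\<alpha>\<sigma> = hom_set_prod[OF K \<sigma>\<alpha> \<sigma>]
  {
    assume "green_J K (\<sigma> \<odot> \<alpha> \<odot> \<sigma>) \<alpha>"
    then obtain \<gamma> \<delta> where "composable \<gamma> (\<sigma> \<odot> \<alpha> \<odot> \<sigma>)" "composable (\<sigma> \<odot> \<alpha> \<odot> \<sigma>) \<delta>"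
      "\<alpha> = \<gamma> \<odot> (\<sigma> \<odot> \<alpha> \<odot> \<sigma>) \<odot> \<delta>" by (auto simp: green_J_def)
    then have "part_rank \<alpha> \<le> part_rank (\<sigma> \<odot> \<alpha> \<odot> \<sigma>)" by (metis part_rank_composable_3)
    with part_rank_composable_3[OF hom_set_composable[OF \<sigma> \<alpha>] hom_set_composable[OF \<alpha> \<sigma>]]
    show "part_rank (\<sigma> \<odot> \<alpha> \<odot> \<sigma>) = part_rank \<alpha>" by simp
  next
    assume "part_rank (\<sigma> \<odot> \<alpha> \<odot> \<sigma>) = part_rank \<alpha>"
    then have rk: "part_rank (\<alpha> \<odot> \<sigma>) = part_rank \<alpha>" "part_rank (\<sigma> \<odot> \<alpha>) = part_rank \<alpha>"
      using part_rank_sandwich_iff[OF \<sigma>] by auto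
    define \<gamma> where "\<gamma> = \<alpha> \<odot> star \<alpha> \<odot> star \<sigma>"
    define \<delta> where "\<delta> = star \<sigma> \<odot> star \<alpha> \<odot> \<alpha>"
    have \<gamma>: "\<gamma> \<in> hom_set K m n" and \<delta>: "\<delta> \<in> hom_set K m n"
      unfolding \<gamma>_def \<delta>_def by (rule witness_left[OF \<sigma>], rule witness_right(2)[OF \<sigma>])
    have "\<gamma> \<odot> (\<sigma> \<odot> \<alpha> \<odot> \<sigma>) \<odot> \<delta> = \<gamma> \<odot> (\<sigma> \<odot> \<alpha> \<odot> \<sigma> \<odot> \<delta>)"
      by (rule part_prod_assoc[OF hom_set_Part[OF \<gamma>] hom_set_Part[OF \<sigma>\<alpha>\<sigma>] hom_set_Part[OF \<delta>]])
    also have "\<sigma> \<odot> \<alpha> \<odot> \<sigma> \<odot> \<delta> = \<sigma> \<odot> (\<alpha> \<odot> \<sigma> \<odot> \<delta>)"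
      unfolding part_prod_assoc[OF P(2,1,2)]
      by (rule part_prod_assoc[OF P(2) hom_set_Part[OF \<alpha>\<sigma>] hom_set_Part[OF \<delta>]])
    also have "\<alpha> \<odot> \<sigma> \<odot> \<delta> = \<alpha>"
      unfolding \<delta>_def by (rule retract_right[OF P rk(1), symmetric])
    also have "\<gamma> \<odot> (\<sigma> \<odot> \<alpha>) = \<alpha>"
      unfolding \<gamma>_def by (rule retract_left[OF P rk(2), symmetric])
    finally have 1: "\<alpha> = \<gamma> \<odot> (\<sigma> \<odot> \<alpha> \<odot> \<sigma>) \<odot> \<delta>" ..
    have mem: "\<alpha> \<in> K" "\<sigma> \<in> K" "\<gamma> \<in> K" "\<delta> \<in> K" "\<sigma> \<odot> \<alpha> \<odot> \<sigma> \<in> K"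
      using \<alpha> \<sigma> \<gamma> \<delta> \<sigma>\<alpha>\<sigma> by (auto simp: hom_set_def)
    show "green_J K (\<sigma> \<odot> \<alpha> \<odot> \<sigma>) \<alpha>"
      unfolding green_J_def
    proof (intro conjI)
      show "\<exists>\<gamma>'\<in>K. \<exists>\<delta>'\<in>K. composable \<gamma>' \<alpha> \<and> composable \<alpha> \<delta>' \<and> \<sigma> \<odot> \<alpha> \<odot> \<sigma> = \<gamma>' \<odot> \<alpha> \<odot> \<delta>'"
        using mem hom_set_composable[OF \<sigma> \<alpha>] hom_set_composable[OF \<alpha> \<sigma>] by blast
      show "\<exists>\<gamma>'\<in>K. \<exists>\<delta>'\<in>K. composable \<gamma>' (\<sigma> \<odot> \<alpha> \<odot> \<sigma>) \<and> composable (\<sigma> \<odot> \<alpha> \<odot> \<sigma>) \<delta>' \<and>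
          \<alpha> = \<gamma>' \<odot> (\<sigma> \<odot> \<alpha> \<odot> \<sigma>) \<odot> \<delta>'"
        using mem 1 hom_set_composable[OF \<gamma> \<sigma>\<alpha>\<sigma>] hom_set_composable[OF \<sigma>\<alpha>\<sigma> \<delta>] by blast
    qed (rule mem)+
  }
qed

text \<open>When the ranks agree, \<open>\<tau> = \<sigma>\<^sup>*\<alpha>\<^sup>*\<alpha>\<alpha>\<^sup>*\<sigma>\<^sup>*\<close> shows that \<open>\<alpha>\<close> is regular: \<open>retract_left\<close>
  reduces \<open>(\<alpha>\<sigma>)\<tau>(\<sigma>\<alpha>)\<close> to \<open>\<alpha>\<sigma>(\<sigma>\<^sup>*\<alpha>\<^sup>*\<alpha>)\<close>, and \<open>retract_right\<close> reduces this to \<open>\<alpha>\<close>.\<close>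
lemma sandwich_regular_iff:
  assumes \<sigma>: "\<sigma> \<in> hom_set K n m"
  shows "(\<exists>\<tau>\<in>hom_set K m n. \<alpha> = sandwich \<sigma> (sandwich \<sigma> \<alpha> \<tau>) \<alpha>) \<longleftrightarrow>
    part_rank (\<alpha> \<odot> \<sigma>) = part_rank \<alpha> \<and> part_rank (\<sigma> \<odot> \<alpha>) = part_rank \<alpha>"
proof
  note P = hom_set_Part[OF \<alpha>] hom_set_Part[OF \<sigma>]
  note \<alpha>\<sigma> = hom_set_prod[OF K \<alpha> \<sigma>] and \<sigma>\<alpha> = hom_set_prod[OF K \<sigma> \<alpha>]
  note le = part_rank_composable(1)[OF hom_set_composable[OF \<alpha> \<sigma>]]
    part_rank_composable(2)[OF hom_set_composable[OF \<sigma> \<alpha>]]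
  have eq: "sandwich \<sigma> (sandwich \<sigma> \<alpha> \<tau>) \<alpha> = \<alpha> \<odot> \<sigma> \<odot> (\<tau> \<odot> (\<sigma> \<odot> \<alpha>))" if "\<tau> \<in> hom_set K m n" for \<tau>
    unfolding sandwich_def
    using part_prod_assoc[OF hom_set_Part[OF hom_set_prod[OF K \<alpha>\<sigma> that]] P(2,1)]
      part_prod_assoc[OF hom_set_Part[OF \<alpha>\<sigma>] hom_set_Part[OF that] hom_set_Part[OF \<sigma>\<alpha>]] by simp
  {
    assume "\<exists>\<tau>\<in>hom_set K m n. \<alpha> = sandwich \<sigma> (sandwich \<sigma> \<alpha> \<tau>) \<alpha>"
    then obtain \<tau> where \<tau>: "\<tau> \<in> hom_set K m n" and "\<alpha> = sandwich \<sigma> (sandwich \<sigma> \<alpha> \<tau>) \<alpha>" by blast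
    then have reg: "\<alpha> = \<alpha> \<odot> \<sigma> \<odot> (\<tau> \<odot> (\<sigma> \<odot> \<alpha>))" by (simp add: eq)
    note \<tau>\<sigma>\<alpha> = hom_set_prod[OF K \<tau> \<sigma>\<alpha>]
    have "part_rank \<alpha> \<le> part_rank (\<alpha> \<odot> \<sigma>)"
      using part_rank_composable(1)[OF hom_set_composable[OF \<alpha>\<sigma> \<tau>\<sigma>\<alpha>], folded reg] .
    moreover have "part_rank \<alpha> \<le> part_rank (\<sigma> \<odot> \<alpha>)"
      using part_rank_composable(2)[OF hom_set_composable[OF \<alpha>\<sigma> \<tau>\<sigma>\<alpha>], folded reg]
        part_rank_composable(2)[OF hom_set_composable[OF \<tau> \<sigma>\<alpha>]] by simp
    ultimately show "part_rank (\<alpha> \<odot> \<sigma>) = part_rank \<alpha> \<and> part_rank (\<sigma> \<odot> \<alpha>) = part_rank \<alpha>"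
      using le by simp
  next
    assume rk: "part_rank (\<alpha> \<odot> \<sigma>) = part_rank \<alpha> \<and> part_rank (\<sigma> \<odot> \<alpha>) = part_rank \<alpha>"
    define \<epsilon> where "\<epsilon> = star \<sigma> \<odot> star \<alpha>"
    define \<gamma> where "\<gamma> = \<alpha> \<odot> star \<alpha> \<odot> star \<sigma>"
    have \<gamma>: "\<gamma> \<in> hom_set K m n" and \<epsilon>: "\<epsilon> \<in> hom_set K m m"
      unfolding \<gamma>_def \<epsilon>_def by (rule witness_left[OF \<sigma>], rule witness_right(1)[OF \<sigma>])
    note \<epsilon>\<gamma> = hom_set_prod[OF K \<epsilon> \<gamma>]
    have "sandwich \<sigma> (sandwich \<sigma> \<alpha> (\<epsilon> \<odot> \<gamma>)) \<alpha> = \<alpha> \<odot> \<sigma> \<odot> (\<epsilon> \<odot> \<gamma> \<odot> (\<sigma> \<odot> \<alpha>))" by (rule eq[OF \<epsilon>\<gamma>])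
    also have "\<epsilon> \<odot> \<gamma> \<odot> (\<sigma> \<odot> \<alpha>) = \<epsilon> \<odot> (\<gamma> \<odot> (\<sigma> \<odot> \<alpha>))"
      by (rule part_prod_assoc[OF hom_set_Part[OF \<epsilon>] hom_set_Part[OF \<gamma>] hom_set_Part[OF \<sigma>\<alpha>]])
    also have "\<gamma> \<odot> (\<sigma> \<odot> \<alpha>) = \<alpha>"
      unfolding \<gamma>_def using retract_left[OF P] rk by simp
    also have "\<alpha> \<odot> \<sigma> \<odot> (\<epsilon> \<odot> \<alpha>) = \<alpha>"
      unfolding \<epsilon>_def using retract_right[OF P] rk by simp
    finally show "\<exists>\<tau>\<in>hom_set K m n. \<alpha> = sandwich \<sigma> (sandwich \<sigma> \<alpha> \<tau>) \<alpha>" using \<epsilon>\<gamma> by metis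
  }
qed

end

theorem proposition5p7:
  fixes K :: "vertex set set set" and m n :: nat and \<sigma> :: "vertex set set"
  assumes "K \<in> {P_cat, PB_cat, B_cat, PP_cat, M_cat, TL_cat}"
    and "\<sigma> \<in> hom_set K n m"
  shows "P1 K m n \<sigma> = {\<alpha> \<in> hom_set K m n. part_rank (\<alpha> \<odot> \<sigma>) = part_rank \<alpha>}
    \<and> P2 K m n \<sigma> = {\<alpha> \<in> hom_set K m n. part_rank (\<sigma> \<odot> \<alpha>) = part_rank \<alpha>}
    \<and> Reg (hom_set K m n) (sandwich \<sigma>) = P12 K m n \<sigma>
    \<and> P12 K m n \<sigma> = P3 K m n \<sigma>
    \<and> P3 K m n \<sigma> = {\<alpha> \<in> hom_set K m n.
          part_rank (\<alpha> \<odot> \<sigma>) = part_rank (\<sigma> \<odot> \<alpha>) \<and> part_rank (\<sigma> \<odot> \<alpha>) = part_rank \<alpha>}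
    \<and> {\<alpha> \<in> hom_set K m n.
          part_rank (\<alpha> \<odot> \<sigma>) = part_rank (\<sigma> \<odot> \<alpha>) \<and> part_rank (\<sigma> \<odot> \<alpha>) = part_rank \<alpha>}
        = {\<alpha> \<in> hom_set K m n. part_rank (\<sigma> \<odot> \<alpha> \<odot> \<sigma>) = part_rank \<alpha>}"
proof -
  note K = star_subcategory_cases[OF assms(1)] and \<sigma> = assms(2)
  let ?H = "hom_set K m n"
  have P1: "P1 K m n \<sigma> = {\<alpha> \<in> ?H. part_rank (\<alpha> \<odot> \<sigma>) = part_rank \<alpha>}"
    unfolding P1_def using green_R_iff[OF K _ \<sigma>] by blast
  have P2: "P2 K m n \<sigma> = {\<alpha> \<in> ?H. part_rank (\<sigma> \<odot> \<alpha>) = part_rank \<alpha>}"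
    unfolding P2_def using green_L_iff[OF K _ \<sigma>] by blast
  have P3: "P3 K m n \<sigma> = {\<alpha> \<in> ?H. part_rank (\<sigma> \<odot> \<alpha> \<odot> \<sigma>) = part_rank \<alpha>}"
    unfolding P3_def using green_J_iff[OF K _ \<sigma>] by blast
  have Reg: "Reg ?H (sandwich \<sigma>) = {\<alpha> \<in> ?H. part_rank (\<alpha> \<odot> \<sigma>) = part_rank \<alpha> \<and> part_rank (\<sigma> \<odot> \<alpha>) = part_rank \<alpha>}"
    unfolding Reg_def using sandwich_regular_iff[OF K _ \<sigma>] by blast
  have P12: "P12 K m n \<sigma> = {\<alpha> \<in> ?H. part_rank (\<alpha> \<odot> \<sigma>) = part_rank \<alpha> \<and> part_rank (\<sigma> \<odot> \<alpha>) = part_rank \<alpha>}"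
    unfolding P12_def P1 P2 by blast
  have ranks: "{\<alpha> \<in> ?H. part_rank (\<alpha> \<odot> \<sigma>) = part_rank (\<sigma> \<odot> \<alpha>) \<and> part_rank (\<sigma> \<odot> \<alpha>) = part_rank \<alpha>} =
      {\<alpha> \<in> ?H. part_rank (\<alpha> \<odot> \<sigma>) = part_rank \<alpha> \<and> part_rank (\<sigma> \<odot> \<alpha>) = part_rank \<alpha>}"
    by (rule Collect_cong) metis
  have sandwich: "{\<alpha> \<in> ?H. part_rank (\<sigma> \<odot> \<alpha> \<odot> \<sigma>) = part_rank \<alpha>} =
      {\<alpha> \<in> ?H. part_rank (\<alpha> \<odot> \<sigma>) = part_rank \<alpha> \<and> part_rank (\<sigma> \<odot> \<alpha>) = part_rank \<alpha>}"
    using part_rank_sandwich_iff[OF K _ \<sigma>] by blast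
  show ?thesis
    using P1 P2 P3 Reg P12 ranks sandwich by simp
qed

end
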